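(* Let $0<q<1$, $T>0$, $\varphi\in W^2_{q,\mathcal L}[0,1]$, $f\in C_q\big([0,T];W^2_{q,\mathcal L}[0,1]\big)$ and $\psi\in C^1_q[0,T]$. Suppose there is a positive real number $M_1$ such that $$\left|\int_0^1 f(t,x)\,d_qx\right|^{-1}\le M_1,\qquad 0<t\le T.$$ Then the following inverse source problem is locally well-posed in time: find a pair of functions $\{u(t,x),\upsilon(t)\}$ satisfying $$D_{q,t}u(t,x)+\mathcal L u(t,x)=\upsilon(t)f(t,x),\qquad 0<x<1,\ t>0,$$ the initial condition $$u(0,x)=\varphi(x),\qquad 0<x<1,$$ and the over-determination condition $$\int_0^1 u(t,x)\,d_qx=\psi(t),\qquad t>0,$$ where $\mathcal L$ acts in the variable $x$ and includes the boundary conditions $u(t,0)=u(t,1)=0$.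
   Context: Throughout $0<q<1$. **$q$-calculus.** The Jackson $q$-derivative is $D_qg(x)=\frac{g(x)-g(qx)}{(1-q)x}$ for $x\neq 0$ (with the value at $0$ understood as the limit of $D_q g(xq^n)$ as $n\to\infty$). $D_{q^{-1}}$ is the same expression with $q$ replaced by $q^{-1}$. The partial operators are $D_{q,x}u(t,x)=\frac{u(t,x)-u(t,qx)}{(1-q)x}$ and $D_{q,t}u(t,x)=\frac{u(t,x)-u(qt,x)}{(1-q)t}$. The Jackson integral is $\int_a^b g(t)\,d_qt=(1-q)\sum_{m=0}^\infty q^m\,[\,b\,g(bq^m)-a\,g(aq^m)\,]$. **The space $L^2_q[0,1]$.** It is the Hilbert space of real-valued functions $g$ on $[0,1]$ with $\|g\|_{L^2_q[0,1]}=\big(\int_0^1|g(x)|^2d_qx\big)^{1/2}<\infty$ and inner product $\langle g,h\rangle=\int_0^1 g(x)h(x)\,d_qx$. **The operator $\mathcal L$.** $C^2_{q,0}[0,1]$ is the space of functions $y$ such that $y$ and $D_qy$ are continuous at zero. $\mathcal L$ is the operator $\mathcal L y=-\frac1q D_{q^{-1}}D_q y$ on functions $y\in C^2_{q,0}[0,1]\cap L^2_q[0,1]$ with $y(0)=y(1)=0$. It is treated as a self-adjoint operator with positive eigenvalues $\lambda_k$, $k\ge1$, given by the zeros of $\lambda\mapsto\sin(\sqrt\lambda;q^2)$, and eigenfunctions $\phi_k(x)=\sin(\sqrt{\lambda_k}\,x;q^2)/\sqrt{\lambda_k}$ forming an orthogonal basis of $L^2_q[0,1]$, where $\sin(z;q^2)=\sum_{n\ge0}\frac{(-1)^nq^{n(n+1)}z^{2n+1}}{[2n+1]_q!}$,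 $[n]_q=\frac{1-q^n}{1-q}$, $[n]_q!=[1]_q\cdots[n]_q$, $[0]_q!=1$. **Sobolev space.** $C^\infty_{\mathcal L}[0,1]$ is the space of all $g\in L^2_q[0,1]$ with $\mathcal L^k g\in \mathrm{Dom}(\mathcal L)$ for all $k\ge 0$, with the Fréchet topology of the norms $\max_{i\le k}\|\mathcal L^i g\|_{L^2_q[0,1]}$, $k\in\mathbb N_0$. $\mathcal D'_{\mathcal L}[0,1]$ is the space of continuous linear functionals on $C^\infty_{\mathcal L}[0,1]$, and $\mathcal L$ acts on it by duality. Then $W^2_{q,\mathcal L}[0,1]=\{g\in\mathcal D'_{\mathcal L}[0,1]:\ \mathcal L g\in L^2_q[0,1]\}$ with norm $\|g\|_{W^2_{q,\mathcal L}}=\|\mathcal L g\|_{L^2_q[0,1]}$. **Time-dependent spaces.** For a normed space $X$ (such as $\mathbb R$, $L^2_q[0,1]$, $W^2_{q,\mathcal L}[0,1]$) and $k\in\mathbb N_0$, $C^k_q([0,T];X)$ is the space of $u:[0,T]\to X$ with $D_{q,t}^n u$ continuous on $[0,T]$ for $0\le n\le k$, with norm $\sum_{n=0}^k\max_{0\le t\le T}\|D^n_{q,t}u(t,\cdot)\|_X$; $C_q=C^0_q$, and $C^k_q[0,T]=C^k_q([0,T];\mathbb R)$. **Local well-posedness in time.** This means that there is $T_0\in(0,T]$ such that on the time interval $[0,T_0]$ the problem has a solution pair $(u,\upsilon)$ with $\upsilon\in C_q[0,T_0]$, $u\in C_q([0,T_0];W^2_{q,\mathcal L}[0,1])$ and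 $D_{q,t}u\in C_q([0,T_0];L^2_q[0,1])$, that this pair is unique in this class, and that it depends continuously on the data $(\varphi,f,\psi)$ in the norms of the corresponding spaces.
   Formalization: The compatibility condition ∫_0^1 φ(x) d_qx = ψ(0) is assumed, for the given data and for the nearby data in the continuous dependence; without it (e.g. φ=0, ψ=1) no solution pair exists, since ∫_0^1 u(t,x) d_qx is continuous at t=0. *)

theory Defs
  imports "HOL-Analysis.Analysis"
begin

text \<open>Functions on an interval are total functions on the reals. The quotient for the base \<open>p\<close> is
  used with \<open>p = q\<close> and \<open>p = 1/q\<close>; in both cases the value at \<open>0\<close> is the limit
  along \<open>y q^n\<close>, for every \<open>y > 0\<close>.\<close>

definition qquot :: "real \<Rightarrow> (real \<Rightarrow> real) \<Rightarrow> real \<Rightarrow> real" where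
  "qquot p g x = (g x - g (p * x)) / ((1 - p) * x)"

definition qderiv :: "real \<Rightarrow> real \<Rightarrow> (real \<Rightarrow> real) \<Rightarrow> real \<Rightarrow> real" where
  "qderiv q p g x =
     (if x = 0 then (THE l. \<forall>y>0. (\<lambda>n. qquot p g (y * q ^ n)) \<longlonglongrightarrow> l) else qquot p g x)"

definition Dq :: "real \<Rightarrow> (real \<Rightarrow> real) \<Rightarrow> real \<Rightarrow> real" where
  "Dq q = qderiv q q"

definition Dqinv :: "real \<Rightarrow> (real \<Rightarrow> real) \<Rightarrow> real \<Rightarrow> real" where
  "Dqinv q = qderiv q (1 / q)"

definition Dqt :: "real \<Rightarrow> (real \<Rightarrow> real \<Rightarrow> real) \<Rightarrow> real \<Rightarrow> real \<Rightarrow> real" where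
  "Dqt q u t x = Dq q (\<lambda>s. u s x) t"

definition jackson_integral :: "real \<Rightarrow> real \<Rightarrow> real \<Rightarrow> (real \<Rightarrow> real) \<Rightarrow> real" where
  "jackson_integral q a b g =
     (1 - q) * (\<Sum>m. q ^ m * (b * g (b * q ^ m) - a * g (a * q ^ m)))"

text \<open>The norm on \<open>L2q\<close> is a seminorm on functions: it sees only the points \<open>q^n\<close>. The elements
  of the Hilbert space are the classes of functions that agree at all points \<open>q^n\<close>.\<close>

definition L2q :: "real \<Rightarrow> (real \<Rightarrow> real) set" where
  "L2q q = {g. summable (\<lambda>m. q ^ m * \<bar>g (q ^ m)\<bar>\<^sup>2)}"

definition L2q_norm :: "real \<Rightarrow> (real \<Rightarrow> real) \<Rightarrow> real" where
  "L2q_norm q g = sqrt (jackson_integral q 0 1 (\<lambda>x. \<bar>g x\<bar>\<^sup>2))"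

definition L2q_inner :: "real \<Rightarrow> (real \<Rightarrow> real) \<Rightarrow> (real \<Rightarrow> real) \<Rightarrow> real" where
  "L2q_inner q g h = jackson_integral q 0 1 (\<lambda>x. g x * h x)"

definition C2q0 :: "real \<Rightarrow> (real \<Rightarrow> real) set" where
  "C2q0 q = {y. continuous (at 0 within {0..1}) y \<and> continuous (at 0 within {0..1}) (Dq q y)}"

text \<open>For \<open>q < x \<le> 1\<close> the expression \<open>Lop q y x\<close> reads \<open>y\<close> at \<open>x/q > 1\<close>, so a function on
  \<open>[0,1]\<close> is used together with an extension. Of the points \<open>q^n\<close> only \<open>x = 1\<close> is affected.
  In the test space, \<open>L^k g (1) = 0\<close> is required for every \<open>k\<close>, so no choice remains there.\<close>

definition Lop :: "real \<Rightarrow> (real \<Rightarrow> real) \<Rightarrow> real \<Rightarrow> real" where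
  "Lop q y x = - (1 / q) * Dqinv q (Dq q y) x"

definition DomL :: "real \<Rightarrow> (real \<Rightarrow> real) set" where
  "DomL q = {y. y \<in> C2q0 q \<and> y \<in> L2q q \<and> y 0 = 0 \<and> y 1 = 0}"

definition CinfL :: "real \<Rightarrow> (real \<Rightarrow> real) set" where
  "CinfL q = {g \<in> L2q q. \<forall>k. (Lop q ^^ k) g \<in> DomL q}"

definition CinfL_norm :: "real \<Rightarrow> nat \<Rightarrow> (real \<Rightarrow> real) \<Rightarrow> real" where
  "CinfL_norm q k g = Max ((\<lambda>i. L2q_norm q ((Lop q ^^ i) g)) ` {..k})"

text \<open>Continuity for the topology of the increasing family of seminorms \<open>CinfL_norm q k\<close>.
  Only the values of a functional on \<open>CinfL q\<close> are relevant.\<close>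

definition distrL :: "real \<Rightarrow> ((real \<Rightarrow> real) \<Rightarrow> real) set" where
  "distrL q = {G.
     (\<forall>g\<in>CinfL q. \<forall>h\<in>CinfL q. \<forall>a b. G (\<lambda>x. a * g x + b * h x) = a * G g + b * G h) \<and>
     (\<forall>g\<in>CinfL q. \<forall>\<epsilon>>0. \<exists>k. \<exists>\<delta>>0. \<forall>h\<in>CinfL q.
        CinfL_norm q k (\<lambda>x. h x - g x) < \<delta> \<longrightarrow> \<bar>G h - G g\<bar> < \<epsilon>)}"

definition L_distr :: "real \<Rightarrow> ((real \<Rightarrow> real) \<Rightarrow> real) \<Rightarrow> (real \<Rightarrow> real) \<Rightarrow> real" where
  "L_distr q G g = G (Lop q g)"

definition represents :: "real \<Rightarrow> (real \<Rightarrow> real) \<Rightarrow> ((real \<Rightarrow> real) \<Rightarrow> real) \<Rightarrow> bool" where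
  "represents q h G \<longleftrightarrow> h \<in> L2q q \<and> (\<forall>g\<in>CinfL q. G g = L2q_inner q h g)"

definition W2L_distr :: "real \<Rightarrow> ((real \<Rightarrow> real) \<Rightarrow> real) set" where
  "W2L_distr q = {G \<in> distrL q. \<exists>h. represents q h (L_distr q G)}"

text \<open>Test functions vanish at \<open>1\<close>, so a function representing a functional is determined at the
  points \<open>q^n\<close> with \<open>n \<ge> 1\<close> but not at \<open>1\<close>. The norm of the class is the least norm of a
  representative, i.e. the norm of the representative that vanishes at \<open>1\<close> (like all
  eigenfunctions of the operator).\<close>

definition W2L_distr_norm :: "real \<Rightarrow> ((real \<Rightarrow> real) \<Rightarrow> real) \<Rightarrow> real" where
  "W2L_distr_norm q G = Inf {L2q_norm q h | h. represents q h (L_distr q G)}"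

text \<open>The functional \<open>L2q_inner q y\<close> is the function \<open>y\<close> seen as an element of the dual space.
  The elements of the Sobolev space are such functions, with the boundary values of the operator;
  the condition at \<open>1\<close> has to be stated because the functional does not see \<open>y 1\<close>.\<close>

definition W2L :: "real \<Rightarrow> (real \<Rightarrow> real) set" where
  "W2L q = {y \<in> L2q q. y 0 = 0 \<and> y 1 = 0 \<and> L2q_inner q y \<in> W2L_distr q}"

definition W2L_norm :: "real \<Rightarrow> (real \<Rightarrow> real) \<Rightarrow> real" where
  "W2L_norm q y = W2L_distr_norm q (L2q_inner q y)"

text \<open>\<open>CqX q k T X N\<close> is \<open>C^k_q([0,T];X)\<close> for a space \<open>X\<close> of functions of \<open>x\<close> with norm \<open>N\<close>.\<close>

definition CqX :: "real \<Rightarrow> nat \<Rightarrow> real \<Rightarrow> (real \<Rightarrow> real) set \<Rightarrow> ((real \<Rightarrow> real) \<Rightarrow> real)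
    \<Rightarrow> (real \<Rightarrow> real \<Rightarrow> real) set" where
  "CqX q k T X N = {u. \<forall>n\<le>k. \<forall>t\<in>{0..T}. (Dqt q ^^ n) u t \<in> X \<and>
     ((\<lambda>s. N (\<lambda>x. (Dqt q ^^ n) u s x - (Dqt q ^^ n) u t x)) \<longlongrightarrow> 0) (at t within {0..T})}"

definition CqX_norm :: "real \<Rightarrow> nat \<Rightarrow> real \<Rightarrow> ((real \<Rightarrow> real) \<Rightarrow> real)
    \<Rightarrow> (real \<Rightarrow> real \<Rightarrow> real) \<Rightarrow> real" where
  "CqX_norm q k T N u = (\<Sum>n\<le>k. SUP t\<in>{0..T}. N ((Dqt q ^^ n) u t))"

definition Cq :: "real \<Rightarrow> nat \<Rightarrow> real \<Rightarrow> (real \<Rightarrow> real) set" where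
  "Cq q k T = {g. \<forall>n\<le>k. continuous_on {0..T} ((Dq q ^^ n) g)}"

definition Cq_norm :: "real \<Rightarrow> nat \<Rightarrow> real \<Rightarrow> (real \<Rightarrow> real) \<Rightarrow> real" where
  "Cq_norm q k T g = (\<Sum>n\<le>k. SUP t\<in>{0..T}. \<bar>(Dq q ^^ n) g t\<bar>)"

text \<open>Equations in \<open>x\<close> are equations in \<open>L^2_q\<close>: they hold at the points \<open>q^n\<close> of \<open>(0,1)\<close>. There
  \<open>Lop\<close> reads its argument inside \<open>[0,1]\<close> only.\<close>

definition lattice_points :: "real \<Rightarrow> real set" where
  "lattice_points q = {x. 0 < x \<and> x < 1 \<and> (\<exists>n::nat. x = q ^ n)}"

definition solution_pair :: "real \<Rightarrow> real \<Rightarrow> (real \<Rightarrow> real) \<Rightarrow> (real \<Rightarrow> real \<Rightarrow> real) \<Rightarrow> (real \<Rightarrow> real)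
    \<Rightarrow> (real \<Rightarrow> real \<Rightarrow> real) \<Rightarrow> (real \<Rightarrow> real) \<Rightarrow> bool" where
  "solution_pair q T0 \<phi> f \<psi> u \<upsilon> \<longleftrightarrow>
     \<upsilon> \<in> Cq q 0 T0 \<and>
     u \<in> CqX q 0 T0 (W2L q) (W2L_norm q) \<and>
     Dqt q u \<in> CqX q 0 T0 (L2q q) (L2q_norm q) \<and>
     (\<forall>t. 0 < t \<and> t \<le> T0 \<longrightarrow>
        (\<forall>x\<in>lattice_points q. Dqt q u t x + Lop q (u t) x = \<upsilon> t * f t x)) \<and>
     (\<forall>t\<in>{0..T0}. u t 0 = 0 \<and> u t 1 = 0) \<and>
     (\<forall>x\<in>lattice_points q. u 0 x = \<phi> x) \<and>
     (\<forall>t. 0 < t \<and> t \<le> T0 \<longrightarrow> jackson_integral q 0 1 (u t) = \<psi> t)"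

definition data_space :: "real \<Rightarrow> real
    \<Rightarrow> ((real \<Rightarrow> real) \<times> (real \<Rightarrow> real \<Rightarrow> real) \<times> (real \<Rightarrow> real)) set" where
  "data_space q T = W2L q \<times> CqX q 0 T (W2L q) (W2L_norm q) \<times> Cq q 1 T"

text \<open>Compatibility of the initial condition with the over-determination condition. Both sides of
  the latter are continuous on \<open>[0,T0]\<close>, so it extends to \<open>t = 0\<close> and no solution pair exists
  for data that are not compatible.\<close>

definition compatible_data :: "real \<Rightarrow> (real \<Rightarrow> real) \<Rightarrow> (real \<Rightarrow> real) \<Rightarrow> bool" where
  "compatible_data q \<phi> \<psi> \<longleftrightarrow> jackson_integral q 0 1 \<phi> = \<psi> 0"

text \<open>Continuous dependence is continuity, at the given data, of the map from compatible data to
  solution pairs; that nearby data have a solution pair on the same interval is part of it.\<close>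

definition locally_well_posed :: "real \<Rightarrow> real \<Rightarrow> (real \<Rightarrow> real) \<Rightarrow> (real \<Rightarrow> real \<Rightarrow> real)
    \<Rightarrow> (real \<Rightarrow> real) \<Rightarrow> bool" where
  "locally_well_posed q T \<phi> f \<psi> \<longleftrightarrow> (\<exists>T0. 0 < T0 \<and> T0 \<le> T \<and>
     (\<exists>u \<upsilon>. solution_pair q T0 \<phi> f \<psi> u \<upsilon>) \<and>
     (\<forall>u \<upsilon> u' \<upsilon>'. solution_pair q T0 \<phi> f \<psi> u \<upsilon> \<and> solution_pair q T0 \<phi> f \<psi> u' \<upsilon>' \<longrightarrow>
        (\<forall>t\<in>{0..T0}. \<upsilon>' t = \<upsilon> t \<and> L2q_norm q (\<lambda>x. u' t x - u t x) = 0)) \<and>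
     (\<forall>u \<upsilon>. solution_pair q T0 \<phi> f \<psi> u \<upsilon> \<longrightarrow>
        (\<forall>\<epsilon>>0. \<exists>\<delta>>0. \<forall>\<phi>' f' \<psi>'.
           (\<phi>', f', \<psi>') \<in> data_space q T \<and> compatible_data q \<phi>' \<psi>' \<and>
           W2L_norm q (\<lambda>x. \<phi>' x - \<phi> x) < \<delta> \<and>
           CqX_norm q 0 T (W2L_norm q) (\<lambda>t x. f' t x - f t x) < \<delta> \<and>
           Cq_norm q 1 T (\<lambda>t. \<psi>' t - \<psi> t) < \<delta> \<longrightarrow>
           (\<exists>u' \<upsilon>'. solution_pair q T0 \<phi>' f' \<psi>' u' \<upsilon>') \<and>
           (\<forall>u' \<upsilon>'. solution_pair q T0 \<phi>' f' \<psi>' u' \<upsilon>' \<longrightarrow>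
              Cq_norm q 0 T0 (\<lambda>t. \<upsilon>' t - \<upsilon> t) < \<epsilon> \<and>
              CqX_norm q 0 T0 (W2L_norm q) (\<lambda>t x. u' t x - u t x) < \<epsilon> \<and>
              CqX_norm q 0 T0 (L2q_norm q) (Dqt q (\<lambda>t x. u' t x - u t x)) < \<epsilon>))))"

end

theory Submission
  imports Defs
begin

text \<open>
Only the points \<open>q\<^sup>n\<close> of the space variable are seen by the norms, and in time the equation at
\<open>t\<close> involves \<open>t\<close> and \<open>q t\<close> only. With \<open>\<tau> = (1 - q) t\<close> it reads
\<open>u(t) + \<tau> L u(t) = u(q t) + \<tau> \<upsilon>(t) f(t)\<close>: an implicit Euler step on a geometric time grid whose
points accumulate at \<open>0\<close>.

Take \<open>w = L u\<close> as the unknown, so that the norm of \<open>u\<close> in the Sobolev space is the Hilbert norm of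
\<open>w\<close>. The inverse of \<open>L\<close> with its boundary conditions is Green's operator \<open>G\<close>, which is bounded,
symmetric, positive and injective with dense range. The Sobolev space consists of the functions that
vanish at \<open>0\<close> and \<open>1\<close> and whose values at the points \<open>q\<^sup>n\<close> lie in the range of \<open>G\<close>
(\<open>W2L_iff\<close>, \<open>W2L_norm_eq\<close>); for this one needs enough test functions, namely some \<open>g\<close> for which
\<open>L g\<close> is a given unit vector (\<open>test_function\<close>). With \<open>k = L f\<close> and the resolvent
\<open>R(\<tau>) = G (G + \<tau>)\<^sup>-\<^sup>1\<close> the equation becomes \<open>w(t) = R(\<tau>) (w(q t) + \<tau> \<upsilon>(t) k(t))\<close>, and
positivity of \<open>G\<close> makes \<open>R(\<tau>)\<close> a contraction that depends strongly continuously on \<open>\<tau> \<ge> 0\<close>.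

Integrating the equation over \<open>[0,1]\<close> turns the over-determination condition, for compatible data,
into \<open>\<upsilon>(t) \<integral>f(t) = D\<^sub>q \<psi>(t) + \<integral>w(t)\<close>. As \<open>\<integral>f(t)\<close> is bounded away from \<open>0\<close>, this determines
\<open>\<upsilon>(t)\<close> explicitly from \<open>w(q t)\<close> as long as \<open>t\<close> is small, and one obtains a step map from
\<open>w(q t)\<close> to \<open>w(t)\<close> with Lipschitz constant \<open>exp (c \<tau>)\<close>. Composing the steps for
\<open>t, q t, q\<^sup>2 t, \<dots>\<close> gives Lipschitz constants bounded by \<open>exp (c t)\<close>, since the step sizes add up to
at most \<open>t\<close>. If the initial value lies in the range of \<open>G\<close>, one step of size \<open>\<tau>\<close> moves it by
\<open>O(\<tau>)\<close>, so the composed maps applied to it form a geometrically convergent sequence; by density and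
the uniform Lipschitz bound they converge uniformly for every initial value (\<open>iterate_Cauchy\<close>), and
the limit is a solution (\<open>existence\<close>).

For uniqueness and continuous dependence, the distance \<open>N(t)\<close> of two solutions satisfies
\<open>N(t) \<le> N(q t) + (1 - q) t (a N(t) + b)\<close>, where \<open>b\<close> measures the distance of the data, and
a Gronwall inequality for the geometric grid bounds it by a multiple of \<open>N(0) + b\<close>
(\<open>gronwall_geometric\<close>, \<open>stability\<close>). All constants are uniform for data near the given ones, so one
time interval serves for all of them.
\<close>

section \<open>Square-summable sequences\<close>

lemma summable_mult_of_squares:
  fixes a b :: "nat \<Rightarrow> real"
  assumes "summable (\<lambda>i. (a i)\<^sup>2)" "summable (\<lambda>i. (b i)\<^sup>2)"
  shows "summable (\<lambda>i. \<bar>a i * b i\<bar>)" "summable (\<lambda>i. a i * b i)"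
proof -
  show "summable (\<lambda>i. \<bar>a i * b i\<bar>)"
  proof (rule summable_comparison_test')
    show "summable (\<lambda>i. (a i)\<^sup>2 + (b i)\<^sup>2)"
      by (intro summable_add assms)
    show "norm \<bar>a n * b n\<bar> \<le> (a n)\<^sup>2 + (b n)\<^sup>2" if "n \<ge> 0" for n
    proof -
      have "2 * (\<bar>a n\<bar> * \<bar>b n\<bar>) \<le> (a n)\<^sup>2 + (b n)\<^sup>2"
        using sum_squares_bound[of "\<bar>a n\<bar>" "\<bar>b n\<bar>"] by simp
      moreover have "0 \<le> \<bar>a n\<bar> * \<bar>b n\<bar>" by simp
      ultimately have "\<bar>a n\<bar> * \<bar>b n\<bar> \<le> (a n)\<^sup>2 + (b n)\<^sup>2" by linarith
      then show ?thesis by (simp add: abs_mult)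
    qed
  qed
  then show "summable (\<lambda>i. a i * b i)"
    by (rule summable_rabs_cancel)
qed

lemma summable_square_add:
  fixes a b :: "nat \<Rightarrow> real"
  assumes "summable (\<lambda>i. (a i)\<^sup>2)" "summable (\<lambda>i. (b i)\<^sup>2)"
  shows "summable (\<lambda>i. (a i + b i)\<^sup>2)"
proof -
  have "summable (\<lambda>i. (a i)\<^sup>2 + (b i)\<^sup>2 + 2 * (a i * b i))"
    by (intro summable_add summable_mult summable_mult_of_squares(2) assms)
  then show ?thesis by (simp add: power2_sum algebra_simps)
qed

typedef l2 = "{a :: nat \<Rightarrow> real. summable (\<lambda>i. (a i)\<^sup>2)}" morphisms coord Abs_l2
  by (rule exI[of _ "\<lambda>_. 0"]) simp

setup_lifting type_definition_l2

lemma summable_coord_square: "summable (\<lambda>i. (coord x i)\<^sup>2)"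
  using coord[of x] by simp

lemma l2_eqI: "(\<And>i. coord x i = coord y i) \<Longrightarrow> x = y"
  by (simp add: coord_inject[symmetric] fun_eq_iff)

instantiation l2 :: real_inner
begin

lift_definition zero_l2 :: l2 is "\<lambda>_. 0" by simp
lift_definition plus_l2 :: "l2 \<Rightarrow> l2 \<Rightarrow> l2" is "\<lambda>a b i. a i + b i"
  by (rule summable_square_add)
lift_definition minus_l2 :: "l2 \<Rightarrow> l2 \<Rightarrow> l2" is "\<lambda>a b i. a i - b i"
  using summable_square_add[where b = "\<lambda>i. - b i" for b] by simp
lift_definition uminus_l2 :: "l2 \<Rightarrow> l2" is "\<lambda>a i. - a i" by simp
lift_definition scaleR_l2 :: "real \<Rightarrow> l2 \<Rightarrow> l2" is "\<lambda>r a i. r * a i"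
  by (simp add: power_mult_distrib summable_mult)
lift_definition inner_l2 :: "l2 \<Rightarrow> l2 \<Rightarrow> real" is "\<lambda>a b. \<Sum>i. a i * b i" .

definition norm_l2 :: "l2 \<Rightarrow> real" where "norm_l2 x = sqrt (inner x x)"
definition sgn_l2 :: "l2 \<Rightarrow> l2" where "sgn_l2 x = inverse (norm x) *\<^sub>R x"
definition dist_l2 :: "l2 \<Rightarrow> l2 \<Rightarrow> real" where "dist_l2 x y = norm (x - y)"
definition uniformity_l2 :: "(l2 \<times> l2) filter"
  where "uniformity_l2 = (INF e\<in>{0 <..}. principal {(x, y). dist x y < e})"
definition open_l2 :: "l2 set \<Rightarrow> bool"
  where "open_l2 U \<longleftrightarrow> (\<forall>x\<in>U. \<forall>\<^sub>F (x', y) in uniformity. x' = x \<longrightarrow> y \<in> U)"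

instance
proof
  fix x y z :: l2 and r s :: real
  note ops = plus_l2.rep_eq minus_l2.rep_eq uminus_l2.rep_eq zero_l2.rep_eq scaleR_l2.rep_eq
  show "x + y + z = x + (y + z)" "x + y = y + x" "0 + x = x" "- x + x = 0" "x - y = x + - y"
    "r *\<^sub>R (x + y) = r *\<^sub>R x + r *\<^sub>R y" "(r + s) *\<^sub>R x = r *\<^sub>R x + s *\<^sub>R x"
    "r *\<^sub>R s *\<^sub>R x = (r * s) *\<^sub>R x" "1 *\<^sub>R x = x"
    by (auto intro!: l2_eqI simp: ops algebra_simps)
  show "dist x y = norm (x - y)" "sgn x = inverse (norm x) *\<^sub>R x"
    "uniformity = (INF e\<in>{0 <..}. principal {(x::l2, y). dist x y < e})"
    "norm x = sqrt (inner x x)"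
    by (simp_all add: dist_l2_def sgn_l2_def uniformity_l2_def norm_l2_def)
  show "open U \<longleftrightarrow> (\<forall>x\<in>U. \<forall>\<^sub>F (x', y) in uniformity. x' = x \<longrightarrow> y \<in> U)" for U :: "l2 set"
    by (rule open_l2_def)
  have summ: "summable (\<lambda>i. coord x i * coord y i)" for x y
    by (intro summable_mult_of_squares summable_coord_square)
  show "inner x y = inner y x"
    by (simp add: inner_l2.rep_eq mult.commute)
  show "inner (x + y) z = inner x z + inner y z"
    by (simp add: inner_l2.rep_eq ops distrib_right suminf_add summ)
  show "inner (r *\<^sub>R x) y = r * inner x y"
    by (simp add: inner_l2.rep_eq ops suminf_mult summ mult.assoc)
  show "0 \<le> inner x x"
    by (simp add: inner_l2.rep_eq suminf_nonneg summ)
  have "inner x x = 0 \<longleftrightarrow> (\<forall>i. coord x i * coord x i = 0)"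
    unfolding inner_l2.rep_eq by (rule suminf_eq_zero_iff[OF summ]) simp
  also have "\<dots> \<longleftrightarrow> x = 0"
    by (auto intro: l2_eqI simp: ops)
  finally show "inner x x = 0 \<longleftrightarrow> x = 0" .
qed

end

lemma coord_add: "coord (x + y) i = coord x i + coord y i"
  and coord_diff: "coord (x - y) i = coord x i - coord y i"
  and coord_scaleR: "coord (r *\<^sub>R x) i = r * coord x i"
  by (simp_all add: plus_l2.rep_eq minus_l2.rep_eq scaleR_l2.rep_eq)

lemma inner_l2_sums: "(\<lambda>i. coord x i * coord y i) sums inner x y"
  unfolding inner_l2.rep_eq
  by (intro summable_sums summable_mult_of_squares summable_coord_square)

lemma norm_l2_sums: "(\<lambda>i. (coord x i)\<^sup>2) sums (norm x)\<^sup>2"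
  using inner_l2_sums[of x x] by (simp add: power2_eq_square dot_square_norm)

lemma sum_square_coord_le: "(\<Sum>i<n. (coord x i)\<^sup>2) \<le> (norm x)\<^sup>2"
  using sum_le_suminf[OF summable_coord_square, of "{..<n}" x] norm_l2_sums[of x]
  by (simp add: sums_iff)

lemma abs_coord_le_norm: "\<bar>coord x i\<bar> \<le> norm x"
proof -
  have "(coord x i)\<^sup>2 \<le> (\<Sum>j<Suc i. (coord x j)\<^sup>2)"
    by (simp add: sum_nonneg)
  also have "\<dots> \<le> (norm x)\<^sup>2" by (rule sum_square_coord_le)
  finally show ?thesis by (simp add: abs_le_square_iff[symmetric])
qed

lemma bounded_linear_coord: "bounded_linear (\<lambda>x. coord x i)"
  by (rule bounded_linear_intro[where K = 1]) (auto simp: coord_add coord_scaleR abs_coord_le_norm)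

instance l2 :: banach
proof
  fix X :: "nat \<Rightarrow> l2"
  assume X: "Cauchy X"
  define a where "a i = lim (\<lambda>n. coord (X n) i)" for i
  have a: "(\<lambda>n. coord (X n) i) \<longlonglongrightarrow> a i" for i
    using bounded_linear.Cauchy[OF bounded_linear_coord X]
    by (simp add: a_def Cauchy_convergent_iff convergent_LIMSEQ_iff)
  have tail: "\<exists>N. \<forall>n\<ge>N. \<forall>k. (\<Sum>i<k. (coord (X n) i - a i)\<^sup>2) \<le> e\<^sup>2" if "e > 0" for e :: real
  proof -
    obtain N where N: "norm (X n - X m) < e" if "n \<ge> N" "m \<ge> N" for m n
      using CauchyD[OF X \<open>e > 0\<close>] by blast
    have "(\<Sum>i<k. (coord (X n) i - a i)\<^sup>2) \<le> e\<^sup>2" if "n \<ge> N" for n k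
    proof (rule tendsto_upperbound)
      show "(\<lambda>m. \<Sum>i<k. (coord (X n) i - coord (X m) i)\<^sup>2) \<longlonglongrightarrow> (\<Sum>i<k. (coord (X n) i - a i)\<^sup>2)"
        by (intro tendsto_intros a)
      have "(\<Sum>i<k. (coord (X n) i - coord (X m) i)\<^sup>2) \<le> e\<^sup>2" if "m \<ge> N" for m
      proof -
        have "(\<Sum>i<k. (coord (X n) i - coord (X m) i)\<^sup>2) \<le> (norm (X n - X m))\<^sup>2"
          using sum_square_coord_le[of "X n - X m" k] by (simp add: coord_diff)
        also have "\<dots> \<le> e\<^sup>2"
          using N[OF \<open>n \<ge> N\<close> \<open>m \<ge> N\<close>] by (intro power_mono) auto
        finally show ?thesis .
      qed
      then show "\<forall>\<^sub>F m in sequentially. (\<Sum>i<k. (coord (X n) i - coord (X m) i)\<^sup>2) \<le> e\<^sup>2"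
        by (auto simp: eventually_sequentially)
    qed simp
    then show ?thesis by blast
  qed
  obtain N where N: "(\<Sum>i<k. (coord (X N) i - a i)\<^sup>2) \<le> 1" for k
    using tail[of 1] by fastforce
  have "summable (\<lambda>i. (coord (X N) i - a i)\<^sup>2)"
    by (rule bounded_imp_summable[where B = 1]) (use N[of "Suc _"] in \<open>auto simp: lessThan_Suc_atMost\<close>)
  then have "summable (\<lambda>i. (a i - coord (X N) i)\<^sup>2)"
    by (subst power2_commute)
  from summable_square_add[OF summable_coord_square[of "X N"] this] have "summable (\<lambda>i. (a i)\<^sup>2)" by simp
  then have A: "coord (Abs_l2 a) = a" by (simp add: Abs_l2_inverse)
  have "X \<longlonglongrightarrow> Abs_l2 a"
  proof (rule LIMSEQ_I)
    fix r :: real assume "r > 0"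
    then obtain N where N: "\<And>n k. n \<ge> N \<Longrightarrow> (\<Sum>i<k. (coord (X n) i - a i)\<^sup>2) \<le> (r / 2)\<^sup>2"
      using tail[of "r / 2"] by auto
    have "norm (X n - Abs_l2 a) < r" if "n \<ge> N" for n
    proof -
      have "(norm (X n - Abs_l2 a))\<^sup>2 \<le> (r / 2)\<^sup>2"
        using norm_l2_sums[of "X n - Abs_l2 a"] N[OF that]
        by (intro LIMSEQ_le_const2[where X = "\<lambda>k. \<Sum>i<k. (coord (X n) i - a i)\<^sup>2"])
          (auto simp: sums_def coord_diff A)
      then have "norm (X n - Abs_l2 a) \<le> r / 2"
        using \<open>r > 0\<close> by (simp add: power2_le_iff_abs_le)
      then show ?thesis using \<open>r > 0\<close> by simp
    qed
    then show "\<exists>N. \<forall>n\<ge>N. norm (X n - Abs_l2 a) < r" by blast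
  qed
  then show "convergent X" by (auto simp: convergent_def)
qed

section \<open>Resolvents of a positive operator\<close>

lemma norm_add_diff_le: "norm (a + b - c) \<le> norm a + norm b + norm c"
  for a b c :: "'a::real_normed_vector"
  by (rule order_trans[OF norm_triangle_ineq4 add_right_mono[OF norm_triangle_ineq]])

text \<open>\<open>G\<close> stands for the inverse of a positive unbounded operator \<open>L\<close>, and the range of \<open>G\<close> for the
domain of \<open>L\<close>. Working with \<open>G\<close> avoids unbounded operators altogether.\<close>

locale positive_operator =
  fixes G :: "'a::{real_inner, banach} \<Rightarrow> 'a"
  assumes bounded_linear_G: "bounded_linear G"
    and positive: "0 \<le> inner (G x) x"
    and dense_range: "closure (range G) = UNIV"
begin

lemmas G_add = linear_add[OF bounded_linear.linear[OF bounded_linear_G]]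
  and G_diff = linear_diff[OF bounded_linear.linear[OF bounded_linear_G]]
  and G_scaleR = linear_scale[OF bounded_linear.linear[OF bounded_linear_G]]

text \<open>The cross term in the square of the sum is \<open>2 \<tau> (G x, x)\<close>, which positivity makes harmless.\<close>

lemma norm_le_shifted:
  assumes "0 \<le> \<tau>"
  shows "(norm (G x))\<^sup>2 + (\<tau> * norm x)\<^sup>2 \<le> (norm (G x + \<tau> *\<^sub>R x))\<^sup>2"
proof -
  have "(norm (G x + \<tau> *\<^sub>R x))\<^sup>2 = (norm (G x))\<^sup>2 + 2 * \<tau> * inner (G x) x + (\<tau> * norm x)\<^sup>2"
    unfolding power_mult_distrib power2_norm_eq_inner
    by (simp add: inner_add inner_commute power2_eq_square algebra_simps)
  then show ?thesis using assms positive[of x] by simp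
qed

text \<open>The Lax-Milgram argument: \<open>G + \<tau>\<close> is bounded and coercive, so a sufficiently short step of the
Richardson iteration \<open>y - s (G y + \<tau> y - x)\<close> is a contraction.\<close>

lemma shifted_bijective:
  assumes "0 < \<tau>"
  shows "\<exists>!y. G y + \<tau> *\<^sub>R y = x"
proof -
  obtain K where K: "K > 0" "\<And>x. norm (G x) \<le> norm x * K"
    using bounded_linear.pos_bounded[OF bounded_linear_G] by blast
  define M where "M = K + \<tau>"
  \<comment> \<open>this step length minimises the bound \<open>1 - 2 s \<tau> + s\<^sup>2 M\<^sup>2\<close> for the squared contraction factor\<close>
  define s where "s = \<tau> / M\<^sup>2"
  have M: "M > 0" "\<tau> < M" using K assms by (auto simp: M_def)
  have s: "0 < s" using M assms by (simp add: s_def)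
  define c where "c = sqrt (1 - (\<tau> / M)\<^sup>2)"
  have "(\<tau> / M)\<^sup>2 < 1"
    using M assms by (intro power_less_one_iff[THEN iffD2]) (auto)
  moreover have "0 < (\<tau> / M)\<^sup>2" using M assms by simp
  ultimately have c: "0 \<le> c" "c < 1" "c\<^sup>2 = 1 - (\<tau> / M)\<^sup>2"
    by (auto simp: c_def)
  define f where "f y = y - s *\<^sub>R (G y + \<tau> *\<^sub>R y - x)" for y
  have "\<exists>!y. f y = y"
  proof (rule banach_fix_type[OF c(1,2)], intro allI)
    fix y z :: 'a
    define d where "d = y - z"
    define e where "e = G d + \<tau> *\<^sub>R d"
    have "f y - f z = d - s *\<^sub>R e"
      by (simp add: f_def d_def e_def G_diff algebra_simps)
    then have "(norm (f y - f z))\<^sup>2 = (norm (d - s *\<^sub>R e))\<^sup>2" by simp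
    also have "\<dots> = (norm d)\<^sup>2 - 2 * s * inner e d + s\<^sup>2 * (norm e)\<^sup>2"
      unfolding power2_norm_eq_inner
      by (simp add: inner_diff inner_commute power2_eq_square algebra_simps)
    also have "\<dots> \<le> (norm d)\<^sup>2 - 2 * s * (\<tau> * (norm d)\<^sup>2) + s\<^sup>2 * (M * norm d)\<^sup>2"
    proof -
      have "\<tau> * (norm d)\<^sup>2 \<le> inner e d"
        using positive[of d] by (simp add: e_def inner_add power2_norm_eq_inner)
      then have 1: "2 * s * (\<tau> * (norm d)\<^sup>2) \<le> 2 * s * inner e d"
        using s by (intro mult_left_mono) auto
      have "norm e \<le> norm (G d) + norm (\<tau> *\<^sub>R d)" unfolding e_def by (rule norm_triangle_ineq)
      also have "\<dots> \<le> M * norm d" using K(2)[of d] assms by (simp add: M_def algebra_simps)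
      finally have "(norm e)\<^sup>2 \<le> (M * norm d)\<^sup>2" by (intro power_mono) auto
      then have "s\<^sup>2 * (norm e)\<^sup>2 \<le> s\<^sup>2 * (M * norm d)\<^sup>2" by (intro mult_left_mono) auto
      with 1 show ?thesis by linarith
    qed
    also have "\<dots> = (c * norm d)\<^sup>2"
    proof -
      have "s * M\<^sup>2 = \<tau>" using M by (simp add: s_def)
      then have "s\<^sup>2 * M\<^sup>2 = s * \<tau>"
        by (simp add: power2_eq_square[of s] mult.assoc)
      then have "(norm d)\<^sup>2 - 2 * s * (\<tau> * (norm d)\<^sup>2) + s\<^sup>2 * (M * norm d)\<^sup>2 = (1 - s * \<tau>) * (norm d)\<^sup>2"
        by (simp add: power_mult_distrib left_diff_distrib mult.assoc[symmetric])
      moreover have "s * \<tau> = (\<tau> / M)\<^sup>2"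
        by (simp add: s_def power2_eq_square)
      ultimately show ?thesis
        by (simp add: power_mult_distrib c(3))
    qed
    finally have "norm (f y - f z) \<le> c * norm d"
      using c(1) by (simp add: power2_le_iff_abs_le)
    then show "dist (f y) (f z) \<le> c * dist y z" by (simp add: dist_norm d_def)
  qed
  then show ?thesis using s by (simp add: f_def)
qed

definition shifted_inverse :: "real \<Rightarrow> 'a \<Rightarrow> 'a" where
  "shifted_inverse \<tau> x = (THE y. G y + \<tau> *\<^sub>R y = x)"

text \<open>This is \<open>G (G + \<tau>)\<^sup>-\<^sup>1 = (1 + \<tau> L)\<^sup>-\<^sup>1\<close>. The form chosen gives the identity at \<open>\<tau> = 0\<close>, where
\<open>shifted_inverse\<close> need not be meaningful.\<close>

definition resolvent :: "real \<Rightarrow> 'a \<Rightarrow> 'a" where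
  "resolvent \<tau> x = x - \<tau> *\<^sub>R shifted_inverse \<tau> x"

lemma shifted_inverse:
  "0 < \<tau> \<Longrightarrow> G (shifted_inverse \<tau> x) + \<tau> *\<^sub>R shifted_inverse \<tau> x = x"
  unfolding shifted_inverse_def by (rule theI') (rule shifted_bijective)

lemma shifted_eqI: "0 < \<tau> \<Longrightarrow> G y + \<tau> *\<^sub>R y = G z + \<tau> *\<^sub>R z \<Longrightarrow> y = z"
  using shifted_bijective by blast

lemma resolvent_0 [simp]: "resolvent 0 x = x"
  by (simp add: resolvent_def)

lemma resolvent_eq: "0 < \<tau> \<Longrightarrow> resolvent \<tau> x = G (shifted_inverse \<tau> x)"
  using shifted_inverse[of \<tau> x] by (simp add: resolvent_def algebra_simps)

lemma resolvent_equation: "0 < \<tau> \<Longrightarrow> G (resolvent \<tau> x) + \<tau> *\<^sub>R resolvent \<tau> x = G x"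
  using shifted_inverse[of \<tau> x] by (metis G_add G_scaleR resolvent_eq)

lemma resolvent_eqI: "0 < \<tau> \<Longrightarrow> G y + \<tau> *\<^sub>R y = G x \<Longrightarrow> y = resolvent \<tau> x"
  using shifted_eqI resolvent_equation by metis

lemma resolvent_add: "0 \<le> \<tau> \<Longrightarrow> resolvent \<tau> (x + y) = resolvent \<tau> x + resolvent \<tau> y"
proof (cases "\<tau> = 0")
  case False
  assume "0 \<le> \<tau>"
  with False have \<tau>: "0 < \<tau>" by simp
  have "resolvent \<tau> x + resolvent \<tau> y = resolvent \<tau> (x + y)"
    using resolvent_equation[OF \<tau>, of x] resolvent_equation[OF \<tau>, of y]
    by (intro resolvent_eqI \<tau>) (simp add: G_add algebra_simps)
  then show ?thesis by simp
qed simp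

lemma resolvent_scaleR: "0 \<le> \<tau> \<Longrightarrow> resolvent \<tau> (r *\<^sub>R x) = r *\<^sub>R resolvent \<tau> x"
proof (cases "\<tau> = 0")
  case False
  assume "0 \<le> \<tau>"
  with False have \<tau>: "0 < \<tau>" by simp
  have "r *\<^sub>R (G (resolvent \<tau> x) + \<tau> *\<^sub>R resolvent \<tau> x) = r *\<^sub>R G x"
    using resolvent_equation[OF \<tau>, of x] by simp
  then have "r *\<^sub>R resolvent \<tau> x = resolvent \<tau> (r *\<^sub>R x)"
    by (intro resolvent_eqI \<tau>) (simp add: G_scaleR algebra_simps)
  then show ?thesis by simp
qed simp

lemma resolvent_diff: "0 \<le> \<tau> \<Longrightarrow> resolvent \<tau> (x - y) = resolvent \<tau> x - resolvent \<tau> y"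
  using resolvent_add[of \<tau> "x - y" y] by simp

lemma norm_resolvent_le: "0 \<le> \<tau> \<Longrightarrow> norm (resolvent \<tau> x) \<le> norm x"
proof (cases "\<tau> = 0")
  case False
  assume "0 \<le> \<tau>"
  with False have \<tau>: "0 < \<tau>" by simp
  have "(norm (G (shifted_inverse \<tau> x)))\<^sup>2 + (\<tau> * norm (shifted_inverse \<tau> x))\<^sup>2 \<le> (norm x)\<^sup>2"
    using norm_le_shifted[of \<tau> "shifted_inverse \<tau> x"] \<tau> unfolding shifted_inverse[OF \<tau>] by simp
  then have "(norm (G (shifted_inverse \<tau> x)))\<^sup>2 \<le> (norm x)\<^sup>2"
    by (rule order_trans[rotated]) simp
  then have "norm (G (shifted_inverse \<tau> x)) \<le> norm x"
    by (rule power2_le_imp_le) simp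
  then show ?thesis by (simp only: resolvent_eq[OF \<tau>])
qed simp

lemma shifted_inverse_G: "0 < \<tau> \<Longrightarrow> shifted_inverse \<tau> (G z) = resolvent \<tau> z"
  using shifted_inverse[of \<tau> "G z"] resolvent_equation[of \<tau> z] shifted_eqI by metis

text \<open>On the domain of \<open>L\<close> the resolvent is Lipschitz in \<open>\<tau>\<close> down to \<open>\<tau> = 0\<close>. For positive parameters
this is the resolvent identity.\<close>

lemma resolvent_G_diff_le:
  assumes "0 \<le> \<sigma>" "0 \<le> \<tau>"
  shows "norm (resolvent \<tau> (G z) - resolvent \<sigma> (G z)) \<le> \<bar>\<tau> - \<sigma>\<bar> * norm z"
proof -
  have main: "norm (resolvent \<tau> (G z) - resolvent \<sigma> (G z)) \<le> \<bar>\<tau> - \<sigma>\<bar> * norm z"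
    if \<tau>: "0 < \<tau>" and \<sigma>: "0 \<le> \<sigma>" for \<tau> \<sigma>
  proof (cases "\<sigma> = 0")
    case True
    then have "resolvent \<tau> (G z) - resolvent \<sigma> (G z) = - (\<tau> *\<^sub>R resolvent \<tau> z)"
      using \<tau> by (simp add: resolvent_def[of \<tau> "G z"] shifted_inverse_G)
    then show ?thesis
      using True \<tau> norm_resolvent_le[of \<tau> z] by (simp add: mult_left_mono)
  next
    case False
    then have \<sigma>': "0 < \<sigma>" using \<sigma> by simp
    define x where "x = resolvent \<tau> z"
    define y where "y = resolvent \<sigma> z"
    have eqs: "resolvent \<tau> (G z) = G x" "resolvent \<sigma> (G z) = G y"
      using \<tau> \<sigma>' by (simp_all add: resolvent_eq shifted_inverse_G x_def y_def)
    have "G (x - y) + \<tau> *\<^sub>R (x - y) = (\<sigma> - \<tau>) *\<^sub>R y"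
      using resolvent_equation[OF \<tau>, of z] resolvent_equation[OF \<sigma>', of z]
      by (simp add: G_diff algebra_simps x_def y_def)
    then have "shifted_inverse \<tau> ((\<sigma> - \<tau>) *\<^sub>R y) = x - y"
      using shifted_inverse[OF \<tau>] shifted_eqI[OF \<tau>] by metis
    then have "G (x - y) = resolvent \<tau> ((\<sigma> - \<tau>) *\<^sub>R y)"
      using \<tau> by (simp add: resolvent_eq)
    then have "norm (G x - G y) \<le> norm ((\<sigma> - \<tau>) *\<^sub>R y)"
      using norm_resolvent_le[of \<tau> "(\<sigma> - \<tau>) *\<^sub>R y"] \<tau> by (simp add: G_diff)
    also have "\<dots> \<le> \<bar>\<tau> - \<sigma>\<bar> * norm z"
      using norm_resolvent_le[OF \<sigma>, of z] by (simp add: y_def mult_left_mono abs_minus_commute)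
    finally show ?thesis by (simp add: eqs)
  qed
  show ?thesis
  proof (cases "\<tau> = 0")
    case True
    then show ?thesis
      using main[of \<sigma> \<tau>] assms by (cases "\<sigma> = 0") (auto simp: norm_minus_commute)
  qed (use main assms in auto)
qed

text \<open>Strong continuity spreads from the dense range of \<open>G\<close> to all vectors because the resolvents are
contractions.\<close>

lemma resolvent_continuous: "continuous_on {0..} (\<lambda>\<tau>. resolvent \<tau> x)"
proof (rule continuous_on_iff[THEN iffD2], intro ballI allI impI)
  fix \<sigma> e :: real
  assume \<sigma>: "\<sigma> \<in> {0..}" and e: "0 < e"
  have "x \<in> closure (range G)" by (simp add: dense_range)
  then obtain z where z: "dist (G z) x < e / 3"
    using e unfolding closure_approachable by (metis divide_pos_pos zero_less_numeral rangeE)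
  have "dist (resolvent \<tau> x) (resolvent \<sigma> x) < e"
    if \<tau>: "\<tau> \<in> {0..}" and d: "dist \<tau> \<sigma> < e / (3 * (norm z + 1))" for \<tau>
  proof -
    have close: "norm (resolvent \<rho> x - resolvent \<rho> (G z)) < e / 3" if "0 \<le> \<rho>" for \<rho>
      using norm_resolvent_le[OF that, of "x - G z"] z that
      by (simp add: resolvent_diff dist_norm norm_minus_commute)
    have "norm (resolvent \<tau> (G z) - resolvent \<sigma> (G z)) \<le> \<bar>\<tau> - \<sigma>\<bar> * norm z"
      using resolvent_G_diff_le \<sigma> \<tau> by simp
    also have "\<dots> \<le> \<bar>\<tau> - \<sigma>\<bar> * (norm z + 1)" by (simp add: mult_left_mono)
    also have "\<dots> < e / 3"
    proof -
      have "0 < 3 * (norm z + 1)" by (simp add: add_nonneg_pos)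
      then have "\<bar>\<tau> - \<sigma>\<bar> * (3 * (norm z + 1)) < e"
        using d by (simp only: dist_real_def pos_less_divide_eq)
      then show ?thesis by (simp add: algebra_simps)
    qed
    finally have mid: "norm (resolvent \<tau> (G z) - resolvent \<sigma> (G z)) < e / 3" .
    have "resolvent \<tau> x - resolvent \<sigma> x = (resolvent \<tau> x - resolvent \<tau> (G z))
        + (resolvent \<tau> (G z) - resolvent \<sigma> (G z)) - (resolvent \<sigma> x - resolvent \<sigma> (G z))"
      by simp
    then have "norm (resolvent \<tau> x - resolvent \<sigma> x) \<le> norm (resolvent \<tau> x - resolvent \<tau> (G z))
        + norm (resolvent \<tau> (G z) - resolvent \<sigma> (G z)) + norm (resolvent \<sigma> x - resolvent \<sigma> (G z))"
      by (simp only: norm_add_diff_le)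
    then show ?thesis using close[of \<tau>] close[of \<sigma>] mid \<sigma> \<tau> by (simp add: dist_norm)
  qed
  moreover have "0 < e / (3 * (norm z + 1))" using e by (simp add: add_nonneg_pos)
  ultimately show "\<exists>d>0. \<forall>\<tau>\<in>{0..}. dist \<tau> \<sigma> < d \<longrightarrow> dist (resolvent \<tau> x) (resolvent \<sigma> x) < e"
    by blast
qed

lemma continuous_on_resolvent:
  fixes v :: "'b::metric_space \<Rightarrow> 'a"
  assumes \<tau>: "continuous_on S \<tau>" "\<And>t. t \<in> S \<Longrightarrow> 0 \<le> \<tau> t" and v: "continuous_on S v"
  shows "continuous_on S (\<lambda>t. resolvent (\<tau> t) (v t))"
  unfolding continuous_on_def
proof
  fix s assume s: "s \<in> S"
  have "((\<lambda>t. resolvent (\<tau> t) (v s)) \<longlongrightarrow> resolvent (\<tau> s) (v s)) (at s within S)"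
    using continuous_on_compose2[OF resolvent_continuous \<tau>(1)] \<tau>(2) s
    by (auto simp: continuous_on_def)
  moreover have "((\<lambda>t. resolvent (\<tau> t) (v t - v s)) \<longlongrightarrow> 0) (at s within S)"
  proof (rule Lim_null_comparison)
    show "\<forall>\<^sub>F t in at s within S. norm (resolvent (\<tau> t) (v t - v s)) \<le> norm (v t - v s)"
      using \<tau>(2) norm_resolvent_le by (auto simp: eventually_at_filter)
    show "((\<lambda>t. norm (v t - v s)) \<longlongrightarrow> 0) (at s within S)"
      using v s by (auto simp: continuous_on_def intro!: tendsto_norm_zero LIM_zero)
  qed
  ultimately have "((\<lambda>t. resolvent (\<tau> t) (v s) + resolvent (\<tau> t) (v t - v s))
      \<longlongrightarrow> resolvent (\<tau> s) (v s) + 0) (at s within S)"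
    by (rule tendsto_add)
  moreover have "\<forall>\<^sub>F t in at s within S.
      resolvent (\<tau> t) (v s) + resolvent (\<tau> t) (v t - v s) = resolvent (\<tau> t) (v t)"
    using \<tau>(2) by (auto simp: eventually_at_filter resolvent_diff)
  ultimately show "((\<lambda>t. resolvent (\<tau> t) (v t)) \<longlongrightarrow> resolvent (\<tau> s) (v s)) (at s within S)"
    by (auto elim: Lim_transform_eventually)
qed
end

section \<open>Evolution on a geometric time grid\<close>

text \<open>Iterating the hypothesis along \<open>t, q t, q\<^sup>2 t, \<dots>\<close> telescopes the step sizes \<open>(1 - q) q\<^sup>n t\<close> to at
most \<open>t\<close>. Bounding \<open>N\<close> on the right by its maximum then leaves an inequality for the maximum
itself, which can be absorbed because \<open>a T \<le> 1 / 2\<close>.\<close>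

lemma gronwall_geometric:
  fixes N :: "real \<Rightarrow> real"
  assumes q: "0 < q" "q < 1" and cont: "continuous_on {0..T} N"
    and a: "0 \<le> a" "2 * (a * T) \<le> 1" and b: "0 \<le> b"
    and nonneg: "\<And>t. t \<in> {0..T} \<Longrightarrow> 0 \<le> N t"
    and step: "\<And>t. 0 < t \<Longrightarrow> t \<le> T \<Longrightarrow> N t \<le> N (q * t) + (1 - q) * t * (a * N t + b)"
    and t: "t \<in> {0..T}"
  shows "N t \<le> 2 * (N 0 + T * b)"
proof -
  have T: "0 \<le> T" using t by simp
  obtain s where s: "s \<in> {0..T}" "\<And>t. t \<in> {0..T} \<Longrightarrow> N t \<le> N s"
    using continuous_attains_sup[OF compact_Icc _ cont] T by fastforce
  define c where "c = a * N s + b"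
  have c: "0 \<le> c" using a b nonneg s by (simp add: c_def)
  have in_range: "q ^ n * t \<in> {0..T}" if "t \<in> {0..T}" for t n
  proof -
    have "q ^ n \<le> 1" using q by (intro power_le_one) auto
    then have "q ^ n * t \<le> 1 * t" using that by (intro mult_right_mono) auto
    then show ?thesis using that q by simp
  qed
  have iter: "N t \<le> N (q ^ n * t) + t * (1 - q ^ n) * c" if t: "t \<in> {0..T}" for t n
  proof (induction n)
    case (Suc n)
    have "N (q ^ n * t) \<le> N (q ^ Suc n * t) + t * (q ^ n - q ^ Suc n) * c"
    proof (cases "t = 0")
      case False
      then have "0 < q ^ n * t" using t q by simp
      then have "N (q ^ n * t) \<le> N (q * (q ^ n * t)) + (1 - q) * (q ^ n * t) * (a * N (q ^ n * t) + b)"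
        using in_range[OF t, of n] by (intro step) auto
      also have "\<dots> \<le> N (q * (q ^ n * t)) + (1 - q) * (q ^ n * t) * c"
        unfolding c_def using in_range[OF t, of n] q a s(2)
        by (intro add_left_mono mult_left_mono add_right_mono) auto
      finally show ?thesis by (simp add: algebra_simps)
    qed simp
    with Suc show ?case by (simp add: algebra_simps)
  qed simp
  have bound: "N t \<le> N 0 + t * c" if t: "t \<in> {0..T}" for t
  proof -
    have pow: "(\<lambda>n. q ^ n) \<longlonglongrightarrow> 0" using q by (intro LIMSEQ_realpow_zero) auto
    then have "(\<lambda>n. q ^ n * t) \<longlonglongrightarrow> 0" using tendsto_mult_left_zero by blast
    then have "(\<lambda>n. N (q ^ n * t)) \<longlonglongrightarrow> N 0"
      using T in_range[OF t] by (intro continuous_on_tendsto_compose[OF cont]) auto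
    then have "(\<lambda>n. N (q ^ n * t) + t * (1 - q ^ n) * c) \<longlonglongrightarrow> N 0 + t * (1 - 0) * c"
      by (intro tendsto_intros pow)
    then show ?thesis using iter[OF t] by (intro LIMSEQ_le_const) auto
  qed
  have "N s \<le> N 0 + T * c"
    using bound[OF s(1)] mult_right_mono[of s T c] s(1) c by auto
  also have "\<dots> = N 0 + T * b + (a * T) * N s" by (simp add: c_def algebra_simps)
  also have "\<dots> \<le> N 0 + T * b + 1 / 2 * N s"
    using a(2) nonneg[OF s(1)] by (intro add_left_mono mult_right_mono) auto
  finally have "N s \<le> 2 * (N 0 + T * b)" by simp
  then show ?thesis using s(2)[OF t] by simp
qed

lemma one_le_exp_double:
  fixes s :: real
  assumes "0 \<le> s" "2 * s \<le> 1"
  shows "1 \<le> (1 - s) * exp (2 * s)"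
proof -
  have "0 \<le> s * (1 - 2 * s)" using assms by simp
  then have "1 \<le> (1 - s) * (1 + 2 * s)" by (simp add: algebra_simps)
  also have "\<dots> \<le> (1 - s) * exp (2 * s)"
    using assms exp_ge_add_one_self[of "2 * s"] by (intro mult_left_mono) auto
  finally show ?thesis .
qed

text \<open>The functional \<open>inner e\<close> plays the part of the integral over \<open>[0,1]\<close>.\<close>

locale inverse_source = positive_operator G for G :: "'a::{real_inner, banach} \<Rightarrow> 'a" +
  fixes e :: 'a and q :: real
  assumes q: "0 < q" "q < 1"
begin

text \<open>The equations for \<open>w = L u\<close>, with \<open>p = L \<phi>\<close>, \<open>k = L f\<close> and \<open>\<eta> = D\<^sub>q \<psi>\<close>. The second one is the
over-determination condition after one differentiation in time; it is required at \<open>t = 0\<close> too,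
because it is what determines the value \<open>\<upsilon> 0\<close>.\<close>

definition solves :: "real \<Rightarrow> 'a \<Rightarrow> (real \<Rightarrow> 'a) \<Rightarrow> (real \<Rightarrow> real) \<Rightarrow> (real \<Rightarrow> 'a) \<Rightarrow> (real \<Rightarrow> real) \<Rightarrow> bool" where
  "solves T p k \<eta> w \<upsilon> \<longleftrightarrow> continuous_on {0..T} w \<and> w 0 = p \<and>
     (\<forall>t\<in>{0<..T}. G (w t) + ((1 - q) * t) *\<^sub>R w t = G (w (q * t)) + ((1 - q) * t * \<upsilon> t) *\<^sub>R G (k t)) \<and>
     (\<forall>t\<in>{0..T}. \<upsilon> t * inner e (G (k t)) = \<eta> t + inner e (w t))"

lemma step_size: "0 < t \<Longrightarrow> 0 < (1 - q) * t" "0 \<le> t \<Longrightarrow> 0 \<le> (1 - q) * t" "0 \<le> t \<Longrightarrow> (1 - q) * t \<le> t"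
  using q by (simp_all add: mult_left_le_one_le)

lemma contracted_time: "t \<in> {0..T} \<Longrightarrow> q * t \<in> {0..T}"
  using q mult_left_le_one_le[of t q] by auto

lemma solves_resolvent:
  assumes "solves T p k \<eta> w \<upsilon>" "t \<in> {0<..T}"
  shows "w t = resolvent ((1 - q) * t) (w (q * t) + ((1 - q) * t * \<upsilon> t) *\<^sub>R k t)"
proof (rule resolvent_eqI)
  show "G (w t) + ((1 - q) * t) *\<^sub>R w t = G (w (q * t) + ((1 - q) * t * \<upsilon> t) *\<^sub>R k t)"
    using assms by (simp add: solves_def G_add G_scaleR)
qed (use assms q in simp)

text \<open>The relation for the sources bounds \<open>\<upsilon>' - \<upsilon>\<close> by \<open>w' - w\<close> and the distance of the data. Inserted into
the resolvent equation it yields the hypothesis of \<open>gronwall_geometric\<close>.\<close>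

lemma stability:
  assumes sol: "solves T p k \<eta> w \<upsilon>" and sol': "solves T p' k' \<eta>' w' \<upsilon>'"
    and K: "\<And>t. t \<in> {0..T} \<Longrightarrow> norm (k' t) \<le> K"
    and m: "0 < m" "\<And>t. t \<in> {0..T} \<Longrightarrow> m \<le> \<bar>inner e (G (k' t))\<bar>"
    and V: "\<And>t. t \<in> {0..T} \<Longrightarrow> \<bar>\<upsilon> t\<bar> \<le> V"
    and small: "2 * (K * norm e / m * T) \<le> 1"
    and \<Gamma>: "0 \<le> \<Gamma>" "\<And>x. norm (G x) \<le> \<Gamma> * norm x"
    and \<delta>: "norm (p' - p) \<le> \<delta>" "\<And>t. t \<in> {0..T} \<Longrightarrow> norm (k' t - k t) \<le> \<delta>"
      "\<And>t. t \<in> {0..T} \<Longrightarrow> \<bar>\<eta>' t - \<eta> t\<bar> \<le> \<delta>"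
    and t: "t \<in> {0..T}"
  shows "norm (w' t - w t) \<le> 2 * (1 + T * (K * (1 + norm e * \<Gamma> * V) / m + V)) * \<delta>"
    and "\<bar>\<upsilon>' t - \<upsilon> t\<bar> \<le> (\<delta> + norm e * norm (w' t - w t) + norm e * \<Gamma> * \<delta> * V) / m"
proof -
  have nonneg: "0 \<le> \<delta>" "0 \<le> T" "0 \<le> K" "0 \<le> V"
    using \<delta>(1) t K[OF t] V[OF t] by (auto intro: order_trans[OF norm_ge_zero])
  have source: "\<bar>\<upsilon>' t - \<upsilon> t\<bar> \<le> (\<delta> + norm e * norm (w' t - w t) + norm e * \<Gamma> * \<delta> * V) / m"
    if t: "t \<in> {0..T}" for t
  proof -
    have "(\<upsilon>' t - \<upsilon> t) * inner e (G (k' t)) = (\<eta>' t - \<eta> t) + inner e (w' t - w t)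
        - inner e (G (k' t - k t)) * \<upsilon> t"
      using sol sol' t unfolding solves_def by (simp add: G_diff inner_diff_right algebra_simps)
    then have "\<bar>\<upsilon>' t - \<upsilon> t\<bar> * \<bar>inner e (G (k' t))\<bar> \<le> \<bar>\<eta>' t - \<eta> t\<bar> + \<bar>inner e (w' t - w t)\<bar>
        + \<bar>inner e (G (k' t - k t))\<bar> * \<bar>\<upsilon> t\<bar>"
      unfolding abs_mult[symmetric] by linarith
    also have "\<dots> \<le> \<delta> + norm e * norm (w' t - w t) + norm e * (\<Gamma> * \<delta>) * V"
    proof (intro add_mono mult_mono)
      show "\<bar>inner e (w' t - w t)\<bar> \<le> norm e * norm (w' t - w t)"
        by (rule Cauchy_Schwarz_ineq2)
      have "\<bar>inner e (G (k' t - k t))\<bar> \<le> norm e * norm (G (k' t - k t))"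
        by (rule Cauchy_Schwarz_ineq2)
      also have "\<dots> \<le> norm e * (\<Gamma> * \<delta>)"
        using \<Gamma>(2)[of "k' t - k t"] mult_left_mono[OF \<delta>(2)[OF t] \<Gamma>(1)]
        by (intro mult_left_mono) auto
      finally show "\<bar>inner e (G (k' t - k t))\<bar> \<le> norm e * (\<Gamma> * \<delta>)" .
    qed (use \<delta>(3) V t nonneg \<Gamma>(1) in auto)
    finally have "\<bar>\<upsilon>' t - \<upsilon> t\<bar> * m \<le> \<delta> + norm e * norm (w' t - w t) + norm e * (\<Gamma> * \<delta>) * V"
      using mult_left_mono[OF m(2)[OF t], of "\<bar>\<upsilon>' t - \<upsilon> t\<bar>"] by simp
    then show ?thesis using m(1) by (simp add: pos_le_divide_eq mult.assoc)
  qed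
  show "\<bar>\<upsilon>' t - \<upsilon> t\<bar> \<le> (\<delta> + norm e * norm (w' t - w t) + norm e * \<Gamma> * \<delta> * V) / m"
    by (rule source[OF t])
  define b where "b = K * (1 + norm e * \<Gamma> * V) / m + V"
  have b: "0 \<le> b" using nonneg \<Gamma>(1) m(1) by (simp add: b_def)
  have "norm (w' t - w t) \<le> 2 * (norm (w' 0 - w 0) + T * (b * \<delta>))"
  proof (rule gronwall_geometric[where q = q and a = "K * norm e / m" and N = "\<lambda>t. norm (w' t - w t)"])
    show "continuous_on {0..T} (\<lambda>t. norm (w' t - w t))"
      using sol sol' by (auto simp: solves_def intro!: continuous_intros)
    fix t assume t: "0 < t" "t \<le> T"
    define \<tau> where "\<tau> = (1 - q) * t"
    have \<tau>: "0 < \<tau>" using t q by (simp add: \<tau>_def)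
    have "w' t - w t = resolvent \<tau> ((w' (q * t) - w (q * t)) + \<tau> *\<^sub>R ((\<upsilon>' t - \<upsilon> t) *\<^sub>R k' t + \<upsilon> t *\<^sub>R (k' t - k t)))"
    proof -
      have "w t = resolvent \<tau> (w (q * t) + (\<tau> * \<upsilon> t) *\<^sub>R k t)"
        using solves_resolvent[OF sol, of t] t by (simp add: \<tau>_def)
      moreover have "w' t = resolvent \<tau> (w' (q * t) + (\<tau> * \<upsilon>' t) *\<^sub>R k' t)"
        using solves_resolvent[OF sol', of t] t by (simp add: \<tau>_def)
      moreover have "(w' (q * t) + (\<tau> * \<upsilon>' t) *\<^sub>R k' t) - (w (q * t) + (\<tau> * \<upsilon> t) *\<^sub>R k t)
          = (w' (q * t) - w (q * t)) + \<tau> *\<^sub>R ((\<upsilon>' t - \<upsilon> t) *\<^sub>R k' t + \<upsilon> t *\<^sub>R (k' t - k t))"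
        by (simp add: algebra_simps)
      ultimately show ?thesis using resolvent_diff[of \<tau>] \<tau> by (metis less_imp_le)
    qed
    then have "norm (w' t - w t) \<le> norm ((w' (q * t) - w (q * t)) + \<tau> *\<^sub>R ((\<upsilon>' t - \<upsilon> t) *\<^sub>R k' t + \<upsilon> t *\<^sub>R (k' t - k t)))"
      using \<tau> norm_resolvent_le by (metis less_imp_le)
    also have "\<dots> \<le> norm (w' (q * t) - w (q * t)) + norm (\<tau> *\<^sub>R ((\<upsilon>' t - \<upsilon> t) *\<^sub>R k' t + \<upsilon> t *\<^sub>R (k' t - k t)))"
      by (rule norm_triangle_ineq)
    also have "norm (\<tau> *\<^sub>R ((\<upsilon>' t - \<upsilon> t) *\<^sub>R k' t + \<upsilon> t *\<^sub>R (k' t - k t)))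
        \<le> \<tau> * (\<bar>\<upsilon>' t - \<upsilon> t\<bar> * norm (k' t) + \<bar>\<upsilon> t\<bar> * norm (k' t - k t))"
      using \<tau> norm_triangle_ineq[of "(\<upsilon>' t - \<upsilon> t) *\<^sub>R k' t" "\<upsilon> t *\<^sub>R (k' t - k t)"] by simp
    also have "\<dots> \<le> \<tau> * ((\<delta> + norm e * norm (w' t - w t) + norm e * \<Gamma> * \<delta> * V) / m * K + V * \<delta>)"
      using \<tau> t source[of t] K[of t] V[of t] \<delta>(2)[of t] nonneg \<Gamma>(1) m(1)
      by (intro mult_left_mono add_mono mult_mono) auto
    also have "\<dots> = \<tau> * (K * norm e / m * norm (w' t - w t) + b * \<delta>)"
      using m(1) by (simp add: b_def field_simps)
    finally show "norm (w' t - w t) \<le> norm (w' (q * t) - w (q * t))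
        + (1 - q) * t * (K * norm e / m * norm (w' t - w t) + b * \<delta>)"
      by (simp add: \<tau>_def)
  qed (use q small nonneg m b t in auto)
  also have "\<dots> \<le> 2 * (\<delta> + T * (b * \<delta>))"
    using sol sol' \<delta>(1) by (simp add: solves_def)
  finally have "norm (w' t - w t) \<le> 2 * (1 + T * b) * \<delta>"
    by (simp add: algebra_simps)
  then show "norm (w' t - w t) \<le> 2 * (1 + T * (K * (1 + norm e * \<Gamma> * V) / m + V)) * \<delta>"
    unfolding b_def .
qed

lemma solves_unique:
  assumes sol: "solves T p k \<eta> w \<upsilon>" "solves T p k \<eta> w' \<upsilon>'" and \<upsilon>: "continuous_on {0..T} \<upsilon>"
    and k: "\<And>t. t \<in> {0..T} \<Longrightarrow> norm (k t) \<le> K"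
    and m: "0 < m" "\<And>t. t \<in> {0..T} \<Longrightarrow> m \<le> \<bar>inner e (G (k t))\<bar>"
    and small: "2 * (K * norm e / m * T) \<le> 1" and t: "t \<in> {0..T}"
  shows "\<upsilon>' t = \<upsilon> t" "w' t = w t"
proof -
  obtain V where "\<forall>r\<in>\<upsilon> ` {0..T}. norm r \<le> V"
    using compact_imp_bounded[OF compact_continuous_image[OF \<upsilon> compact_Icc]]
    unfolding bounded_iff by blast
  then have V: "\<bar>\<upsilon> t\<bar> \<le> V" if "t \<in> {0..T}" for t using that by auto
  obtain \<Gamma> where \<Gamma>: "0 < \<Gamma>" "\<And>x. norm (G x) \<le> norm x * \<Gamma>"
    using bounded_linear.pos_bounded[OF bounded_linear_G] by blast
  then have \<Gamma>': "norm (G x) \<le> \<Gamma> * norm x" for x by (simp add: mult.commute)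
  note stable = stability[OF sol k m V small less_imp_le[OF \<Gamma>(1)] \<Gamma>' _ _ _ t, of 0]
  show w: "w' t = w t" using stable(1) by simp
  show "\<upsilon>' t = \<upsilon> t" using stable(2) by (simp add: w)
qed

text \<open>The third difference is that of the time derivatives \<open>D\<^sub>q\<^sub>,\<^sub>t u = \<upsilon> f - L u\<close>. The constant depends on
the given solution and on \<open>K\<close> and \<open>m\<close>, but not on the perturbed data.\<close>

lemma continuous_dependence:
  assumes sol: "solves T p k \<eta> w \<upsilon>" and \<upsilon>: "continuous_on {0..T} \<upsilon>" and T: "0 \<le> T"
    and K: "0 \<le> K" and m: "0 < m" and small: "2 * (K * norm e / m * T) \<le> 1"
  obtains C where "0 < C"
    and "\<And>p' k' \<eta>' w' \<upsilon>' \<delta> t. \<lbrakk>solves T p' k' \<eta>' w' \<upsilon>';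
      \<And>t. t \<in> {0..T} \<Longrightarrow> norm (k' t) \<le> K; \<And>t. t \<in> {0..T} \<Longrightarrow> m \<le> \<bar>inner e (G (k' t))\<bar>;
      norm (p' - p) \<le> \<delta>; \<And>t. t \<in> {0..T} \<Longrightarrow> norm (k' t - k t) \<le> \<delta>;
      \<And>t. t \<in> {0..T} \<Longrightarrow> \<bar>\<eta>' t - \<eta> t\<bar> \<le> \<delta>; t \<in> {0..T}\<rbrakk> \<Longrightarrow>
      \<bar>\<upsilon>' t - \<upsilon> t\<bar> \<le> C * \<delta> \<and> norm (w' t - w t) \<le> C * \<delta> \<and>
      norm ((\<upsilon>' t *\<^sub>R G (k' t) - w' t) - (\<upsilon> t *\<^sub>R G (k t) - w t)) \<le> C * \<delta>"
proof -
  obtain V where "\<forall>r\<in>\<upsilon> ` {0..T}. norm r \<le> V"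
    using compact_imp_bounded[OF compact_continuous_image[OF \<upsilon> compact_Icc]]
    unfolding bounded_iff by blast
  then have V: "\<bar>\<upsilon> t\<bar> \<le> V" if "t \<in> {0..T}" for t using that by auto
  obtain \<Gamma> where \<Gamma>: "0 < \<Gamma>" "\<And>x. norm (G x) \<le> norm x * \<Gamma>"
    using bounded_linear.pos_bounded[OF bounded_linear_G] by blast
  define C\<^sub>1 where "C\<^sub>1 = 2 * (1 + T * (K * (1 + norm e * \<Gamma> * V) / m + V))"
  define C\<^sub>2 where "C\<^sub>2 = (1 + norm e * C\<^sub>1 + norm e * \<Gamma> * V) / m"
  define C\<^sub>3 where "C\<^sub>3 = C\<^sub>2 * (K * \<Gamma>) + V * \<Gamma> + C\<^sub>1"
  have V0: "0 \<le> V" using V[of 0] T by auto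
  have C: "0 \<le> C\<^sub>1" "0 \<le> C\<^sub>2" "0 \<le> C\<^sub>3"
  proof -
    show C1: "0 \<le> C\<^sub>1" using T K V0 \<Gamma>(1) m by (simp add: C\<^sub>1_def)
    then show C2: "0 \<le> C\<^sub>2" using V0 \<Gamma>(1) m by (simp add: C\<^sub>2_def)
    show "0 \<le> C\<^sub>3" using C1 C2 K V0 \<Gamma>(1) by (simp add: C\<^sub>3_def)
  qed
  show ?thesis
  proof (rule that[of "C\<^sub>1 + C\<^sub>2 + C\<^sub>3 + 1"])
    show "0 < C\<^sub>1 + C\<^sub>2 + C\<^sub>3 + 1" using C by linarith
    fix p' k' \<eta>' w' \<upsilon>' \<delta> t
    assume sol': "solves T p' k' \<eta>' w' \<upsilon>'"
      and k': "\<And>t. t \<in> {0..T} \<Longrightarrow> norm (k' t) \<le> K" "\<And>t. t \<in> {0..T} \<Longrightarrow> m \<le> \<bar>inner e (G (k' t))\<bar>"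
      and \<delta>: "norm (p' - p) \<le> \<delta>" "\<And>t. t \<in> {0..T} \<Longrightarrow> norm (k' t - k t) \<le> \<delta>"
      "\<And>t. t \<in> {0..T} \<Longrightarrow> \<bar>\<eta>' t - \<eta> t\<bar> \<le> \<delta>" and t: "t \<in> {0..T}"
    have \<delta>0: "0 \<le> \<delta>" using \<delta>(1) norm_ge_zero order_trans by blast
    have \<Gamma>': "norm (G x) \<le> \<Gamma> * norm x" for x using \<Gamma>(2)[of x] by (simp add: mult.commute)
    note stable = stability[OF sol sol' k'(1) m k'(2) V small less_imp_le[OF \<Gamma>(1)] \<Gamma>' \<delta> t]
    have 1: "norm (w' t - w t) \<le> C\<^sub>1 * \<delta>"
      using stable(1) by (simp add: C\<^sub>1_def)
    have "\<bar>\<upsilon>' t - \<upsilon> t\<bar> \<le> (\<delta> + norm e * norm (w' t - w t) + norm e * \<Gamma> * \<delta> * V) / m"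
      by (rule stable(2))
    also have "\<dots> \<le> (\<delta> + norm e * (C\<^sub>1 * \<delta>) + norm e * \<Gamma> * \<delta> * V) / m"
      using 1 m mult_left_mono[OF 1, of "norm e"] by (intro divide_right_mono) auto
    also have "\<dots> = C\<^sub>2 * \<delta>" by (simp add: C\<^sub>2_def algebra_simps)
    finally have 2: "\<bar>\<upsilon>' t - \<upsilon> t\<bar> \<le> C\<^sub>2 * \<delta>" .
    have "(\<upsilon>' t *\<^sub>R G (k' t) - w' t) - (\<upsilon> t *\<^sub>R G (k t) - w t)
        = (\<upsilon>' t - \<upsilon> t) *\<^sub>R G (k' t) + \<upsilon> t *\<^sub>R G (k' t - k t) - (w' t - w t)"
      by (simp add: G_diff algebra_simps)
    then have "norm ((\<upsilon>' t *\<^sub>R G (k' t) - w' t) - (\<upsilon> t *\<^sub>R G (k t) - w t))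
        = norm ((\<upsilon>' t - \<upsilon> t) *\<^sub>R G (k' t) + \<upsilon> t *\<^sub>R G (k' t - k t) - (w' t - w t))"
      by (simp only:)
    also have "\<dots> \<le> \<bar>\<upsilon>' t - \<upsilon> t\<bar> * norm (G (k' t)) + \<bar>\<upsilon> t\<bar> * norm (G (k' t - k t)) + norm (w' t - w t)"
      using norm_add_diff_le[of "(\<upsilon>' t - \<upsilon> t) *\<^sub>R G (k' t)" "\<upsilon> t *\<^sub>R G (k' t - k t)" "w' t - w t"] by simp
    also have "\<dots> \<le> (C\<^sub>2 * \<delta>) * (K * \<Gamma>) + V * (\<delta> * \<Gamma>) + C\<^sub>1 * \<delta>"
    proof (intro add_mono mult_mono)
      show "norm (G (k' t)) \<le> K * \<Gamma>"
        by (rule order_trans[OF \<Gamma>(2) mult_right_mono[OF k'(1)[OF t] less_imp_le[OF \<Gamma>(1)]]])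
      show "norm (G (k' t - k t)) \<le> \<delta> * \<Gamma>"
        by (rule order_trans[OF \<Gamma>(2) mult_right_mono[OF \<delta>(2)[OF t] less_imp_le[OF \<Gamma>(1)]]])
    qed (use 1 2 V[OF t] V0 C \<delta>0 in auto)
    also have "\<dots> = C\<^sub>3 * \<delta>" by (simp add: C\<^sub>3_def algebra_simps)
    finally have 3: "norm ((\<upsilon>' t *\<^sub>R G (k' t) - w' t) - (\<upsilon> t *\<^sub>R G (k t) - w t)) \<le> C\<^sub>3 * \<delta>" .
    have "C\<^sub>1 * \<delta> \<le> (C\<^sub>1 + C\<^sub>2 + C\<^sub>3 + 1) * \<delta>" "C\<^sub>2 * \<delta> \<le> (C\<^sub>1 + C\<^sub>2 + C\<^sub>3 + 1) * \<delta>"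
      "C\<^sub>3 * \<delta> \<le> (C\<^sub>1 + C\<^sub>2 + C\<^sub>3 + 1) * \<delta>"
      using C \<delta>0 by (auto intro!: mult_right_mono)
    with 1 2 3 show "\<bar>\<upsilon>' t - \<upsilon> t\<bar> \<le> (C\<^sub>1 + C\<^sub>2 + C\<^sub>3 + 1) * \<delta> \<and> norm (w' t - w t) \<le> (C\<^sub>1 + C\<^sub>2 + C\<^sub>3 + 1) * \<delta> \<and>
      norm ((\<upsilon>' t *\<^sub>R G (k' t) - w' t) - (\<upsilon> t *\<^sub>R G (k t) - w t)) \<le> (C\<^sub>1 + C\<^sub>2 + C\<^sub>3 + 1) * \<delta>"
      by linarith
  qed
qed

context
  fixes T K m :: real and k :: "real \<Rightarrow> 'a" and \<eta> :: "real \<Rightarrow> real"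
  assumes T: "0 \<le> T"
    and k: "continuous_on {0..T} k" "\<And>t. t \<in> {0..T} \<Longrightarrow> norm (k t) \<le> K"
    and \<eta>: "continuous_on {0..T} \<eta>"
    and m: "0 < m" "\<And>t. t \<in> {0..T} \<Longrightarrow> m \<le> \<bar>inner e (G (k t))\<bar>"
    and small: "2 * (K * norm e / m * T) \<le> 1"
begin

text \<open>Applying \<open>inner e\<close> to \<open>w(t) = R (w(q t) + \<tau> \<upsilon>(t) k(t))\<close> and inserting the result into the relation for
\<open>\<upsilon>(t)\<close> gives a scalar linear equation for \<open>\<upsilon>(t)\<close>; this is its coefficient, \<open>source\<close> its solution,
and \<open>step\<close> the resulting value of \<open>w(t)\<close>.\<close>

definition pivot :: "real \<Rightarrow> real" where
  "pivot t = inner e (G (k t)) - (1 - q) * t * inner e (resolvent ((1 - q) * t) (k t))"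

definition source :: "real \<Rightarrow> 'a \<Rightarrow> real" where
  "source t x = (\<eta> t + inner e (resolvent ((1 - q) * t) x)) / pivot t"

definition step :: "real \<Rightarrow> 'a \<Rightarrow> 'a" where
  "step t x = resolvent ((1 - q) * t) (x + ((1 - q) * t * source t x) *\<^sub>R k t)"

lemma K_nonneg: "0 \<le> K"
  using k(2)[of 0] T by (auto intro: order_trans[OF norm_ge_zero])

text \<open>The coefficient differs from \<open>inner e (G (k t))\<close> by \<open>O(t)\<close>, which the smallness of \<open>T\<close> controls.\<close>

lemma pivot_lower:
  assumes "t \<in> {0..T}"
  shows "m / 2 \<le> \<bar>pivot t\<bar>"
proof -
  have "\<bar>(1 - q) * t * inner e (resolvent ((1 - q) * t) (k t))\<bar> \<le> T * (norm e * K)"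
    unfolding abs_mult[of "(1 - q) * t"]
  proof (intro mult_mono)
    show "\<bar>(1 - q) * t\<bar> \<le> T" using step_size(2,3)[of t] assms by simp
    have "\<bar>inner e (resolvent ((1 - q) * t) (k t))\<bar> \<le> norm e * norm (resolvent ((1 - q) * t) (k t))"
      by (rule Cauchy_Schwarz_ineq2)
    also have "\<dots> \<le> norm e * K"
      using norm_resolvent_le[of "(1 - q) * t" "k t"] step_size(2)[of t] k(2)[OF assms] assms
      by (intro mult_left_mono) auto
    finally show "\<bar>inner e (resolvent ((1 - q) * t) (k t))\<bar> \<le> norm e * K" .
  qed (use T in auto)
  also have "\<dots> \<le> m / 2" using small m(1) by (simp add: field_simps)
  finally show ?thesis
    using m(2)[OF assms] abs_triangle_ineq2[of "inner e (G (k t))" "(1 - q) * t * inner e (resolvent ((1 - q) * t) (k t))"]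
    unfolding pivot_def by linarith
qed

lemma source_eq:
  assumes "t \<in> {0..T}"
  shows "source t x * inner e (G (k t)) = \<eta> t + inner e (step t x)"
proof -
  have "pivot t \<noteq> 0" using pivot_lower[OF assms] m(1) by auto
  then have "source t x * pivot t = \<eta> t + inner e (resolvent ((1 - q) * t) x)"
    by (simp add: source_def)
  moreover have "step t x = resolvent ((1 - q) * t) x + ((1 - q) * t * source t x) *\<^sub>R resolvent ((1 - q) * t) (k t)"
    using step_size(2)[of t] assms by (simp add: step_def resolvent_add resolvent_scaleR)
  ultimately show ?thesis
    by (simp only: pivot_def inner_add_right inner_scaleR_right right_diff_distrib)
      (simp add: mult.commute mult.left_commute)
qed

text \<open>Two values of a step differ by at most the difference of the arguments plus \<open>\<tau>\<close> times the difference of the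
sources, which is again bounded by the difference of the values. The resulting factor
\<open>1 / (1 - a \<tau>)\<close> is replaced by an exponential, since exponentials multiply well along the grid.\<close>

lemma step_Lipschitz:
  assumes t: "t \<in> {0..T}"
  shows "norm (step t x - step t y) \<le> exp (2 * (K * norm e / m * ((1 - q) * t))) * norm (x - y)"
proof -
  define \<tau> where "\<tau> = (1 - q) * t"
  define a where "a = K * norm e / m"
  have \<tau>: "0 \<le> \<tau>" "\<tau> \<le> T" using step_size(2,3)[of t] t by (auto simp: \<tau>_def)
  have a: "0 \<le> a" using K_nonneg m by (simp add: a_def)
  define d where "d = norm (step t x - step t y)"
  have "(source t x - source t y) * inner e (G (k t)) = inner e (step t x - step t y)"
    using source_eq[OF t, of x] source_eq[OF t, of y] by (simp add: inner_diff_right algebra_simps)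
  then have "\<bar>source t x - source t y\<bar> * \<bar>inner e (G (k t))\<bar> \<le> norm e * d"
    unfolding abs_mult[symmetric] d_def by (simp add: Cauchy_Schwarz_ineq2)
  then have "\<bar>source t x - source t y\<bar> * m \<le> norm e * d"
    using mult_left_mono[OF m(2)[OF t], of "\<bar>source t x - source t y\<bar>"] by simp
  then have c: "\<bar>source t x - source t y\<bar> \<le> norm e * d / m"
    using m(1) by (simp add: pos_le_divide_eq)
  have "step t x - step t y = resolvent \<tau> ((x - y) + (\<tau> * (source t x - source t y)) *\<^sub>R k t)"
  proof -
    have "(x + (\<tau> * source t x) *\<^sub>R k t) - (y + (\<tau> * source t y) *\<^sub>R k t)
        = (x - y) + (\<tau> * (source t x - source t y)) *\<^sub>R k t"
      by (simp add: algebra_simps)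
    then show ?thesis
      unfolding step_def \<tau>_def[symmetric] by (metis resolvent_diff \<tau>(1))
  qed
  then have "d \<le> norm ((x - y) + (\<tau> * (source t x - source t y)) *\<^sub>R k t)"
    using \<tau>(1) norm_resolvent_le by (simp add: d_def)
  also have "\<dots> \<le> norm (x - y) + \<tau> * (\<bar>source t x - source t y\<bar> * norm (k t))"
    using norm_triangle_ineq[of "x - y" "(\<tau> * (source t x - source t y)) *\<^sub>R k t"] \<tau>(1)
    by (simp add: abs_mult)
  also have "\<dots> \<le> norm (x - y) + \<tau> * (norm e * d / m * K)"
    using \<tau> c k(2)[OF t] m(1)
    by (intro add_left_mono mult_left_mono mult_mono) (auto simp: d_def)
  finally have *: "(1 - a * \<tau>) * d \<le> norm (x - y)"
    by (simp add: a_def algebra_simps)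
  have "2 * (a * \<tau>) \<le> 1"
    using small mult_left_mono[OF \<tau>(2) a] by (simp add: a_def)
  then have "1 * d \<le> ((1 - a * \<tau>) * exp (2 * (a * \<tau>))) * d"
    using \<tau>(1) a by (intro mult_right_mono one_le_exp_double) (auto simp: d_def)
  also have "\<dots> = exp (2 * (a * \<tau>)) * ((1 - a * \<tau>) * d)" by simp
  also have "\<dots> \<le> exp (2 * (a * \<tau>)) * norm (x - y)"
    using * by (intro mult_left_mono) auto
  finally show ?thesis by (simp add: d_def a_def \<tau>_def)
qed

lemma step_continuous:
  assumes "continuous_on {0..T} v"
  shows "continuous_on {0..T} (\<lambda>t. step t (v t))"
proof -
  have R: "continuous_on {0..T} (\<lambda>t. resolvent ((1 - q) * t) (x t))"
    if "continuous_on {0..T} x" for x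
    using that step_size(2) by (intro continuous_on_resolvent) (auto intro!: continuous_intros)
  have "continuous_on {0..T} (\<lambda>t. source t (v t))"
    unfolding source_def
  proof (rule continuous_on_divide)
    show "continuous_on {0..T} pivot"
      unfolding pivot_def
      by (intro continuous_intros R k bounded_linear.continuous_on[OF bounded_linear_G])
    show "\<forall>t\<in>{0..T}. pivot t \<noteq> 0"
      using pivot_lower m(1) by force
  qed (intro continuous_intros R \<eta> assms)
  then show ?thesis
    unfolding step_def by (intro R continuous_intros k assms)
qed

text \<open>For a general starting point a step is close to the identity without any rate; on the range of \<open>G\<close>
the error is linear in \<open>t\<close>, hence summable along the grid.\<close>

lemma step_near_identity: "\<exists>C. \<forall>t\<in>{0..T}. norm (step t (G z) - G z) \<le> C * t"
proof -
  define x where "x = G z"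
  obtain X where "\<forall>r\<in>\<eta> ` {0..T}. norm r \<le> X"
    using compact_imp_bounded[OF compact_continuous_image[OF \<eta> compact_Icc]]
    unfolding bounded_iff by blast
  then have X: "\<bar>\<eta> t\<bar> \<le> X" if "t \<in> {0..T}" for t using that by auto
  have X0: "0 \<le> X" using X[of 0] T by auto
  define S where "S = (X + norm e * norm x) / (m / 2)"
  have "norm (step t x - x) \<le> (norm z + S * K) * t" if t: "t \<in> {0..T}" for t
  proof -
    define \<tau> where "\<tau> = (1 - q) * t"
    have \<tau>: "0 \<le> \<tau>" "\<tau> \<le> t" using step_size(2,3)[of t] t by (auto simp: \<tau>_def)
    have "\<bar>inner e (resolvent \<tau> x)\<bar> \<le> norm e * norm (resolvent \<tau> x)"
      by (rule Cauchy_Schwarz_ineq2)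
    also have "\<dots> \<le> norm e * norm x"
      using \<tau>(1) norm_resolvent_le by (intro mult_left_mono) auto
    finally have "\<bar>\<eta> t + inner e (resolvent \<tau> x)\<bar> \<le> X + norm e * norm x"
      using X[OF t] by linarith
    then have S: "\<bar>source t x\<bar> \<le> S"
      unfolding source_def S_def abs_divide \<tau>_def[symmetric]
      using pivot_lower[OF t] m(1) X0 by (intro frac_le) auto
    have "step t x - x = (resolvent \<tau> (G z) - resolvent 0 (G z)) + (\<tau> * source t x) *\<^sub>R resolvent \<tau> (k t)"
      using \<tau>(1) by (simp add: step_def \<tau>_def[symmetric] resolvent_add resolvent_scaleR x_def)
    then have "norm (step t x - x) \<le> norm (resolvent \<tau> (G z) - resolvent 0 (G z))
        + \<tau> * (\<bar>source t x\<bar> * norm (resolvent \<tau> (k t)))"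
      using norm_triangle_ineq[of "resolvent \<tau> (G z) - resolvent 0 (G z)" "(\<tau> * source t x) *\<^sub>R resolvent \<tau> (k t)"] \<tau>(1)
      by (simp add: abs_mult)
    also have "\<dots> \<le> \<tau> * norm z + \<tau> * (S * K)"
    proof (intro add_mono mult_left_mono mult_mono)
      show "norm (resolvent \<tau> (G z) - resolvent 0 (G z)) \<le> \<tau> * norm z"
        using resolvent_G_diff_le[of 0 \<tau> z] \<tau>(1) by simp
      show "norm (resolvent \<tau> (k t)) \<le> K"
        using norm_resolvent_le[OF \<tau>(1), of "k t"] k(2)[OF t] by simp
    qed (use S \<tau> in auto)
    also have "\<dots> = (norm z + S * K) * \<tau>" by (simp add: algebra_simps)
    also have "\<dots> \<le> (norm z + S * K) * t"
      using \<tau>(2) X0 m(1) K_nonneg by (intro mult_left_mono) (auto simp: S_def)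
    finally show ?thesis .
  qed
  then show ?thesis unfolding x_def by blast
qed

text \<open>The composition of the steps at \<open>q\<^sup>n\<^sup>-\<^sup>1 t, \<dots>, q t, t\<close>, in this order.\<close>

primrec iterate :: "nat \<Rightarrow> real \<Rightarrow> 'a \<Rightarrow> 'a" where
  "iterate 0 t x = x"
| "iterate (Suc n) t x = step t (iterate n (q * t) x)"

lemma iterate_Suc_right: "iterate (Suc n) t x = iterate n t (step (q ^ n * t) x)"
proof (induction n arbitrary: t)
  case (Suc n)
  have "iterate (Suc (Suc n)) t x = step t (iterate n (q * t) (step (q ^ n * (q * t)) x))"
    by (simp only: iterate.simps(2)[of "Suc n"] Suc)
  also have "q ^ n * (q * t) = q ^ Suc n * t" by simp
  finally show ?case by simp
qed simp

text \<open>The step sizes sum up to at most \<open>t\<close>, so the product of the exponential factors stays below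
\<open>exp (2 a T) \<le> exp 1\<close>.\<close>

lemma iterate_Lipschitz:
  assumes "t \<in> {0..T}"
  shows "norm (iterate n t x - iterate n t y) \<le> 3 * norm (x - y)"
proof -
  define a where "a = K * norm e / m"
  have a: "0 \<le> a" using K_nonneg m by (simp add: a_def)
  have "norm (iterate n t x - iterate n t y) \<le> exp (2 * (a * t)) * norm (x - y)"
    using assms
  proof (induction n arbitrary: t)
    case 0
    have "1 * norm (x - y) \<le> exp (2 * (a * t)) * norm (x - y)"
      using a 0 by (intro mult_right_mono) auto
    then show ?case by simp
  next
    case (Suc n)
    have "norm (iterate (Suc n) t x - iterate (Suc n) t y)
        \<le> exp (2 * (a * ((1 - q) * t))) * norm (iterate n (q * t) x - iterate n (q * t) y)"
      using step_Lipschitz[OF Suc.prems] by (simp add: a_def)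
    also have "\<dots> \<le> exp (2 * (a * ((1 - q) * t))) * (exp (2 * (a * (q * t))) * norm (x - y))"
      using Suc.prems by (intro mult_left_mono Suc.IH contracted_time) auto
    also have "\<dots> = exp (2 * (a * ((1 - q) * t)) + 2 * (a * (q * t))) * norm (x - y)"
      by (simp add: exp_add)
    also have "2 * (a * ((1 - q) * t)) + 2 * (a * (q * t)) = 2 * (a * t)"
      by (simp add: algebra_simps)
    finally show ?case .
  qed
  also have "\<dots> \<le> 3 * norm (x - y)"
  proof (rule mult_right_mono)
    have "a * t \<le> a * T" using a assms by (intro mult_left_mono) auto
    then have "exp (2 * (a * t)) \<le> exp 1"
      using small by (simp add: a_def)
    also have "\<dots> \<le> (3::real)" by (rule exp_le)
    finally show "exp (2 * (a * t)) \<le> 3" .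
  qed simp
  finally show ?thesis .
qed

lemma iterate_continuous: "continuous_on {0..T} (\<lambda>t. iterate n t x)"
proof (induction n)
  case (Suc n)
  have "continuous_on {0..T} (\<lambda>t. iterate n (q * t) x)"
    using contracted_time
    by (intro continuous_on_compose2[OF Suc, of _ "\<lambda>t. q * t"] continuous_intros) blast
  then show ?case by (simp add: step_continuous)
qed simp

text \<open>For \<open>p = G z\<close> consecutive compositions differ in their innermost step only, which moves \<open>p\<close> by
\<open>O(q\<^sup>n)\<close>. The general case follows by approximating \<open>p\<close> and the uniform Lipschitz bound.\<close>

lemma iterate_Cauchy: "uniformly_Cauchy_on {0..T} (\<lambda>n t. iterate n t p)"
proof -
  have range: "uniformly_Cauchy_on {0..T} (\<lambda>n t. iterate n t (G z))" for z
  proof -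
    obtain C where C: "\<And>t. t \<in> {0..T} \<Longrightarrow> norm (step t (G z) - G z) \<le> C * t"
      using step_near_identity by blast
    have *: "uniformly_convergent_on {0..T} (\<lambda>n t. \<Sum>i<n. iterate (Suc i) t (G z) - iterate i t (G z))"
    proof (rule Weierstrass_m_test')
      fix n t assume t: "t \<in> {0..T}"
      have qt: "q ^ n * t \<in> {0..T}"
        using t q power_le_one[of q n] mult_left_le_one_le[of t "q ^ n"] by auto
      have "norm (iterate (Suc n) t (G z) - iterate n t (G z)) \<le> 3 * norm (step (q ^ n * t) (G z) - G z)"
        unfolding iterate_Suc_right by (rule iterate_Lipschitz[OF t])
      also have "\<dots> \<le> 3 * (C * (q ^ n * t))" using C[OF qt] by simp
      also have "\<dots> \<le> 3 * (\<bar>C\<bar> * (q ^ n * T))"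
        using t q by (intro mult_left_mono mult_mono) auto
      finally show "norm (iterate (Suc n) t (G z) - iterate n t (G z)) \<le> 3 * (\<bar>C\<bar> * (q ^ n * T))" .
    next
      show "summable (\<lambda>n. 3 * (\<bar>C\<bar> * (q ^ n * T)))"
        using q by (intro summable_mult summable_mult2 summable_geometric) auto
    qed
    have "uniformly_convergent_on {0..T} (\<lambda>n t. iterate n t (G z) - G z)"
    proof -
      have "(\<Sum>i<n. iterate (Suc i) t (G z) - iterate i t (G z)) = iterate n t (G z) - G z" for n t
        using sum_lessThan_telescope[of "\<lambda>i. iterate i t (G z)" n] by (simp only: iterate.simps(1))
      with * show ?thesis by (simp only:)
    qed
    from uniformly_convergent_Cauchy[OF this] show ?thesis
      by (simp add: uniformly_Cauchy_on_def dist_norm)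
  qed
  show ?thesis
  proof (rule uniformly_Cauchy_onI)
    fix \<epsilon> :: real assume \<epsilon>: "0 < \<epsilon>"
    have "p \<in> closure (range G)" by (simp add: dense_range)
    then obtain z where z: "norm (p - G z) < \<epsilon> / 9"
      using \<epsilon> unfolding closure_approachable
      by (metis dist_norm norm_minus_commute divide_pos_pos zero_less_numeral rangeE)
    obtain M where M: "\<And>t i j. t \<in> {0..T} \<Longrightarrow> i \<ge> M \<Longrightarrow> j \<ge> M \<Longrightarrow>
        norm (iterate i t (G z) - iterate j t (G z)) < \<epsilon> / 3"
      using range[of z] \<epsilon> unfolding uniformly_Cauchy_on_def dist_norm
      by (metis divide_pos_pos zero_less_numeral)
    have "norm (iterate i t p - iterate j t p) < \<epsilon>" if t: "t \<in> {0..T}" and ij: "i \<ge> M" "j \<ge> M" for t i j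
    proof -
      have near: "norm (iterate n t p - iterate n t (G z)) < \<epsilon> / 3" for n
        using iterate_Lipschitz[OF t, of n p "G z"] z by simp
      have "norm (iterate i t p - iterate j t p)
          = norm ((iterate i t p - iterate i t (G z)) + (iterate i t (G z) - iterate j t (G z))
            - (iterate j t p - iterate j t (G z)))" by simp
      also have "\<dots> \<le> norm (iterate i t p - iterate i t (G z)) + norm (iterate i t (G z) - iterate j t (G z))
            + norm (iterate j t p - iterate j t (G z))"
        by (rule norm_add_diff_le)
      finally show ?thesis using near[of i] near[of j] M[OF t ij] by linarith
    qed
    then show "\<exists>M. \<forall>t\<in>{0..T}. \<forall>i\<ge>M. \<forall>j\<ge>M. dist (iterate i t p) (iterate j t p) < \<epsilon>"
      unfolding dist_norm by blast
  qed
qed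

lemma existence: "\<exists>w \<upsilon>. continuous_on {0..T} \<upsilon> \<and> solves T p k \<eta> w \<upsilon>"
proof -
  obtain w where w: "uniform_limit {0..T} (\<lambda>n t. iterate n t p) w sequentially"
    using Cauchy_uniformly_convergent[OF iterate_Cauchy] unfolding uniformly_convergent_on_def by blast
  have lim: "(\<lambda>n. iterate n t p) \<longlonglongrightarrow> w t" if "t \<in> {0..T}" for t
    using tendsto_uniform_limitI[OF w that] .
  have cont: "continuous_on {0..T} w"
    by (rule uniform_limit_theorem[OF _ w]) (simp_all add: iterate_continuous)
  have fix_eq: "w t = step t (w (q * t))" if t: "t \<in> {0..T}" for t
  proof (rule LIMSEQ_unique)
    show "(\<lambda>n. iterate (Suc n) t p) \<longlonglongrightarrow> w t"
      using LIMSEQ_Suc[OF lim[OF t]] .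
    have "(\<lambda>n. iterate n (q * t) p - w (q * t)) \<longlonglongrightarrow> 0"
      by (rule LIM_zero[OF lim[OF contracted_time[OF t]]])
    then have "(\<lambda>n. exp (2 * (K * norm e / m * ((1 - q) * t))) * norm (iterate n (q * t) p - w (q * t))) \<longlonglongrightarrow> 0"
      by (intro tendsto_mult_right_zero tendsto_norm_zero)
    then have "(\<lambda>n. step t (iterate n (q * t) p) - step t (w (q * t))) \<longlonglongrightarrow> 0"
      by (rule Lim_null_comparison[rotated]) (intro always_eventually allI step_Lipschitz[OF t])
    then show "(\<lambda>n. iterate (Suc n) t p) \<longlonglongrightarrow> step t (w (q * t))"
      by (simp add: LIM_zero_iff)
  qed
  have "iterate n 0 p = p" for n
    by (induction n) (auto simp: step_def)
  then have w0: "w 0 = p"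
    using lim[of 0] T by (simp add: LIMSEQ_const_iff)
  define \<upsilon> where "\<upsilon> t = (\<eta> t + inner e (w t)) / inner e (G (k t))" for t
  have nz: "inner e (G (k t)) \<noteq> 0" if "t \<in> {0..T}" for t
    using m that by force
  have \<upsilon>: "\<upsilon> t = source t (w (q * t))" if t: "t \<in> {0..T}" for t
    using source_eq[OF t, of "w (q * t)"] nz[OF t] by (simp add: \<upsilon>_def fix_eq[OF t, symmetric] field_simps)
  have "continuous_on {0..T} \<upsilon>"
    unfolding \<upsilon>_def using nz
    by (intro continuous_intros cont k \<eta> bounded_linear.continuous_on[OF bounded_linear_G]) auto
  moreover have "solves T p k \<eta> w \<upsilon>"
    unfolding solves_def
  proof (intro conjI ballI)
    fix t assume "t \<in> {0<..T}"
    then have t: "t \<in> {0..T}" "0 < t" by auto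
    have "w t = resolvent ((1 - q) * t) (w (q * t) + ((1 - q) * t * \<upsilon> t) *\<^sub>R k t)"
      using fix_eq[OF t(1)] by (simp add: step_def \<upsilon>[OF t(1)])
    then show "G (w t) + ((1 - q) * t) *\<^sub>R w t = G (w (q * t)) + ((1 - q) * t * \<upsilon> t) *\<^sub>R G (k t)"
      using resolvent_equation[OF step_size(1)[OF t(2)], of "w (q * t) + ((1 - q) * t * \<upsilon> t) *\<^sub>R k t"]
      by (simp add: G_add G_scaleR)
  qed (use cont w0 nz in \<open>auto simp: \<upsilon>_def\<close>)
  ultimately show ?thesis by blast
qed
end

end

section \<open>Green's operator on the powers of q\<close>

locale geometric_grid =
  fixes q :: real
  assumes q: "0 < q" "q < 1"
begin

text \<open>The mass of the point \<open>q\<^sup>n\<close> in the Jackson integral over \<open>[0,1]\<close>.\<close>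

definition wt :: "nat \<Rightarrow> real" where "wt n = (1 - q) * q ^ n"

lemma wt_pos: "0 < wt n" using q by (simp add: wt_def)

lemma wt_nonneg: "0 \<le> wt n" using wt_pos[of n] by simp

lemma wt_sums: "(\<lambda>n. wt n) sums 1"
  using sums_mult[OF geometric_sums[of q], of "1 - q"] q by (simp add: wt_def)

lemma wt_shift: "wt (n + j) = q ^ n * wt j" by (simp add: wt_def power_add)

lemma wt_shift_sums: "(\<lambda>j. wt (n + j)) sums q ^ n"
  using sums_mult[OF wt_sums, of "q ^ n"] by (simp add: wt_shift)

lemma sum_wt_Suc_le: "(\<Sum>i<n. wt (Suc i)) \<le> 1"
proof -
  have "(\<Sum>i<n. wt (Suc i)) \<le> (\<Sum>i<Suc n. wt i)"
    by (simp only: sum.lessThan_Suc_shift) (simp add: wt_nonneg)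
  also have "\<dots> \<le> 1"
    using sum_le_suminf[OF sums_summable[OF wt_sums], of "{..<Suc n}"] wt_sums wt_nonneg
    by (simp add: sums_iff)
  finally show ?thesis .
qed

lemma summable_wt_bounded:
  assumes "\<And>n. \<bar>y n\<bar> \<le> B"
  shows "summable (\<lambda>n. wt n * y n)"
proof (rule summable_comparison_test')
  show "summable (\<lambda>n. wt n * B)" using wt_sums by (intro summable_mult2) (simp add: sums_iff)
  show "norm (wt n * y n) \<le> wt n * B" if "n \<ge> 0" for n
    using assms[of n] wt_nonneg[of n] by (simp add: abs_mult mult_left_mono)
qed

text \<open>Coordinate \<open>i\<close> of a sequence belongs to the point \<open>q\<^sup>i\<^sup>+\<^sup>1\<close>, scaled so that the norm is that of
\<open>L\<^sup>2\<^sub>q\<close>. The point \<open>q\<^sup>0 = 1\<close> carries the boundary value \<open>0\<close> and has no coordinate.\<close>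

definition val :: "l2 \<Rightarrow> nat \<Rightarrow> real" where
  "val a n = (case n of 0 \<Rightarrow> 0 | Suc i \<Rightarrow> coord a i / sqrt (wt (Suc i)))"

definition of_val :: "(nat \<Rightarrow> real) \<Rightarrow> l2" where
  "of_val y = Abs_l2 (\<lambda>i. sqrt (wt (Suc i)) * y (Suc i))"

lemma val_0 [simp]: "val a 0 = 0" by (simp add: val_def)

lemma val_Suc: "val a (Suc i) = coord a i / sqrt (wt (Suc i))" by (simp add: val_def)

lemma coord_eq_val: "coord a i = sqrt (wt (Suc i)) * val a (Suc i)"
  using wt_pos[of "Suc i"] by (simp add: val_Suc)

lemma val_eqI: "(\<And>n. val a n = val b n) \<Longrightarrow> a = b"
  by (rule l2_eqI) (simp add: coord_eq_val)

lemma val_add: "val (a + b) n = val a n + val b n"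
  and val_diff: "val (a - b) n = val a n - val b n"
  and val_scaleR: "val (r *\<^sub>R a) n = r * val a n"
  by (simp_all add: val_def coord_add coord_diff coord_scaleR add_divide_distrib diff_divide_distrib split: nat.split)

lemma bounded_linear_val: "bounded_linear (\<lambda>a. val a n)"
proof (cases n)
  case (Suc i)
  have "bounded_linear (\<lambda>a. (1 / sqrt (wt (Suc i))) * coord a i)"
    by (rule bounded_linear_const_mult[OF bounded_linear_coord])
  then show ?thesis by (simp add: Suc val_Suc)
qed simp

lemma inner_val_sums: "(\<lambda>n. wt n * (val a n * val b n)) sums inner a b"
proof -
  have "(\<lambda>i. wt (Suc i) * (val a (Suc i) * val b (Suc i))) sums inner a b"
  proof -
    have "coord a i * coord b i = wt (Suc i) * (val a (Suc i) * val b (Suc i))" for i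
    proof -
      have "coord a i * coord b i = (sqrt (wt (Suc i)) * sqrt (wt (Suc i))) * (val a (Suc i) * val b (Suc i))"
        unfolding coord_eq_val by (simp only: mult_ac)
      then show ?thesis using wt_nonneg[of "Suc i"] by simp
    qed
    then show ?thesis using inner_l2_sums[of a b] by simp
  qed
  then show ?thesis by (subst (asm) sums_Suc_iff) simp
qed

lemma val_of_val:
  assumes "summable (\<lambda>n. wt n * (y n)\<^sup>2)"
  shows "val (of_val y) n = (if n = 0 then 0 else y n)"
proof (cases n)
  case (Suc i)
  have "summable (\<lambda>i. (sqrt (wt (Suc i)) * y (Suc i))\<^sup>2)"
    using assms summable_Suc_iff[of "\<lambda>n. wt n * (y n)\<^sup>2"] wt_nonneg
    by (simp add: power_mult_distrib)
  then show ?thesis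
    using wt_pos[of "Suc i"] by (simp add: Suc val_Suc of_val_def Abs_l2_inverse)
qed simp

text \<open>To solve \<open>L y = a\<close>: at the points \<open>q\<^sup>n\<close> the operator is the difference quotient of
\<open>D\<^sub>q y\<close>, so \<open>D\<^sub>q y\<close> is a partial sum of \<open>a\<close> plus a constant, and \<open>y\<close> is the sum of \<open>D\<^sub>q y\<close> from
the point \<open>q\<^sup>n\<close> down to \<open>0\<close>, where \<open>y\<close> vanishes. The constant in \<open>slope\<close> is the one for which
\<open>y\<close> vanishes at \<open>1\<close> as well; it is a mean value because the weights sum up to \<open>1\<close>.\<close>

definition flux :: "l2 \<Rightarrow> nat \<Rightarrow> real" where
  "flux a n = (\<Sum>i<n. wt (Suc i) * val a (Suc i))"

definition slope :: "l2 \<Rightarrow> nat \<Rightarrow> real" where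
  "slope a n = flux a n - (\<Sum>j. wt j * flux a j)"

definition potential :: "l2 \<Rightarrow> nat \<Rightarrow> real" where
  "potential a n = (\<Sum>j. wt (n + j) * slope a (n + j))"

definition green :: "l2 \<Rightarrow> l2" where
  "green a = of_val (potential a)"

lemma abs_flux_le: "\<bar>flux a n\<bar> \<le> norm a"
proof -
  have "flux a n = (\<Sum>i<n. sqrt (wt (Suc i)) * coord a i)"
    using wt_nonneg by (simp add: flux_def coord_eq_val flip: mult.assoc)
  then have "(flux a n)\<^sup>2 \<le> (\<Sum>i<n. (sqrt (wt (Suc i)))\<^sup>2) * (\<Sum>i<n. (coord a i)\<^sup>2)"
    by (simp only: Cauchy_Schwarz_ineq_sum)
  also have "\<dots> \<le> 1 * (norm a)\<^sup>2"
    using sum_wt_Suc_le[of n] sum_square_coord_le[where x = a and n = n] wt_nonneg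
    by (intro mult_mono) (auto intro: sum_nonneg)
  finally show ?thesis using abs_le_square_iff[of "flux a n" "norm a"] by simp
qed

lemma summable_flux: "summable (\<lambda>j. wt j * flux a j)"
  by (rule summable_wt_bounded[OF abs_flux_le])

lemma abs_slope_le: "\<bar>slope a n\<bar> \<le> 2 * norm a"
proof -
  have "\<bar>\<Sum>j. wt j * flux a j\<bar> \<le> (\<Sum>j. \<bar>wt j * flux a j\<bar>)"
    using summable_wt_bounded[of "\<lambda>j. \<bar>flux a j\<bar>" "norm a"] abs_flux_le wt_nonneg
    by (intro summable_rabs) (simp add: abs_mult)
  also have "\<dots> \<le> (\<Sum>j. wt j * norm a)"
    using summable_wt_bounded[of "\<lambda>j. \<bar>flux a j\<bar>" "norm a"] abs_flux_le wt_nonneg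
      summable_wt_bounded[of "\<lambda>j. norm a" "norm a"]
    by (intro suminf_le) (auto simp: abs_mult mult_left_mono)
  also have "\<dots> = norm a"
    using sums_mult2[OF wt_sums, of "norm a"] by (simp add: sums_iff)
  finally show ?thesis using abs_flux_le[of a n] by (simp add: slope_def)
qed

lemma summable_slope: "summable (\<lambda>j. wt (n + j) * slope a (n + j))"
  using summable_ignore_initial_segment[OF summable_wt_bounded[OF abs_slope_le], of n a]
  by (simp add: add.commute)

lemma potential_Suc: "potential a n - potential a (Suc n) = wt n * slope a n"
  using suminf_split_head[OF summable_slope, of n a] by (simp add: potential_def)

lemma slope_Suc: "slope a (Suc n) - slope a n = wt (Suc n) * val a (Suc n)"
  by (simp add: slope_def flux_def)

lemma potential_0: "potential a 0 = 0"
proof -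
  have "potential a 0 = (\<Sum>j. wt j * flux a j - wt j * (\<Sum>j. wt j * flux a j))"
    by (simp add: potential_def slope_def right_diff_distrib)
  also have "\<dots> = 0"
    using sums_diff[OF summable_sums[OF summable_flux[of a]] sums_mult2[OF wt_sums, of "\<Sum>j. wt j * flux a j"]]
    by (simp add: sums_iff)
  finally show ?thesis .
qed

text \<open>The slopes are bounded, and the mass of the grid below \<open>q\<^sup>n\<close> is \<open>q\<^sup>n\<close>.\<close>

lemma abs_potential_le: "\<bar>potential a n\<bar> \<le> 2 * norm a * q ^ n"
proof -
  have s: "summable (\<lambda>j. wt (n + j) * (2 * norm a))"
    using wt_shift_sums[of n] by (intro summable_mult2) (simp add: sums_iff)
  have le: "norm (wt (n + j) * slope a (n + j)) \<le> wt (n + j) * (2 * norm a)" for j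
    using abs_slope_le[of a "n + j"] wt_nonneg[of "n + j"] by (simp add: abs_mult mult_left_mono)
  have "\<bar>potential a n\<bar> \<le> (\<Sum>j. wt (n + j) * (2 * norm a))"
    using norm_suminf_le[OF le s] by (simp add: potential_def)
  also have "\<dots> = 2 * norm a * q ^ n"
    using sums_mult2[OF wt_shift_sums[of n], of "2 * norm a"] by (simp add: sums_iff mult.commute)
  finally show ?thesis .
qed

lemma potential_tendsto_0: "potential a \<longlonglongrightarrow> 0"
proof (rule Lim_null_comparison)
  show "\<forall>\<^sub>F n in sequentially. norm (potential a n) \<le> 2 * norm a * q ^ n"
    by (simp add: abs_potential_le)
  show "(\<lambda>n. 2 * norm a * q ^ n) \<longlonglongrightarrow> 0"
    using q by (intro tendsto_mult_right_zero LIMSEQ_realpow_zero) auto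
qed

lemma abs_potential_le': "\<bar>potential a n\<bar> \<le> 2 * norm a"
  using abs_potential_le[of a n] mult_left_mono[of "q ^ n" 1 "2 * norm a"] q
  by (simp add: power_le_one)

lemma val_green: "val (green a) n = potential a n"
proof -
  have "summable (\<lambda>n. wt n * (potential a n)\<^sup>2)"
    using abs_potential_le'[of a] power_mono[of "\<bar>potential a n\<bar>" "2 * norm a" 2 for n]
    by (intro summable_wt_bounded[where B = "(2 * norm a)\<^sup>2"]) simp
  then show ?thesis by (simp add: green_def val_of_val potential_0)
qed

text \<open>The difference of two solutions has constant slope, and both boundary values vanish.\<close>

lemma green_unique:
  assumes y: "y 0 = 0" "y \<longlonglongrightarrow> 0"
    and D: "\<And>n. (y (Suc n) - y (Suc (Suc n))) / wt (Suc n) - (y n - y (Suc n)) / wt n = wt (Suc n) * val a (Suc n)"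
  shows "y n = val (green a) n"
proof -
  define z where "z n = y n - potential a n" for n
  \<comment> \<open>the common slope of the difference\<close>
  define c where "c = (z 0 - z 1) / wt 0"
  have dz: "z n - z (Suc n) = wt n * c" for n
  proof -
    have slope: "slope a n = (potential a n - potential a (Suc n)) / wt n" for n
      using wt_pos[of n] by (simp add: potential_Suc)
    have "(z n - z (Suc n)) / wt n = c"
    proof (induction n)
      case (Suc n)
      then show ?case
        using D[of n] slope_Suc[of a n] unfolding slope
        by (simp add: z_def diff_divide_distrib)
    qed (simp add: c_def)
    then show ?thesis using wt_pos[of n] by (simp add: field_simps)
  qed
  have z: "z n = - c * (\<Sum>j<n. wt j)" for n
  proof (induction n)
    case (Suc n)
    then show ?case using dz[of n] by (simp add: algebra_simps)
  qed (simp add: z_def y(1) potential_0)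
  have "z \<longlonglongrightarrow> - c * 1"
    unfolding z using wt_sums by (intro tendsto_mult tendsto_const) (simp add: sums_def)
  moreover have "z \<longlonglongrightarrow> 0 - 0"
    unfolding z_def by (intro tendsto_diff y(2) potential_tendsto_0)
  ultimately have "c = 0"
    using LIMSEQ_unique by fastforce
  then show ?thesis using z[of n] by (simp add: z_def val_green)
qed

lemma inj_green: "inj green"
proof (rule injI, rule val_eqI)
  fix a b n
  assume "green a = green b"
  then have pot: "potential a n = potential b n" for n by (simp flip: val_green)
  have slope: "slope a n = slope b n" for n
    using potential_Suc[of a n] potential_Suc[of b n] wt_pos[of n] by (simp add: pot)
  show "val a n = val b n"
  proof (cases n)
    case (Suc i)
    then show ?thesis using slope_Suc[of a i] slope_Suc[of b i] wt_pos[of n] by (simp add: slope)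
  qed simp
qed

lemma green_add: "green (a + b) = green a + green b"
  and green_scaleR: "green (r *\<^sub>R a) = r *\<^sub>R green a"
proof -
  have dist: "(y (Suc n) - y (Suc (Suc n))) / wt (Suc n) - (y n - y (Suc n)) / wt n
      = wt (Suc n) * val a (Suc n)" if "y = potential a" for y a n
    using potential_Suc[of a] slope_Suc[of a n] wt_pos[of n] wt_pos[of "Suc n"] that by simp
  show "green (a + b) = green a + green b"
  proof (rule val_eqI)
    fix n
    have "potential a n + potential b n = val (green (a + b)) n"
    proof (rule green_unique)
      show "(\<lambda>n. potential a n + potential b n) \<longlonglongrightarrow> 0"
        using tendsto_add[OF potential_tendsto_0 potential_tendsto_0] by simp
      fix n
      show "(potential a (Suc n) + potential b (Suc n) - (potential a (Suc (Suc n)) + potential b (Suc (Suc n)))) / wt (Suc n)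
          - (potential a n + potential b n - (potential a (Suc n) + potential b (Suc n))) / wt n
          = wt (Suc n) * val (a + b) (Suc n)"
        using dist[of "potential a" a n] dist[of "potential b" b n]
        by (simp add: val_add diff_divide_distrib add_divide_distrib distrib_left)
    qed (simp add: potential_0)
    then show "val (green (a + b)) n = val (green a + green b) n"
      by (simp add: val_add val_green)
  qed
  show "green (r *\<^sub>R a) = r *\<^sub>R green a"
  proof (rule val_eqI)
    fix n
    have "r * potential a n = val (green (r *\<^sub>R a)) n"
    proof (rule green_unique)
      show "(\<lambda>n. r * potential a n) \<longlonglongrightarrow> 0"
        by (rule tendsto_mult_right_zero[OF potential_tendsto_0])
      fix n
      have "r * ((potential a (Suc n) - potential a (Suc (Suc n))) / wt (Suc n) - (potential a n - potential a (Suc n)) / wt n)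
          = r * (wt (Suc n) * val a (Suc n))"
        by (simp only: dist[OF refl])
      then show "(r * potential a (Suc n) - r * potential a (Suc (Suc n))) / wt (Suc n)
          - (r * potential a n - r * potential a (Suc n)) / wt n = wt (Suc n) * val (r *\<^sub>R a) (Suc n)"
        by (simp add: val_scaleR diff_divide_distrib right_diff_distrib mult_ac)
    qed (simp add: potential_0)
    then show "val (green (r *\<^sub>R a)) n = val (r *\<^sub>R green a) n"
      by (simp add: val_scaleR val_green)
  qed
qed

lemma norm_green_le: "norm (green a) \<le> 2 * norm a"
proof -
  have "(norm (green a))\<^sup>2 = (\<Sum>n. wt n * (potential a n)\<^sup>2)"
    using inner_val_sums[of "green a" "green a"] by (simp add: val_green sums_iff dot_square_norm power2_eq_square)
  also have "\<dots> \<le> (\<Sum>n. wt n * (2 * norm a)\<^sup>2)"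
  proof (rule suminf_le)
    show "wt n * (potential a n)\<^sup>2 \<le> wt n * (2 * norm a)\<^sup>2" for n
      using power_mono[OF abs_potential_le'[of a n], of 2] wt_nonneg[of n]
      by (intro mult_left_mono) simp_all
    show "summable (\<lambda>n. wt n * (potential a n)\<^sup>2)"
      using inner_val_sums[of "green a" "green a"] by (simp add: val_green sums_iff power2_eq_square)
    show "summable (\<lambda>n. wt n * (2 * norm a)\<^sup>2)"
      by (rule summable_wt_bounded[where B = "(2 * norm a)\<^sup>2"]) simp
  qed
  also have "\<dots> = (2 * norm a)\<^sup>2"
    using sums_mult2[OF wt_sums, of "(2 * norm a)\<^sup>2"] by (simp add: sums_iff)
  finally show ?thesis by (rule power2_le_imp_le) simp
qed

lemma bounded_linear_green: "bounded_linear green"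
  by (rule bounded_linear_intro[where K = 2])
    (use norm_green_le in \<open>auto simp: green_add green_scaleR mult.commute\<close>)

text \<open>Summation by parts; the boundary terms disappear since slopes are bounded and potentials vanish at
both ends. The symmetric right-hand side yields symmetry and positivity of \<open>green\<close> at once.\<close>

lemma dirichlet_form_sums: "(\<lambda>n. wt n * (slope a n * slope b n)) sums inner a (green b)"
proof -
  have parts: "(\<Sum>n<N. wt n * (slope a n * slope b n))
      = (\<Sum>n<Suc N. wt n * (val a n * val (green b) n)) - slope a N * potential b N" for N
  proof (induction N)
    case 0
    show ?case by (simp add: potential_0)
  next
    case (Suc N)
    have "wt (Suc N) * val a (Suc N) * potential b (Suc N)
        = (slope a (Suc N) - slope a N) * potential b (Suc N)"
      by (simp only: slope_Suc)
    moreover have "wt N * slope b N = potential b N - potential b (Suc N)"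
      by (simp only: potential_Suc)
    then have "wt N * (slope a N * slope b N) = slope a N * (potential b N - potential b (Suc N))"
      by (simp add: mult_ac)
    ultimately show ?case
      using Suc by (simp add: val_green algebra_simps)
  qed
  have "(\<lambda>N. slope a N * potential b N) \<longlonglongrightarrow> 0"
  proof (rule Lim_null_comparison)
    show "\<forall>\<^sub>F N in sequentially. norm (slope a N * potential b N) \<le> 2 * norm a * \<bar>potential b N\<bar>"
      using abs_slope_le by (simp add: abs_mult mult_right_mono)
    show "(\<lambda>N. 2 * norm a * \<bar>potential b N\<bar>) \<longlonglongrightarrow> 0"
      using potential_tendsto_0 by (intro tendsto_mult_right_zero tendsto_rabs_zero)
  qed
  moreover have "(\<lambda>N. \<Sum>n<Suc N. wt n * (val a n * val (green b) n)) \<longlonglongrightarrow> inner a (green b)"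
    using inner_val_sums[of a "green b"] unfolding sums_def by (rule LIMSEQ_Suc)
  ultimately have "(\<lambda>N. (\<Sum>n<Suc N. wt n * (val a n * val (green b) n)) - slope a N * potential b N)
      \<longlonglongrightarrow> inner a (green b) - 0"
    by (intro tendsto_diff)
  then show ?thesis unfolding sums_def parts by simp
qed

lemma green_symmetric: "inner a (green b) = inner (green a) b"
  using dirichlet_form_sums[of a b] dirichlet_form_sums[of b a]
  by (simp add: sums_iff inner_commute mult.commute mult.left_commute)

lemma green_positive: "0 \<le> inner (green a) a"
proof -
  have "0 \<le> (\<Sum>n. wt n * (slope a n * slope a n))"
    using dirichlet_form_sums[of a a] wt_nonneg by (intro suminf_nonneg) (auto simp: sums_iff)
  then show ?thesis
    using dirichlet_form_sums[of a a] by (simp add: sums_iff green_symmetric)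
qed

text \<open>If \<open>y\<close> has finite support, so does \<open>L y\<close>.\<close>

lemma green_surj_finite:
  assumes "y 0 = 0" and "\<And>n. n \<ge> N \<Longrightarrow> y n = 0"
  shows "\<exists>a. \<forall>n. val (green a) n = y n"
proof -
  define D where "D n = (y n - y (Suc n)) / wt n" for n
  define h where "h n = (case n of 0 \<Rightarrow> 0 | Suc i \<Rightarrow> (D (Suc i) - D i) / wt (Suc i))" for n
  have D: "D n = 0" if "n \<ge> N" for n using that assms(2) by (simp add: D_def)
  have "h n = 0" if "n \<ge> Suc N" for n
    using that D by (auto simp: h_def split: nat.split)
  then have "summable (\<lambda>n. wt n * (h n)\<^sup>2)"
    by (intro summable_finite[of "{..<Suc N}"]) (auto simp: not_less)
  then have val: "val (of_val h) n = h n" for n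
    by (simp add: val_of_val h_def)
  have "y n = val (green (of_val h)) n" for n
  proof (rule green_unique)
    show "y \<longlonglongrightarrow> 0"
      using assms(2) by (intro tendsto_eventually) (auto simp: eventually_sequentially)
    show "(y (Suc n) - y (Suc (Suc n))) / wt (Suc n) - (y n - y (Suc n)) / wt n = wt (Suc n) * val (of_val h) (Suc n)" for n
      using wt_pos[of "Suc n"] by (simp add: val h_def D_def)
  qed (rule assms(1))
  then show ?thesis by metis
qed

lemma dense_range_green: "closure (range green) = UNIV"
proof -
  have "a \<in> closure (range green)" for a
    unfolding closure_sequential
  proof (intro exI conjI allI)
    define X where "X N = Abs_l2 (\<lambda>i. if i < N then coord a i else 0)" for N
    have X: "coord (X N) i = (if i < N then coord a i else 0)" for N i
    proof -
      have "summable (\<lambda>i. (if i < N then coord a i else 0)\<^sup>2)"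
        by (rule summable_finite[of "{..<N}"]) auto
      then show ?thesis by (simp add: X_def Abs_l2_inverse)
    qed
    show "X N \<in> range green" for N
    proof -
      have "\<exists>b. \<forall>n. val (green b) n = val (X N) n"
        by (rule green_surj_finite[where N = "Suc N"]) (auto simp: val_def X split: nat.split)
      then obtain b where "green b = X N" using val_eqI by blast
      then show ?thesis by (metis rangeI)
    qed
    have "(norm (X N - a))\<^sup>2 = (norm a)\<^sup>2 - (\<Sum>i<N. (coord a i)\<^sup>2)" for N
    proof -
      have "(\<lambda>i. (coord a i)\<^sup>2 - (if i \<in> {..<N} then (coord a i)\<^sup>2 else 0)) sums ((norm a)\<^sup>2 - (\<Sum>i\<in>{..<N}. (coord a i)\<^sup>2))"
        by (intro sums_diff norm_l2_sums sums_If_finite_set) simp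
      moreover have "(\<lambda>i. (coord a i)\<^sup>2 - (if i \<in> {..<N} then (coord a i)\<^sup>2 else 0)) = (\<lambda>i. (coord (X N - a) i)\<^sup>2)"
        by (auto simp: coord_diff X)
      ultimately show ?thesis using norm_l2_sums[of "X N - a"] sums_unique2 by metis
    qed
    moreover have "(\<lambda>N. (norm a)\<^sup>2 - (\<Sum>i<N. (coord a i)\<^sup>2)) \<longlonglongrightarrow> (norm a)\<^sup>2 - (norm a)\<^sup>2"
      using norm_l2_sums[of a] by (intro tendsto_diff tendsto_const) (simp add: sums_def)
    ultimately have "(\<lambda>N. sqrt ((norm (X N - a))\<^sup>2)) \<longlonglongrightarrow> sqrt 0"
      by (intro tendsto_real_sqrt) simp
    then show "X \<longlonglongrightarrow> a"
      by (simp add: LIM_zero_iff tendsto_norm_zero_iff)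
  qed
  then show ?thesis by blast
qed

end

sublocale geometric_grid \<subseteq> positive_operator green
  by (intro positive_operator.intro bounded_linear_green green_positive dense_range_green)

section \<open>Functions on the interval as square-summable sequences\<close>

context geometric_grid
begin

lemma grid_inj: "q ^ n = q ^ m \<longleftrightarrow> n = m" for n m :: nat
  using q power_strict_decreasing_iff[of q] by (metis linorder_neqE_nat less_irrefl)

lemma L2q_iff: "g \<in> L2q q \<longleftrightarrow> summable (\<lambda>n. wt n * (g (q ^ n))\<^sup>2)"
proof -
  have "summable (\<lambda>n. wt n * (g (q ^ n))\<^sup>2) \<longleftrightarrow> summable (\<lambda>n. (1 - q) * (q ^ n * (g (q ^ n))\<^sup>2))"
    by (simp add: wt_def mult.assoc)
  also have "\<dots> \<longleftrightarrow> summable (\<lambda>n. q ^ n * (g (q ^ n))\<^sup>2)"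
    using q by (simp add: summable_cmult_iff)
  finally show ?thesis by (simp add: L2q_def)
qed

lemma jackson_integral_sums:
  assumes "(\<lambda>n. wt n * g (q ^ n)) sums s"
  shows "jackson_integral q 0 1 g = s"
proof -
  have "(\<lambda>n. wt n * g (q ^ n) / (1 - q)) sums (s / (1 - q))"
    by (rule sums_divide[OF assms])
  moreover have "(\<lambda>n. wt n * g (q ^ n) / (1 - q)) = (\<lambda>n. q ^ n * g (q ^ n))"
    using q by (auto simp: wt_def)
  ultimately show ?thesis
    using q by (simp add: jackson_integral_def sums_iff)
qed

definition emb :: "(real \<Rightarrow> real) \<Rightarrow> l2" where "emb g = of_val (\<lambda>n. g (q ^ n))"

lemma val_emb: "g \<in> L2q q \<Longrightarrow> val (emb g) n = (if n = 0 then 0 else g (q ^ n))"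
  by (simp add: emb_def val_of_val L2q_iff)

lemma emb_eqI:
  assumes "\<And>n. 0 < n \<Longrightarrow> g (q ^ n) = val a n"
  shows "g \<in> L2q q" "emb g = a"
proof -
  have "summable (\<lambda>n. wt (Suc n) * (g (q ^ Suc n))\<^sup>2)"
    using inner_val_sums[of a a] assms summable_Suc_iff[of "\<lambda>n. wt n * (val a n)\<^sup>2"]
    by (simp add: sums_iff power2_eq_square del: power_Suc)
  then show g: "g \<in> L2q q"
    unfolding L2q_iff by (simp only: summable_Suc_iff[of "\<lambda>n. wt n * (g (q ^ n))\<^sup>2"])
  show "emb g = a"
    by (rule val_eqI) (use assms in \<open>auto simp: val_emb[OF g]\<close>)
qed

lemma L2q_inner_eq:
  assumes "g \<in> L2q q" "h \<in> L2q q" "g 1 = 0 \<or> h 1 = 0"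
  shows "L2q_inner q g h = inner (emb g) (emb h)"
proof -
  have "(\<lambda>n. wt n * (val (emb g) n * val (emb h) n)) = (\<lambda>n. wt n * (g (q ^ n) * h (q ^ n)))"
    using assms by (auto simp: val_emb)
  then show ?thesis
    using inner_val_sums[of "emb g" "emb h"] unfolding L2q_inner_def
    by (intro jackson_integral_sums) simp
qed

text \<open>The sequence does not see the value at \<open>1\<close>, which contributes separately.\<close>

lemma L2q_norm_eq:
  assumes "g \<in> L2q q"
  shows "L2q_norm q g = sqrt (wt 0 * (g 1)\<^sup>2 + (norm (emb g))\<^sup>2)"
proof -
  have "(\<lambda>n. wt n * (val (emb g) n * val (emb g) n) + (if n = 0 then wt 0 * (g 1)\<^sup>2 else 0))
      sums (inner (emb g) (emb g) + wt 0 * (g 1)\<^sup>2)"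
    by (intro sums_add inner_val_sums sums_single)
  moreover have "(\<lambda>n. wt n * (val (emb g) n * val (emb g) n) + (if n = 0 then wt 0 * (g 1)\<^sup>2 else 0))
      = (\<lambda>n. wt n * (g (q ^ n))\<^sup>2)"
    using assms by (auto simp: val_emb power2_eq_square)
  ultimately have "jackson_integral q 0 1 (\<lambda>x. \<bar>g x\<bar>\<^sup>2) = inner (emb g) (emb g) + wt 0 * (g 1)\<^sup>2"
    by (intro jackson_integral_sums) simp
  then show ?thesis
    by (simp add: L2q_norm_def dot_square_norm add.commute)
qed

lemma Dq_nonzero: "x \<noteq> 0 \<Longrightarrow> Dq q y x = (y x - y (q * x)) / ((1 - q) * x)"
  by (simp add: Dq_def qderiv_def qquot_def)

text \<open>The factor \<open>- 1 / q\<close> and the base \<open>1 / q\<close> combine into a backward difference quotient.\<close>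

lemma Lop_nonzero:
  assumes "x \<noteq> 0"
  shows "Lop q y x = (Dq q y x - Dq q y (x / q)) / ((1 - q) * x)"
proof -
  have "Lop q y x = - (1 / q) * ((Dq q y x - Dq q y (x / q)) / ((1 - 1 / q) * x))"
    using assms by (simp add: Lop_def Dqinv_def qderiv_def qquot_def)
  also have "\<dots> = (Dq q y x - Dq q y (x / q)) / (- q * ((1 - 1 / q) * x))"
    by simp
  also have "- q * ((1 - 1 / q) * x) = (1 - q) * x"
    using q by (simp add: field_simps)
  finally show ?thesis .
qed

lemma Dq_grid: "Dq q y (q ^ n) = (y (q ^ n) - y (q ^ Suc n)) / wt n"
  using q by (simp add: Dq_nonzero wt_def)

lemma Lop_grid:
  "Lop q y (q ^ Suc n) = ((y (q ^ Suc n) - y (q ^ Suc (Suc n))) / wt (Suc n) - (y (q ^ n) - y (q ^ Suc n)) / wt n) / wt (Suc n)"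
proof -
  have "q ^ Suc n / q = q ^ n" using q by simp
  then show ?thesis
    using q by (simp add: Lop_nonzero Dq_grid wt_def del: power_Suc)
qed

lemma emb_eq_green:
  assumes "g 1 = 0" "(\<lambda>n. g (q ^ n)) \<longlonglongrightarrow> 0" "Lop q g \<in> L2q q"
  shows "emb g = green (emb (Lop q g))"
proof (rule emb_eqI(2))
  show "g (q ^ n) = val (green (emb (Lop q g))) n" for n
  proof (rule green_unique[of "\<lambda>n. g (q ^ n)"])
    show "(g (q ^ Suc n) - g (q ^ Suc (Suc n))) / wt (Suc n) - (g (q ^ n) - g (q ^ Suc n)) / wt n
        = wt (Suc n) * val (emb (Lop q g)) (Suc n)" for n
      using wt_pos[of "Suc n"] by (simp add: val_emb[OF assms(3)] Lop_grid del: power_Suc)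
  qed (use assms in simp_all)
qed

lemma Lop_of_green:
  assumes "\<And>n. y (q ^ n) = val (green w) n" "0 < n"
  shows "Lop q y (q ^ n) = val w n"
proof (cases n)
  case (Suc i)
  have slope: "slope w n = (potential w n - potential w (Suc n)) / wt n" for n
    using wt_pos[of n] by (simp add: potential_Suc)
  show ?thesis
    using slope_Suc[of w i] wt_pos[of "Suc i"] unfolding Suc Lop_grid assms(1) val_green slope[symmetric]
    by simp
qed (use assms in simp)

text \<open>A test function and its image under \<open>L\<close> both lie in the domain of \<open>L\<close>; continuity at \<open>0\<close> is the
boundary condition there, so Green's operator inverts \<open>L\<close> on test functions.\<close>

lemma CinfL_D:
  assumes "g \<in> CinfL q"
  shows "g \<in> L2q q" "g 1 = 0" "Lop q g \<in> L2q q" "Lop q g 1 = 0" "emb g = green (emb (Lop q g))"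
proof -
  have "(Lop q ^^ 0) g \<in> DomL q" "(Lop q ^^ 1) g \<in> DomL q"
    using assms unfolding CinfL_def by blast+
  then have dom: "g \<in> DomL q" "Lop q g \<in> DomL q" by simp_all
  then show "g \<in> L2q q" "Lop q g \<in> L2q q" and v: "g 1 = 0" "Lop q g 1 = 0"
    by (auto simp: DomL_def)
  have "(g \<longlongrightarrow> 0) (at 0 within {0..1})"
    using dom by (auto simp: DomL_def C2q0_def continuous_within)
  moreover have "filterlim (\<lambda>n. q ^ n) (at 0 within {0..1}) sequentially"
    unfolding filterlim_at using q LIMSEQ_realpow_zero[of q]
    by (auto simp: power_le_one)
  ultimately have "(\<lambda>n. g (q ^ n)) \<longlonglongrightarrow> 0"
    by (rule filterlim_compose)
  then show "emb g = green (emb (Lop q g))"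
    by (intro emb_eq_green v) (use dom in \<open>auto simp: DomL_def\<close>)
qed

section \<open>Test functions\<close>

text \<open>The defining description at \<open>0\<close> is meaningful as soon as the limits exist, by uniqueness of limits.\<close>

lemma qderiv_0:
  assumes "\<And>y. 0 < y \<Longrightarrow> (\<lambda>n. qquot p g (y * q ^ n)) \<longlonglongrightarrow> l"
  shows "qderiv q p g 0 = l"
proof -
  have "(THE l. \<forall>y>0. (\<lambda>n. qquot p g (y * q ^ n)) \<longlonglongrightarrow> l) = l"
  proof (rule the_equality)
    fix l' assume "\<forall>y>0. (\<lambda>n. qquot p g (y * q ^ n)) \<longlonglongrightarrow> l'"
    then show "l' = l" using LIMSEQ_unique assms zero_less_one by blast
  qed (use assms in blast)
  then show ?thesis by (simp add: qderiv_def)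
qed

lemma eventually_grid_small:
  assumes "0 < r"
  shows "\<forall>\<^sub>F n in sequentially. \<bar>y * q ^ n\<bar> < r"
proof -
  have "(\<lambda>n. y * q ^ n) \<longlonglongrightarrow> 0"
    using q by (intro tendsto_mult_right_zero LIMSEQ_realpow_zero) auto
  from tendstoD[OF this assms] show ?thesis by (simp add: dist_real_def)
qed

lemma Dq_linear:
  assumes lin: "\<And>x. \<bar>x\<bar> < r \<Longrightarrow> g x = c * x" and x: "\<bar>x\<bar> < r"
  shows "Dq q g x = c"
proof -
  have quot: "qquot q g x = c" if "x \<noteq> 0" "\<bar>x\<bar> < r" for x
  proof -
    have "\<bar>q * x\<bar> \<le> \<bar>x\<bar>" using q by (simp add: abs_mult mult_left_le_one_le)
    then have "g x - g (q * x) = c * ((1 - q) * x)"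
      using lin that by (simp add: algebra_simps)
    then show ?thesis using that q by (simp add: qquot_def)
  qed
  show ?thesis
  proof (cases "x = 0")
    case True
    have "(\<lambda>n. qquot q g (y * q ^ n)) \<longlonglongrightarrow> c" if "0 < y" for y
    proof (rule tendsto_eventually)
      show "\<forall>\<^sub>F n in sequentially. qquot q g (y * q ^ n) = c"
      proof -
        have "0 < r" using x by linarith
        from eventually_grid_small[OF this, of y] show ?thesis
          by eventually_elim (use that q in \<open>auto intro: quot\<close>)
      qed
    qed
    then show ?thesis using True qderiv_0[of q g c] by (simp add: Dq_def)
  next
    case False
    then show ?thesis using quot[OF False x] by (simp add: Dq_def qderiv_def)
  qed
qed

lemma Dqinv_const:
  assumes const: "\<And>x. \<bar>x\<bar> < r \<Longrightarrow> h x = c" and x: "\<bar>x\<bar> < q * r"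
  shows "Dqinv q h x = 0"
proof -
  have quot: "qquot (1 / q) h x = 0" if "\<bar>x\<bar> < q * r" for x
  proof -
    have "\<bar>1 / q * x\<bar> < r" using that q by (simp add: field_simps)
    moreover have "\<bar>x\<bar> \<le> \<bar>1 / q * x\<bar>" using q by (simp add: field_simps mult_left_le_one_le)
    ultimately show ?thesis using const[of x] const[of "1 / q * x"] by (simp add: qquot_def)
  qed
  show ?thesis
  proof (cases "x = 0")
    case True
    have "(\<lambda>n. qquot (1 / q) h (y * q ^ n)) \<longlonglongrightarrow> 0" for y
    proof (rule tendsto_eventually)
      show "\<forall>\<^sub>F n in sequentially. qquot (1 / q) h (y * q ^ n) = 0"
      proof -
        have "0 < q * r" using x by linarith
        from eventually_grid_small[OF this, of y] show ?thesis
          by eventually_elim (rule quot)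
      qed
    qed
    then show ?thesis using True qderiv_0[of "1 / q" h 0] by (simp add: Dqinv_def)
  next
    case False
    then show ?thesis using quot[OF x] by (simp add: Dqinv_def qderiv_def)
  qed
qed

text \<open>A class of functions that trivially satisfies all conditions at \<open>0\<close> in the definition of the domain
and is mapped by \<open>L\<close> to functions vanishing near \<open>0\<close>.\<close>

definition linear_near_0 :: "real \<Rightarrow> (real \<Rightarrow> real) \<Rightarrow> bool" where
  "linear_near_0 c g \<longleftrightarrow> (\<exists>r>0. \<forall>x. \<bar>x\<bar> < r \<longrightarrow> g x = c * x)"

lemma Lop_linear_near_0:
  assumes "linear_near_0 c g"
  shows "linear_near_0 0 (Lop q g)"
proof -
  obtain r where r: "0 < r" "\<And>x. \<bar>x\<bar> < r \<Longrightarrow> g x = c * x"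
    using assms unfolding linear_near_0_def by blast
  have "Lop q g x = 0" if "\<bar>x\<bar> < q * r" for x
    using Dqinv_const[of r "Dq q g" c x] Dq_linear[OF r(2)] that by (simp add: Lop_def)
  then show ?thesis
    unfolding linear_near_0_def using r(1) q by (intro exI[of _ "q * r"]) simp
qed

lemma continuous_at_0_of_local_eq:
  fixes f :: "real \<Rightarrow> real"
  assumes "0 < r" "\<And>x. \<bar>x\<bar> < r \<Longrightarrow> f x = d + c * x"
  shows "continuous (at 0 within S) f"
proof -
  have "((\<lambda>x. d + c * x) \<longlongrightarrow> d + c * 0) (at 0 within S)"
    by (intro tendsto_intros)
  moreover have "\<forall>\<^sub>F x in at 0 within S. d + c * x = f x"
    unfolding eventually_at using assms by (intro exI[of _ r]) (auto simp: dist_real_def)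
  ultimately show ?thesis
    using assms(2)[of 0] assms(1) by (auto simp: continuous_within intro: Lim_transform_eventually)
qed

lemma linear_near_0_DomL:
  assumes "linear_near_0 c g" "g 1 = 0"
  shows "g \<in> DomL q"
proof -
  obtain r where r: "0 < r" "\<And>x. \<bar>x\<bar> < r \<Longrightarrow> g x = c * x"
    using assms unfolding linear_near_0_def by blast
  have "g \<in> C2q0 q"
    unfolding C2q0_def
    using continuous_at_0_of_local_eq[of r g 0 c] continuous_at_0_of_local_eq[of r "Dq q g" c 0] r Dq_linear[OF r(2)]
    by simp
  moreover have "g \<in> L2q q"
    unfolding L2q_iff
  proof (rule summable_comparison_test_ev)
    show "\<forall>\<^sub>F n in sequentially. norm (wt n * (g (q ^ n))\<^sup>2) \<le> wt n * c\<^sup>2"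
      using eventually_grid_small[OF r(1), of 1]
    proof eventually_elim
      case (elim n)
      have "(q ^ n)\<^sup>2 \<le> 1" using q by (intro power_le_one) auto
      then have "c\<^sup>2 * (q ^ n)\<^sup>2 \<le> c\<^sup>2 * 1" by (intro mult_left_mono) auto
      then show ?case
        using r(2)[of "q ^ n"] elim wt_nonneg[of n] by (simp add: power_mult_distrib mult_left_mono abs_mult)
    qed
    show "summable (\<lambda>n. wt n * c\<^sup>2)" by (rule summable_wt_bounded[where B = "c\<^sup>2"]) simp
  qed
  ultimately show ?thesis using r(2)[of 0] r(1) assms(2) by (simp add: DomL_def)
qed

definition grid_Lop :: "(nat \<Rightarrow> real) \<Rightarrow> nat \<Rightarrow> real" where
  "grid_Lop y n = (case n of 0 \<Rightarrow> 0 | Suc i \<Rightarrow>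
     ((y (Suc i) - y (Suc (Suc i))) / wt (Suc i) - (y i - y (Suc i)) / wt i) / wt (Suc i))"

text \<open>Values at the points \<open>q\<^sup>-\<^sup>j\<close>, from \<open>1\<close> outwards, for the function itself and for all its images
\<open>L\<^sup>k g\<close> simultaneously. A test function must satisfy \<open>L\<^sup>k g (1) = 0\<close> for every \<open>k\<close>, and these values
depend on the extension. The equation for \<open>L\<^sup>k\<^sup>+\<^sup>1 g\<close> at \<open>q\<^sup>-\<^sup>j\<close> can be solved for
\<open>L\<^sup>k g\<close> at \<open>q\<^sup>-\<^sup>j\<^sup>-\<^sup>1\<close>, which gives a recursion on \<open>j\<close>; at \<open>j = 0\<close> the prescribed value of
\<open>L\<^sup>k\<^sup>+\<^sup>1 g (1)\<close> is \<open>0\<close>.\<close>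

fun exterior :: "(nat \<Rightarrow> real) \<Rightarrow> nat \<Rightarrow> nat \<Rightarrow> real" where
  "exterior y 0 k = 0"
| "exterior y (Suc 0) k = - ((grid_Lop ^^ k) y 1) / q"
| "exterior y (Suc (Suc j)) k = exterior y (Suc j) k
     + (exterior y (Suc j) k - exterior y j k - ((1 - q) / q ^ Suc j)\<^sup>2 * exterior y (Suc j) (Suc k)) / q"

definition agrees :: "(nat \<Rightarrow> real) \<Rightarrow> nat \<Rightarrow> (real \<Rightarrow> real) \<Rightarrow> bool" where
  "agrees y k g \<longleftrightarrow> (\<forall>n. g (q ^ n) = (grid_Lop ^^ k) y n) \<and> (\<forall>j. g (1 / q ^ j) = exterior y j k)"

lemma Lop_three_point:
  assumes "0 < x"
  shows "Lop q g x = (g x - g (q * x) - q * (g (x / q) - g x)) / ((1 - q) * x)\<^sup>2"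
proof -
  have "Lop q g x = ((g x - g (q * x)) / ((1 - q) * x) - (g (x / q) - g x) / ((1 - q) * (x / q))) / ((1 - q) * x)"
    using assms q by (simp add: Lop_nonzero Dq_nonzero)
  also have "(g (x / q) - g x) / ((1 - q) * (x / q)) = q * (g (x / q) - g x) / ((1 - q) * x)"
    using q by simp
  finally show ?thesis
    by (simp add: diff_divide_distrib[symmetric] power2_eq_square)
qed

lemma agrees_Lop:
  assumes g: "agrees y k g"
  shows "agrees y (Suc k) (Lop q g)"
proof -
  have grid: "g (q ^ n) = (grid_Lop ^^ k) y n" and ext: "g (1 / q ^ j) = exterior y j k" for n j
    using g by (auto simp: agrees_def)
  have at_1: "Lop q g 1 = 0"
  proof -
    have "g 1 = 0" using ext[of 0] by simp
    moreover have "g q = (grid_Lop ^^ k) y 1" using grid[of 1] by simp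
    moreover have "g (1 / q) = - ((grid_Lop ^^ k) y 1) / q" using ext[of 1] by simp
    ultimately show ?thesis using q Lop_three_point[of 1 g] by simp
  qed
  have "Lop q g (q ^ n) = (grid_Lop ^^ Suc k) y n" for n
  proof (cases n)
    case 0
    then show ?thesis using at_1 by (simp add: grid_Lop_def)
  next
    case (Suc i)
    then show ?thesis by (simp only: Lop_grid grid) (simp add: grid_Lop_def)
  qed
  moreover have "Lop q g (1 / q ^ j) = exterior y j (Suc k)" for j
  proof (cases j)
    case 0
    then show ?thesis using at_1 by simp
  next
    case (Suc i)
    define x where "x = 1 / q ^ Suc i"
    have x: "0 < x" "q * x = 1 / q ^ i" "x / q = 1 / q ^ Suc (Suc i)"
      using q by (simp_all add: x_def field_simps)
    have "g x = exterior y (Suc i) k" "g (q * x) = exterior y i k" "g (x / q) = exterior y (Suc (Suc i)) k"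
      using ext[of "Suc i"] ext[of i] ext[of "Suc (Suc i)"] by (simp_all add: x_def[symmetric] x(2,3) del: power_Suc exterior.simps)
    moreover have "((1 - q) / q ^ Suc i) = (1 - q) * x" by (simp add: x_def)
    ultimately have "q * (g (x / q) - g x) = g x - g (q * x) - ((1 - q) * x)\<^sup>2 * exterior y (Suc i) (Suc k)"
      using q by (simp del: power_Suc)
    then have "Lop q g x = exterior y (Suc i) (Suc k)"
      using x(1) q Lop_three_point[OF x(1), of g] by simp
    then show ?thesis by (simp add: Suc x_def)
  qed
  ultimately show ?thesis by (simp add: agrees_def)
qed

text \<open>Any sequence of the form \<open>c q\<^sup>n\<close> near \<open>0\<close> with value \<open>0\<close> at \<open>1\<close> consists of the values of a test
function: continue it linearly near \<open>0\<close>, also off the grid, and by \<open>exterior\<close> beyond \<open>1\<close>.\<close>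

lemma CinfL_extension:
  assumes y0: "y 0 = 0" and lin: "\<And>n. N \<le> n \<Longrightarrow> y n = c * q ^ n"
  obtains g where "g \<in> CinfL q" "\<And>n. g (q ^ n) = y n"
proof -
  define g where "g x = (if x < q ^ N then c * x
      else if \<exists>n. x = q ^ n then y (THE n. x = q ^ n)
      else if \<exists>j. x = 1 / q ^ j then exterior y (THE j. x = 1 / q ^ j) 0 else 0)" for x
  have grid: "g (q ^ n) = y n" for n
  proof (cases "q ^ n < q ^ N")
    case True
    then have "N < n" using q by (simp add: power_strict_decreasing_iff)
    then show ?thesis using True lin[of n] by (simp add: g_def)
  next
    case False
    then show ?thesis by (simp add: g_def grid_inj)
  qed
  have ext: "g (1 / q ^ j) = exterior y j 0" for j
  proof (cases "j = 0")
    case True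
    then show ?thesis using grid[of 0] y0 by simp
  next
    case False
    have j: "1 < 1 / q ^ j" using q False by (simp add: power_less_one_iff)
    have le: "q ^ n \<le> 1" for n using q by (simp add: power_le_one)
    have "1 / q ^ j \<noteq> q ^ n" for n using j le[of n] by linarith
    moreover have "\<not> 1 / q ^ j < q ^ N" using j le[of N] by linarith
    moreover have "1 / q ^ j = 1 / q ^ i \<longleftrightarrow> j = i" for i
      using q by (simp add: grid_inj[symmetric])
    ultimately show ?thesis by (auto simp: g_def)
  qed
  have ag: "agrees y k ((Lop q ^^ k) g)" for k
  proof (induction k)
    case 0
    show ?case using grid ext by (simp add: agrees_def)
  next
    case (Suc k)
    then show ?case using agrees_Lop[of y k] by simp
  qed
  have near: "\<exists>c. linear_near_0 c ((Lop q ^^ k) g)" for k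
  proof (induction k)
    case 0
    have "linear_near_0 c g"
      unfolding linear_near_0_def using q by (intro exI[of _ "q ^ N"]) (auto simp: g_def)
    then show ?case by auto
  next
    case (Suc k)
    then show ?case using Lop_linear_near_0 by auto
  qed
  have "(Lop q ^^ k) g \<in> DomL q" for k
  proof -
    have "(Lop q ^^ k) g 1 = 0"
      using ag[of k] unfolding agrees_def by (metis exterior.simps(1) power_0 div_by_1)
    then show ?thesis using near[of k] linear_near_0_DomL by blast
  qed
  moreover from this[of 0] have "g \<in> L2q q" by (simp add: DomL_def)
  ultimately have "g \<in> CinfL q" by (simp add: CinfL_def)
  then show ?thesis using that grid by blast
qed

definition unit :: "nat \<Rightarrow> l2" where "unit m = of_val (\<lambda>n. if n = m then 1 else 0)"

lemma val_unit: "0 < m \<Longrightarrow> val (unit m) n = (if n = m then 1 else 0)"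
proof -
  assume "0 < m"
  have "summable (\<lambda>n. wt n * (if n = m then 1 else 0)\<^sup>2)"
    by (rule summable_finite[of "{m}"]) auto
  with \<open>0 < m\<close> show ?thesis by (simp add: unit_def val_of_val)
qed

lemma inner_unit:
  assumes "0 < m"
  shows "inner a (unit m) = wt m * val a m"
proof -
  have "(\<lambda>n. wt n * (val a n * val (unit m) n)) = (\<lambda>n. if n = m then wt m * val a m else 0)"
    using assms by (auto simp: val_unit)
  then show ?thesis
    using inner_val_sums[of a "unit m"] sums_single[of m "\<lambda>_. wt m * val a m"] sums_unique2 by metis
qed

text \<open>The function is the potential of the unit vector; its slope is constant below \<open>q\<^sup>m\<close>, so it is
linear near \<open>0\<close>.\<close>

lemma test_function:
  assumes "0 < m"
  obtains g where "g \<in> CinfL q" "emb (Lop q g) = unit m"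
proof -
  have const: "slope (unit m) (m + j) = slope (unit m) m" for j
  proof (induction j)
    case (Suc j)
    then show ?case using slope_Suc[of "unit m" "m + j"] assms by (simp add: val_unit)
  qed simp
  have lin: "potential (unit m) n = slope (unit m) m * q ^ n" if "m \<le> n" for n
  proof -
    have "slope (unit m) (n + j) = slope (unit m) m" for j
      using const[of "n - m + j"] that by simp
    then have "potential (unit m) n = (\<Sum>j. wt (n + j) * slope (unit m) m)"
      by (simp add: potential_def)
    then show ?thesis
      using sums_mult2[OF wt_shift_sums[of n], of "slope (unit m) m"] by (simp add: sums_iff mult.commute)
  qed
  obtain g where g: "g \<in> CinfL q" "\<And>n. g (q ^ n) = potential (unit m) n"
    using CinfL_extension[of "potential (unit m)" m "slope (unit m) m"] potential_0 lin by blast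
  have "Lop q g (q ^ n) = val (unit m) n" if "0 < n" for n
    by (rule Lop_of_green[OF _ that]) (simp add: g val_green)
  then show ?thesis using that[OF g(1)] emb_eqI(2) by blast
qed

section \<open>The Sobolev space as the range of Green's operator\<close>

text \<open>By symmetry of Green's operator the defining identity pairs \<open>emb y - green (emb h)\<close> with \<open>L g\<close>, and
the images \<open>L g\<close> of test functions include all unit vectors.\<close>

lemma represents_iff:
  assumes y: "y \<in> L2q q" "y 1 = 0"
  shows "represents q h (L_distr q (L2q_inner q y)) \<longleftrightarrow> h \<in> L2q q \<and> emb y = green (emb h)"
proof -
  have pairing: "L2q_inner q y (Lop q g) = inner (emb y) (emb (Lop q g))"
    "L2q_inner q h g = inner (green (emb h)) (emb (Lop q g))" if "h \<in> L2q q" "g \<in> CinfL q" for g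
    using CinfL_D[OF that(2)] that(1) y
    by (simp_all add: L2q_inner_eq green_symmetric[symmetric])
  have "emb y = green (emb h)" if h: "h \<in> L2q q"
    and eq: "\<And>g. g \<in> CinfL q \<Longrightarrow> L2q_inner q y (Lop q g) = L2q_inner q h g"
  proof (rule val_eqI)
    fix n
    show "val (emb y) n = val (green (emb h)) n"
    proof (cases "n = 0")
      case False
      then obtain g where g: "g \<in> CinfL q" "emb (Lop q g) = unit n" using test_function by auto
      then have "inner (emb y) (unit n) = inner (green (emb h)) (unit n)"
        using pairing[OF h g(1)] eq[OF g(1)] by simp
      then show ?thesis using False wt_pos[of n] by (simp add: inner_unit)
    qed simp
  qed
  then show ?thesis unfolding represents_def L_distr_def using pairing by auto
qed

lemma L2q_inner_distrL:
  assumes y: "y \<in> L2q q"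
  shows "L2q_inner q y \<in> distrL q"
proof -
  have lin: "emb (\<lambda>x. a * g x + b * h x) = a *\<^sub>R emb g + b *\<^sub>R emb h"
    "(\<lambda>x. a * g x + b * h x) \<in> L2q q" if "g \<in> L2q q" "h \<in> L2q q" for a b g h
  proof -
    have "a * g (q ^ n) + b * h (q ^ n) = val (a *\<^sub>R emb g + b *\<^sub>R emb h) n" if "0 < n" for n
      using that \<open>g \<in> L2q q\<close> \<open>h \<in> L2q q\<close> by (simp add: val_add val_scaleR val_emb)
    then show "emb (\<lambda>x. a * g x + b * h x) = a *\<^sub>R emb g + b *\<^sub>R emb h"
      "(\<lambda>x. a * g x + b * h x) \<in> L2q q"
      using emb_eqI[of "\<lambda>x. a * g x + b * h x" "a *\<^sub>R emb g + b *\<^sub>R emb h"] by auto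
  qed
  have pair: "L2q_inner q y g = inner (emb y) (emb g)" if "g \<in> L2q q" "g 1 = 0" for g
    using that y by (simp add: L2q_inner_eq)
  have "L2q_inner q y (\<lambda>x. a * g x + b * h x) = a * L2q_inner q y g + b * L2q_inner q y h"
    if "g \<in> CinfL q" "h \<in> CinfL q" for g h a b
    using CinfL_D(1,2)[OF that(1)] CinfL_D(1,2)[OF that(2)] lin
    by (simp add: pair inner_add_right)
  moreover have "\<exists>k. \<exists>\<delta>>0. \<forall>h\<in>CinfL q. CinfL_norm q k (\<lambda>x. h x - g x) < \<delta> \<longrightarrow> \<bar>L2q_inner q y h - L2q_inner q y g\<bar> < \<epsilon>"
    if g: "g \<in> CinfL q" and \<epsilon>: "0 < \<epsilon>" for g \<epsilon>
  proof (intro exI conjI ballI impI)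
    show "0 < \<epsilon> / (norm (emb y) + 1)" using \<epsilon> by (simp add: add_nonneg_pos)
    fix h assume h: "h \<in> CinfL q" and small: "CinfL_norm q 0 (\<lambda>x. h x - g x) < \<epsilon> / (norm (emb y) + 1)"
    note gh = CinfL_D(1,2)[OF g] CinfL_D(1,2)[OF h]
    have d: "emb (\<lambda>x. h x - g x) = emb h - emb g" "(\<lambda>x. h x - g x) \<in> L2q q"
      using lin[of h g 1 "-1"] gh by simp_all
    then have "norm (emb h - emb g) < \<epsilon> / (norm (emb y) + 1)"
      using small gh by (simp add: CinfL_norm_def L2q_norm_eq)
    then have *: "norm (emb h - emb g) * (norm (emb y) + 1) < \<epsilon>"
      by (simp add: pos_less_divide_eq add_nonneg_pos)
    have "\<bar>L2q_inner q y h - L2q_inner q y g\<bar> = \<bar>inner (emb y) (emb h - emb g)\<bar>"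
      using gh by (simp add: pair inner_diff_right)
    also have "\<dots> \<le> norm (emb y) * norm (emb h - emb g)" by (rule Cauchy_Schwarz_ineq2)
    also have "\<dots> \<le> norm (emb h - emb g) * (norm (emb y) + 1)" by (simp add: algebra_simps)
    finally show "\<bar>L2q_inner q y h - L2q_inner q y g\<bar> < \<epsilon>" using * by simp
  qed
  ultimately show ?thesis by (simp add: distrL_def)
qed

lemma W2L_iff:
  "y \<in> W2L q \<longleftrightarrow> y 0 = 0 \<and> y 1 = 0 \<and> (\<exists>w. \<forall>n. y (q ^ n) = val (green w) n)"
proof (intro iffI conjI)
  assume y: "y \<in> W2L q"
  then show y01: "y 0 = 0" "y 1 = 0" by (auto simp: W2L_def)
  from y obtain h where "represents q h (L_distr q (L2q_inner q y))"
    by (auto simp: W2L_def W2L_distr_def)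
  moreover have yL: "y \<in> L2q q" using y by (simp add: W2L_def)
  ultimately have "emb y = green (emb h)" using represents_iff[OF yL y01(2)] by simp
  then have "y (q ^ n) = val (green (emb h)) n" for n
    using val_emb[OF yL, of n] y01(2) by (cases "n = 0") auto
  then show "\<exists>w. \<forall>n. y (q ^ n) = val (green w) n" by blast
next
  assume y: "y 0 = 0 \<and> y 1 = 0 \<and> (\<exists>w. \<forall>n. y (q ^ n) = val (green w) n)"
  then obtain w where w: "\<And>n. y (q ^ n) = val (green w) n" by blast
  have yL: "y \<in> L2q q" "emb y = green w" using emb_eqI[of y "green w"] w by blast+
  define h where "h = Lop q y"
  have h: "h \<in> L2q q" "emb h = w"
    using emb_eqI[of h w] Lop_of_green[OF w] unfolding h_def by blast+
  have "represents q h (L_distr q (L2q_inner q y))"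
    using represents_iff[of y h] yL y h by simp
  then show "y \<in> W2L q"
    using y yL L2q_inner_distrL by (auto simp: W2L_def W2L_distr_def)
qed

text \<open>All representatives agree at the points \<open>q\<^sup>n\<close> other than \<open>1\<close>, so the one that vanishes at \<open>1\<close> has the least norm.\<close>

lemma W2L_norm_eq:
  assumes y: "y 1 = 0" "\<And>n. y (q ^ n) = val (green w) n"
  shows "W2L_norm q y = norm w"
proof -
  have yL: "y \<in> L2q q" "emb y = green w" using emb_eqI[of y "green w"] y(2) by blast+
  have rep: "represents q h (L_distr q (L2q_inner q y)) \<longleftrightarrow> h \<in> L2q q \<and> emb h = w" for h
    using represents_iff[OF yL(1) y(1), of h] inj_green by (auto simp: yL(2) inj_eq)
  have "Inf {L2q_norm q h | h. h \<in> L2q q \<and> emb h = w} = norm w"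
  proof (rule cInf_eq_minimum)
    \<comment> \<open>the representative that vanishes at \<open>1\<close>\<close>
    define h where "h x = (if x = 1 then 0 else Lop q y x)" for x
    have "h (q ^ n) = val w n" if "0 < n" for n
    proof -
      have "q ^ n \<noteq> 1" using q that by (metis less_irrefl power_less_one_iff less_imp_le)
      then show ?thesis using Lop_of_green[OF y(2) that] by (simp add: h_def)
    qed
    then have "h \<in> L2q q" "emb h = w" using emb_eqI[of h w] by blast+
    moreover from this have "L2q_norm q h = norm w" by (simp add: L2q_norm_eq h_def)
    ultimately show "norm w \<in> {L2q_norm q h | h. h \<in> L2q q \<and> emb h = w}" by force
    show "norm w \<le> r" if "r \<in> {L2q_norm q h | h. h \<in> L2q q \<and> emb h = w}" for r
      using that wt_nonneg[of 0] by (auto simp: L2q_norm_eq intro!: real_le_rsqrt)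
  qed
  then show ?thesis by (simp add: W2L_norm_def W2L_distr_norm_def rep)
qed

end

section \<open>Solution pairs as solutions of the evolution\<close>

context geometric_grid
begin

text \<open>The constant function, so that \<open>inner ones\<close> is the Jackson integral of functions vanishing at \<open>1\<close>.\<close>

definition ones :: l2 where "ones = emb (\<lambda>_. 1)"

end

sublocale geometric_grid \<subseteq> inverse_source green ones q
  by unfold_locales (rule q)+

context geometric_grid
begin

lemma jackson_integral_grid:
  assumes "\<And>n. y (q ^ n) = val a n"
  shows "jackson_integral q 0 1 y = inner ones a"
proof (rule jackson_integral_sums)
  have "(\<lambda>_. 1) \<in> L2q q"
    using wt_sums by (simp add: L2q_iff sums_iff)
  then have "(\<lambda>n. wt n * (val ones n * val a n)) = (\<lambda>n. wt n * y (q ^ n))"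
    by (auto simp: ones_def val_emb assms)
  then show "(\<lambda>n. wt n * y (q ^ n)) sums inner ones a"
    using inner_val_sums[of ones a] by simp
qed

lemma q_power_in: "t \<in> {0..T} \<Longrightarrow> t * q ^ n \<in> {0..T}"
  using q mult_right_le_one_le[of t "q ^ n"] by (auto simp: power_le_one)

lemma q_power_tendsto: "(\<lambda>n. t * q ^ n) \<longlonglongrightarrow> 0"
  using q by (intro tendsto_mult_right_zero LIMSEQ_realpow_zero) auto

lemma continuous_at_0_sequence:
  fixes r :: "real \<Rightarrow> 'a::topological_space"
  assumes "continuous_on {0..T} r" "t \<in> {0..T}"
  shows "(\<lambda>n. r (t * q ^ n)) \<longlonglongrightarrow> r 0"
  using assms q_power_in by (intro continuous_on_tendsto_compose[OF assms(1) q_power_tendsto]) auto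

text \<open>The value of a derivative at \<open>0\<close> is a limit along \<open>y q\<^sup>n\<close> for every \<open>y > 0\<close>; since such a sequence
enters \<open>[0,T]\<close>, a continuous extension of the difference quotient supplies it.\<close>

lemma Dq_eqI:
  assumes T: "0 < T" and r: "continuous_on {0..T} r"
    and eq: "\<And>t. 0 < t \<Longrightarrow> t \<le> T \<Longrightarrow> (g t - g (q * t)) / ((1 - q) * t) = r t"
    and t: "t \<in> {0..T}"
  shows "Dq q g t = r t"
proof (cases "t = 0")
  case False
  then show ?thesis using t eq by (simp add: Dq_nonzero)
next
  case True
  have "(\<lambda>n. qquot q g (y * q ^ n)) \<longlonglongrightarrow> r 0" if y: "0 < y" for y
  proof -
    have "(\<lambda>n. r (min T (y * q ^ n))) \<longlonglongrightarrow> r 0"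
    proof (rule continuous_on_tendsto_compose[OF r])
      have "(\<lambda>n. min T (y * q ^ n)) \<longlonglongrightarrow> min T 0"
        by (intro tendsto_min tendsto_const q_power_tendsto)
      then show "(\<lambda>n. min T (y * q ^ n)) \<longlonglongrightarrow> 0" using T by simp
    qed (use T q y in auto)
    moreover have "\<forall>\<^sub>F n in sequentially. r (min T (y * q ^ n)) = qquot q g (y * q ^ n)"
      using eventually_grid_small[OF T, of y]
      by eventually_elim (use y q eq in \<open>auto simp: qquot_def\<close>)
    ultimately show ?thesis by (rule Lim_transform_eventually)
  qed
  then show ?thesis using True qderiv_0[of q g "r 0"] by (simp add: Dq_def)
qed

lemma CqX_0: "u \<in> CqX q 0 T X N \<longleftrightarrow> (\<forall>t\<in>{0..T}. u t \<in> X \<and>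
    ((\<lambda>s. N (\<lambda>x. u s x - u t x)) \<longlongrightarrow> 0) (at t within {0..T}))"
  by (simp add: CqX_def)

lemma tendsto_0_iff_continuous_on:
  fixes w :: "real \<Rightarrow> l2"
  assumes "\<And>s t. s \<in> S \<Longrightarrow> t \<in> S \<Longrightarrow> N (\<lambda>x. u s x - u t x) = norm (w s - w t)"
  shows "(\<forall>t\<in>S. ((\<lambda>s. N (\<lambda>x. u s x - u t x)) \<longlongrightarrow> 0) (at t within S)) \<longleftrightarrow> continuous_on S w"
  unfolding continuous_on_def
proof (rule ball_cong[OF refl])
  fix t assume t: "t \<in> S"
  have "((\<lambda>s. N (\<lambda>x. u s x - u t x)) \<longlongrightarrow> 0) (at t within S) \<longleftrightarrow> ((\<lambda>s. norm (w s - w t)) \<longlongrightarrow> 0) (at t within S)"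
    using assms t by (intro tendsto_cong) (auto simp: eventually_at_filter)
  also have "\<dots> \<longleftrightarrow> (w \<longlongrightarrow> w t) (at t within S)"
    by (simp add: tendsto_norm_zero_iff LIM_zero_iff)
  finally show "((\<lambda>s. N (\<lambda>x. u s x - u t x)) \<longlongrightarrow> 0) (at t within S) \<longleftrightarrow> (w \<longlongrightarrow> w t) (at t within S)" .
qed

lemma W2L_norm_diff:
  assumes "\<And>n. y (q ^ n) = val (green v) n" "\<And>n. z (q ^ n) = val (green w) n"
  shows "W2L_norm q (\<lambda>x. y x - z x) = norm (v - w)"
proof (rule W2L_norm_eq)
  show "y 1 - z 1 = 0" using assms(1)[of 0] assms(2)[of 0] by simp
qed (simp add: assms G_diff val_diff)

lemma L2q_norm_grid:
  assumes "\<And>n. y (q ^ n) = val a n"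
  shows "L2q_norm q y = norm a"
proof -
  have "y \<in> L2q q" "emb y = a" using emb_eqI[of y a] assms by blast+
  moreover have "y 1 = 0" using assms[of 0] by simp
  ultimately show ?thesis by (simp add: L2q_norm_eq)
qed

lemma CqX_W2L_iff:
  "u \<in> CqX q 0 T (W2L q) (W2L_norm q) \<longleftrightarrow> (\<forall>t\<in>{0..T}. u t 0 = 0) \<and>
     (\<exists>w. continuous_on {0..T} w \<and> (\<forall>t\<in>{0..T}. \<forall>n. u t (q ^ n) = val (green (w t)) n))"
proof
  assume u: "u \<in> CqX q 0 T (W2L q) (W2L_norm q)"
  then have "\<forall>t\<in>{0..T}. u t \<in> W2L q" by (simp add: CqX_0)
  then have u0: "\<forall>t\<in>{0..T}. u t 0 = 0" and "\<forall>t\<in>{0..T}. \<exists>w. \<forall>n. u t (q ^ n) = val (green w) n"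
    using W2L_iff by blast+
  then obtain w where w: "\<forall>t\<in>{0..T}. \<forall>n. u t (q ^ n) = val (green (w t)) n"
    by metis
  have "continuous_on {0..T} w"
    using u w by (subst tendsto_0_iff_continuous_on[symmetric, of _ "W2L_norm q" u])
      (auto simp: CqX_0 intro!: W2L_norm_diff)
  with u0 w show "(\<forall>t\<in>{0..T}. u t 0 = 0) \<and>
     (\<exists>w. continuous_on {0..T} w \<and> (\<forall>t\<in>{0..T}. \<forall>n. u t (q ^ n) = val (green (w t)) n))" by blast
next
  assume "(\<forall>t\<in>{0..T}. u t 0 = 0) \<and>
     (\<exists>w. continuous_on {0..T} w \<and> (\<forall>t\<in>{0..T}. \<forall>n. u t (q ^ n) = val (green (w t)) n))"
  then obtain w where u0: "\<And>t. t \<in> {0..T} \<Longrightarrow> u t 0 = 0" and cont: "continuous_on {0..T} w"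
    and w: "\<And>t n. t \<in> {0..T} \<Longrightarrow> u t (q ^ n) = val (green (w t)) n" by blast
  have "u t \<in> W2L q" if "t \<in> {0..T}" for t
    using u0[OF that] w[OF that] w[OF that, of 0] by (auto simp: W2L_iff)
  moreover have "\<forall>t\<in>{0..T}. ((\<lambda>s. W2L_norm q (\<lambda>x. u s x - u t x)) \<longlongrightarrow> 0) (at t within {0..T})"
    using w cont by (subst tendsto_0_iff_continuous_on[of _ "W2L_norm q" u w]) (auto intro!: W2L_norm_diff)
  ultimately show "u \<in> CqX q 0 T (W2L q) (W2L_norm q)" by (simp add: CqX_0)
qed

lemma CqX_L2qI:
  assumes cont: "continuous_on {0..T} a" and u: "\<And>t n. t \<in> {0..T} \<Longrightarrow> u t (q ^ n) = val (a t) n"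
  shows "u \<in> CqX q 0 T (L2q q) (L2q_norm q)"
proof -
  have "u t \<in> L2q q" if "t \<in> {0..T}" for t
    using emb_eqI(1)[of "u t" "a t"] u[OF that] by blast
  moreover have "L2q_norm q (\<lambda>x. u s x - u t x) = norm (a s - a t)" if "s \<in> {0..T}" "t \<in> {0..T}" for s t
    using that by (intro L2q_norm_grid) (simp add: u val_diff)
  then have "\<forall>t\<in>{0..T}. ((\<lambda>s. L2q_norm q (\<lambda>x. u s x - u t x)) \<longlongrightarrow> 0) (at t within {0..T})"
    using cont by (subst tendsto_0_iff_continuous_on[of _ "L2q_norm q" u a]) auto
  ultimately show ?thesis by (simp add: CqX_0)
qed

lemma CqX_norm_le:
  assumes "0 \<le> T" "\<And>t. t \<in> {0..T} \<Longrightarrow> N (u t) \<le> B"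
  shows "CqX_norm q 0 T N u \<le> B"
  unfolding CqX_norm_def using assms by (auto intro!: cSUP_least)

lemma Cq_norm_0_le:
  assumes "0 \<le> T" "\<And>t. t \<in> {0..T} \<Longrightarrow> \<bar>g t\<bar> \<le> B"
  shows "Cq_norm q 0 T g \<le> B"
  unfolding Cq_norm_def using assms by (auto intro!: cSUP_least)

lemma bdd_above_continuous_image:
  fixes g :: "real \<Rightarrow> real"
  assumes "continuous_on {0..T} g"
  shows "bdd_above (g ` {0..T})"
  by (intro bounded_imp_bdd_above compact_imp_bounded compact_continuous_image[OF assms compact_Icc])

lemma le_CqX_norm_W2L:
  assumes v: "continuous_on {0..T} v" "\<And>t n. t \<in> {0..T} \<Longrightarrow> f' t (q ^ n) = val (green (v t)) n"
    and w: "continuous_on {0..T} w" "\<And>t n. t \<in> {0..T} \<Longrightarrow> f t (q ^ n) = val (green (w t)) n"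
    and t: "t \<in> {0..T}"
  shows "norm (v t - w t) \<le> CqX_norm q 0 T (W2L_norm q) (\<lambda>t x. f' t x - f t x)"
proof -
  have N: "W2L_norm q (\<lambda>x. f' t x - f t x) = norm (v t - w t)" if "t \<in> {0..T}" for t
    by (intro W2L_norm_diff v w that)
  have "norm (v t - w t) \<le> (SUP t\<in>{0..T}. norm (v t - w t))"
    by (intro cSUP_upper t bdd_above_continuous_image continuous_intros v w)
  also have "\<dots> = CqX_norm q 0 T (W2L_norm q) (\<lambda>t x. f' t x - f t x)"
    by (simp add: CqX_norm_def N)
  finally show ?thesis .
qed

lemma Cq_1D:
  assumes "\<psi> \<in> Cq q 1 T"
  shows "continuous_on {0..T} \<psi>" "continuous_on {0..T} (Dq q \<psi>)"
proof -
  have "continuous_on {0..T} ((Dq q ^^ 0) \<psi>)" "continuous_on {0..T} ((Dq q ^^ 1) \<psi>)"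
    using assms unfolding Cq_def by blast+
  then show "continuous_on {0..T} \<psi>" "continuous_on {0..T} (Dq q \<psi>)" by simp_all
qed

lemma le_Cq_norm_1:
  assumes T: "0 < T" and \<psi>: "\<psi> \<in> Cq q 1 T" "\<psi>' \<in> Cq q 1 T" and t: "t \<in> {0..T}"
  shows "\<bar>Dq q \<psi>' t - Dq q \<psi> t\<bar> \<le> Cq_norm q 1 T (\<lambda>t. \<psi>' t - \<psi> t)"
proof -
  note c = Cq_1D[OF \<psi>(1)] Cq_1D[OF \<psi>(2)]
  have D: "Dq q (\<lambda>t. \<psi>' t - \<psi> t) t = Dq q \<psi>' t - Dq q \<psi> t" if "t \<in> {0..T}" for t
  proof (rule Dq_eqI[OF T _ _ that])
    show "continuous_on {0..T} (\<lambda>t. Dq q \<psi>' t - Dq q \<psi> t)" by (intro continuous_intros c)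
    show "(\<psi>' t - \<psi> t - (\<psi>' (q * t) - \<psi> (q * t))) / ((1 - q) * t) = Dq q \<psi>' t - Dq q \<psi> t"
      if "0 < t" for t using that by (simp add: Dq_nonzero diff_divide_distrib)
  qed
  have "\<bar>\<psi>' t - \<psi> t\<bar> \<le> (SUP t\<in>{0..T}. \<bar>\<psi>' t - \<psi> t\<bar>)"
    by (intro cSUP_upper t bdd_above_continuous_image continuous_intros c)
  moreover have "\<bar>Dq q \<psi>' t - Dq q \<psi> t\<bar> \<le> (SUP t\<in>{0..T}. \<bar>Dq q \<psi>' t - Dq q \<psi> t\<bar>)"
    by (intro cSUP_upper t bdd_above_continuous_image continuous_intros c)
  moreover have "Cq_norm q 1 T (\<lambda>t. \<psi>' t - \<psi> t)
      = (SUP t\<in>{0..T}. \<bar>\<psi>' t - \<psi> t\<bar>) + (SUP t\<in>{0..T}. \<bar>Dq q \<psi>' t - Dq q \<psi> t\<bar>)"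
    by (simp add: Cq_norm_def D)
  ultimately show ?thesis by linarith
qed

lemma lattice_points_eq: "lattice_points q = {q ^ n | n. 0 < n}"
proof (intro set_eqI iffI)
  have less_1: "q ^ n < 1 \<longleftrightarrow> 0 < n" for n using q power_less_one_iff[of q n] by simp
  fix x
  show "x \<in> {q ^ n | n. 0 < n}" if "x \<in> lattice_points q"
    using that less_1 unfolding lattice_points_def by blast
  show "x \<in> lattice_points q" if "x \<in> {q ^ n | n. 0 < n}"
  proof -
    from that obtain n where n: "0 < n" "x = q ^ n" by auto
    moreover have "0 < q ^ n" using q by simp
    ultimately show ?thesis using less_1[of n] unfolding lattice_points_def by blast
  qed
qed

text \<open>For \<open>t > 0\<close> this is the equation; continuity of its right-hand side extends it to \<open>t = 0\<close>.\<close>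

lemma Dqt_solution:
  assumes T: "0 < T" and sol: "solves T p k \<eta> w \<upsilon>"
    and cont: "continuous_on {0..T} \<upsilon>" "continuous_on {0..T} k"
    and u: "\<And>t. t \<in> {0..T} \<Longrightarrow> u t (q ^ n) = val (green (w t)) n" and t: "t \<in> {0..T}"
  shows "Dqt q u t (q ^ n) = val (\<upsilon> t *\<^sub>R green (k t) - w t) n"
  unfolding Dqt_def
proof (rule Dq_eqI[OF T _ _ t])
  have "continuous_on {0..T} w" using sol by (simp add: solves_def)
  then show "continuous_on {0..T} (\<lambda>t. val (\<upsilon> t *\<^sub>R green (k t) - w t) n)"
    by (intro bounded_linear.continuous_on[OF bounded_linear_val] continuous_intros cont
        bounded_linear.continuous_on[OF bounded_linear_green])
  fix t assume t: "0 < t" "t \<le> T"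
  have "val (green (w t) + ((1 - q) * t) *\<^sub>R w t) n = val (green (w (q * t)) + ((1 - q) * t * \<upsilon> t) *\<^sub>R green (k t)) n"
    using sol t by (simp add: solves_def)
  then have "val (green (w t)) n + (1 - q) * t * val (w t) n
      = val (green (w (q * t))) n + (1 - q) * t * \<upsilon> t * val (green (k t)) n"
    by (simp only: val_add val_scaleR)
  then have "val (green (w t)) n - val (green (w (q * t))) n = ((1 - q) * t) * (\<upsilon> t * val (green (k t)) n - val (w t) n)"
    by (simp add: algebra_simps)
  moreover have "u t (q ^ n) = val (green (w t)) n" "u (q * t) (q ^ n) = val (green (w (q * t))) n"
    using u[of t] u[OF contracted_time[of t T]] t by auto
  ultimately show "(u t (q ^ n) - u (q * t) (q ^ n)) / ((1 - q) * t) = val (\<upsilon> t *\<^sub>R green (k t) - w t) n"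
    using t q by (simp add: val_diff val_scaleR)
qed

text \<open>The equation for the source comes from integrating the equation for \<open>u\<close>, which uses the
over-determination condition at \<open>t\<close> and at \<open>q t\<close>. It extends to \<open>t = 0\<close> by continuity.\<close>

lemma solution_pair_solves:
  assumes T: "0 < T0" "T0 \<le> T"
    and \<phi>: "\<And>n. \<phi> (q ^ n) = val (green p) n"
    and k: "continuous_on {0..T} k" "\<And>t n. t \<in> {0..T} \<Longrightarrow> f t (q ^ n) = val (green (k t)) n"
    and \<psi>: "\<psi> \<in> Cq q 1 T" and sp: "solution_pair q T0 \<phi> f \<psi> u \<upsilon>"
  obtains w where "solves T0 p k (Dq q \<psi>) w \<upsilon>" "continuous_on {0..T0} \<upsilon>"
    "\<And>t n. t \<in> {0..T0} \<Longrightarrow> u t (q ^ n) = val (green (w t)) n"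
proof -
  have \<upsilon>: "continuous_on {0..T0} \<upsilon>" using sp by (simp add: solution_pair_def Cq_def)
  obtain w where w: "continuous_on {0..T0} w" "\<And>t n. t \<in> {0..T0} \<Longrightarrow> u t (q ^ n) = val (green (w t)) n"
    using sp unfolding solution_pair_def CqX_W2L_iff by blast
  have kc: "continuous_on {0..T0} k" "continuous_on {0..T0} (Dq q \<psi>)"
    using k(1) Cq_1D(2)[OF \<psi>] T by (auto elim: continuous_on_subset)
  have w0: "w 0 = p"
  proof -
    have "val (green (w 0)) n = val (green p) n" for n
    proof (cases "n = 0")
      case False
      then have "u 0 (q ^ n) = \<phi> (q ^ n)" using sp unfolding solution_pair_def lattice_points_eq by blast
      then show ?thesis using w(2)[of 0 n] T \<phi>[of n] by simp
    qed simp
    then show ?thesis using val_eqI inj_green by (metis injD)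
  qed
  have evol: "green (w t) + ((1 - q) * t) *\<^sub>R w t = green (w (q * t)) + ((1 - q) * t * \<upsilon> t) *\<^sub>R green (k t)"
    if t: "0 < t" "t \<le> T0" for t
  proof (rule val_eqI)
    fix n
    have tT: "t \<in> {0..T0}" "q * t \<in> {0..T0}" "t \<in> {0..T}" using t T contracted_time[of t T0] by auto
    show "val (green (w t) + ((1 - q) * t) *\<^sub>R w t) n = val (green (w (q * t)) + ((1 - q) * t * \<upsilon> t) *\<^sub>R green (k t)) n"
    proof (cases "n = 0")
      case False
      then have "Dqt q u t (q ^ n) + Lop q (u t) (q ^ n) = \<upsilon> t * f t (q ^ n)"
        using sp t unfolding solution_pair_def lattice_points_eq by blast
      moreover have "Lop q (u t) (q ^ n) = val (w t) n"
        using Lop_of_green[OF w(2)[OF tT(1)]] False by simp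
      moreover have "Dqt q u t (q ^ n) = (val (green (w t)) n - val (green (w (q * t))) n) / ((1 - q) * t)"
        using t by (simp add: Dqt_def Dq_nonzero w(2)[OF tT(1)] w(2)[OF tT(2)])
      ultimately have "(val (green (w t)) n - val (green (w (q * t))) n) / ((1 - q) * t) = \<upsilon> t * val (green (k t)) n - val (w t) n"
        using k(2)[OF tT(3)] by simp
      then have "val (green (w t)) n - val (green (w (q * t))) n = (\<upsilon> t * val (green (k t)) n - val (w t) n) * ((1 - q) * t)"
        using t q by (simp add: nonzero_divide_eq_eq)
      then show ?thesis unfolding val_add val_scaleR by (simp add: algebra_simps)
    qed simp
  qed
  have rel: "\<upsilon> t * inner ones (green (k t)) = Dq q \<psi> t + inner ones (w t)" if t: "0 < t" "t \<le> T0" for t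
  proof -
    have int: "inner ones (green (w s)) = \<psi> s" if "0 < s" "s \<le> T0" for s
      using sp that jackson_integral_grid[OF w(2)[of s]] unfolding solution_pair_def by simp
    have qt: "0 < q * t" "q * t \<le> T0" using t q contracted_time[of t T0] by auto
    have "inner ones (green (w t) + ((1 - q) * t) *\<^sub>R w t) = inner ones (green (w (q * t)) + ((1 - q) * t * \<upsilon> t) *\<^sub>R green (k t))"
      by (simp only: evol[OF t])
    then have "\<psi> t - \<psi> (q * t) = ((1 - q) * t) * (\<upsilon> t * inner ones (green (k t)) - inner ones (w t))"
      using int[OF t] int[OF qt] by (simp add: inner_add_right algebra_simps)
    then show ?thesis using t q by (simp add: Dq_nonzero)
  qed
  have "solves T0 p k (Dq q \<psi>) w \<upsilon>"
    unfolding solves_def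
  proof (intro conjI ballI)
    fix t assume t: "t \<in> {0..T0}"
    show "\<upsilon> t * inner ones (green (k t)) = Dq q \<psi> t + inner ones (w t)"
    proof (cases "t = 0")
      case True
      have T0: "T0 \<in> {0..T0}" using T by simp
      have "(\<lambda>n. \<upsilon> (T0 * q ^ n) * inner ones (green (k (T0 * q ^ n)))) \<longlonglongrightarrow> \<upsilon> 0 * inner ones (green (k 0))"
        by (rule continuous_at_0_sequence[OF _ T0])
          (intro continuous_intros \<upsilon> kc bounded_linear.continuous_on[OF bounded_linear_green])
      moreover have "(\<lambda>n. Dq q \<psi> (T0 * q ^ n) + inner ones (w (T0 * q ^ n))) \<longlonglongrightarrow> Dq q \<psi> 0 + inner ones (w 0)"
        by (rule continuous_at_0_sequence[OF _ T0]) (intro continuous_intros w kc)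
      moreover have "\<upsilon> (T0 * q ^ n) * inner ones (green (k (T0 * q ^ n))) = Dq q \<psi> (T0 * q ^ n) + inner ones (w (T0 * q ^ n))" for n
        using q_power_in[OF T0, of n] T q by (intro rel) auto
      ultimately show ?thesis using True LIMSEQ_unique by simp
    qed (use rel t in auto)
  qed (use evol w w0 in auto)
  then show ?thesis using that \<upsilon> w by blast
qed

text \<open>The function off the grid is set to \<open>0\<close>; only the value at the point \<open>0\<close> is prescribed there.\<close>

definition grid_fun :: "l2 \<Rightarrow> real \<Rightarrow> real" where
  "grid_fun a x = (if \<exists>n. x = q ^ n then val a (THE n. x = q ^ n) else 0)"

lemma grid_fun_power: "grid_fun a (q ^ n) = val a n"
  by (simp add: grid_fun_def grid_inj)

lemma grid_fun_0: "grid_fun a 0 = 0"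
  using q by (auto simp: grid_fun_def)

text \<open>The over-determination condition is recovered from its differentiated form: the defect is constant
along \<open>t, q t, q\<^sup>2 t, \<dots>\<close>, tends to its value at \<open>0\<close>, and this value is \<open>0\<close> for compatible data.\<close>

lemma solves_solution_pair:
  assumes T: "0 < T0" "T0 \<le> T"
    and \<phi>: "\<And>n. \<phi> (q ^ n) = val (green p) n"
    and k: "continuous_on {0..T} k" "\<And>t n. t \<in> {0..T} \<Longrightarrow> f t (q ^ n) = val (green (k t)) n"
    and \<psi>: "\<psi> \<in> Cq q 1 T" and compat: "compatible_data q \<phi> \<psi>"
    and sol: "solves T0 p k (Dq q \<psi>) w \<upsilon>" and \<upsilon>: "continuous_on {0..T0} \<upsilon>"
  shows "solution_pair q T0 \<phi> f \<psi> (\<lambda>t. grid_fun (green (w t))) \<upsilon>"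
proof -
  define u where "u t = grid_fun (green (w t))" for t
  have u: "u t (q ^ n) = val (green (w t)) n" "u t 0 = 0" "u t 1 = 0" for t n
    using grid_fun_power[of "green (w t)" 0] by (simp_all add: u_def grid_fun_power grid_fun_0)
  have w: "continuous_on {0..T0} w" "w 0 = p" using sol by (simp_all add: solves_def)
  have kc: "continuous_on {0..T0} k" "continuous_on {0..T0} \<psi>"
    using k(1) Cq_1D(1)[OF \<psi>] T by (auto elim: continuous_on_subset)
  have D: "Dqt q u t (q ^ n) = val (\<upsilon> t *\<^sub>R green (k t) - w t) n" if "t \<in> {0..T0}" for t n
    by (rule Dqt_solution[OF T(1) sol \<upsilon> kc(1) _ that]) (rule u(1))
  have int: "jackson_integral q 0 1 (u t) = \<psi> t" if t: "t \<in> {0..T0}" for t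
  proof -
    \<comment> \<open>the defect in the over-determination condition\<close>
    define h where "h t = inner ones (green (w t)) - \<psi> t" for t
    have step: "h (q * t) = h t" if t: "t \<in> {0..T0}" for t
    proof (cases "t = 0")
      case False
      then have t0: "0 < t" "t \<le> T0" using t by auto
      have "inner ones (green (w t) + ((1 - q) * t) *\<^sub>R w t) = inner ones (green (w (q * t)) + ((1 - q) * t * \<upsilon> t) *\<^sub>R green (k t))"
        using sol t0 by (simp add: solves_def)
      then have "inner ones (green (w t)) - inner ones (green (w (q * t)))
          = ((1 - q) * t) * (\<upsilon> t * inner ones (green (k t)) - inner ones (w t))"
        by (simp add: inner_add_right algebra_simps)
      also have "\<upsilon> t * inner ones (green (k t)) - inner ones (w t) = Dq q \<psi> t"
        using sol t by (simp add: solves_def)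
      also have "((1 - q) * t) * Dq q \<psi> t = \<psi> t - \<psi> (q * t)"
        using t0 q by (simp add: Dq_nonzero)
      finally show ?thesis by (simp add: h_def)
    qed simp
    have "h (t * q ^ n) = h t" for n
    proof (induction n)
      case (Suc n)
      then show ?case using step[OF q_power_in[OF t, of n]] by (simp add: mult_ac)
    qed simp
    moreover have "(\<lambda>n. h (t * q ^ n)) \<longlonglongrightarrow> h 0"
      unfolding h_def
      by (rule continuous_at_0_sequence[OF _ t])
        (intro continuous_intros w kc bounded_linear.continuous_on[OF bounded_linear_green])
    ultimately have "h t = h 0" by (simp add: LIMSEQ_const_iff)
    also have "\<dots> = 0"
      using compat jackson_integral_grid[OF \<phi>] by (simp add: h_def compatible_data_def w)
    finally show ?thesis using jackson_integral_grid[OF u(1)] by (simp add: h_def)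
  qed
  have "Dqt q u t x + Lop q (u t) x = \<upsilon> t * f t x" if t: "0 < t" "t \<le> T0" and x: "x \<in> lattice_points q" for t x
  proof -
    obtain n where n: "0 < n" "x = q ^ n" using x by (auto simp: lattice_points_eq)
    then show ?thesis
      using t T k(2)[of t] Lop_of_green[OF u(1) n(1)] D[of t n] by (simp add: val_diff val_scaleR)
  qed
  moreover have "\<upsilon> \<in> Cq q 0 T0" using \<upsilon> by (simp add: Cq_def)
  moreover have "u \<in> CqX q 0 T0 (W2L q) (W2L_norm q)"
    unfolding CqX_W2L_iff using u w by blast
  moreover have "Dqt q u \<in> CqX q 0 T0 (L2q q) (L2q_norm q)"
  proof (rule CqX_L2qI[OF _ D])
    show "continuous_on {0..T0} (\<lambda>t. \<upsilon> t *\<^sub>R green (k t) - w t)"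
      by (intro continuous_intros w \<upsilon> kc bounded_linear.continuous_on[OF bounded_linear_green])
  qed
  moreover have "u 0 x = \<phi> x" if "x \<in> lattice_points q" for x
    using that by (auto simp: lattice_points_eq u w \<phi>)
  ultimately have "solution_pair q T0 \<phi> f \<psi> u \<upsilon>"
    unfolding solution_pair_def using int u by auto
  moreover have "u = (\<lambda>t. grid_fun (green (w t)))" by (simp add: u_def fun_eq_iff)
  ultimately show ?thesis by simp
qed

section \<open>Local well-posedness\<close>

lemma inner_green_le: "\<bar>inner ones (green a)\<bar> \<le> 2 * norm ones * norm a"
proof -
  have "\<bar>inner ones (green a)\<bar> \<le> norm ones * norm (green a)" by (rule Cauchy_Schwarz_ineq2)
  also have "\<dots> \<le> norm ones * (2 * norm a)" by (intro mult_left_mono norm_green_le) simp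
  finally show ?thesis by simp
qed

lemma locally_well_posed_source:
  assumes T: "0 < T" and \<phi>: "\<phi> \<in> W2L q" and f: "f \<in> CqX q 0 T (W2L q) (W2L_norm q)"
    and \<psi>: "\<psi> \<in> Cq q 1 T" and compat: "compatible_data q \<phi> \<psi>" and M: "0 < M"
    and int_f: "\<And>t. 0 < t \<Longrightarrow> t \<le> T \<Longrightarrow>
      jackson_integral q 0 1 (f t) \<noteq> 0 \<and> inverse \<bar>jackson_integral q 0 1 (f t)\<bar> \<le> M"
  shows "locally_well_posed q T \<phi> f \<psi>"
proof -
  obtain p where p: "\<And>n. \<phi> (q ^ n) = val (green p) n"
    using \<phi> unfolding W2L_iff by blast
  obtain k where k: "continuous_on {0..T} k" "\<And>t n. t \<in> {0..T} \<Longrightarrow> f t (q ^ n) = val (green (k t)) n"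
    using f unfolding CqX_W2L_iff by blast
  define F where "F t = inner ones (green (k t))" for t
  \<comment> \<open>half of the lower bound for the integral of \<open>f\<close>, which leaves room for perturbed data\<close>
  define m where "m = 1 / (2 * M)"
  have m: "0 < m" using M by (simp add: m_def)
  have F_pos: "2 * m \<le> \<bar>F t\<bar>" if t: "t \<in> {0..T}" for t
  proof -
    have pos: "2 * m \<le> \<bar>F t\<bar>" if "0 < t" "t \<le> T" for t
    proof -
      have "jackson_integral q 0 1 (f t) = F t"
        unfolding F_def using that by (intro jackson_integral_grid k) simp
      with int_f[OF that] have "F t \<noteq> 0" "inverse \<bar>F t\<bar> \<le> M" by simp_all
      then show ?thesis using M by (simp add: m_def field_simps)
    qed
    show ?thesis
    proof (cases "t = 0")
      case True
      have TT: "T \<in> {0..T}" using T by simp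
      have "(\<lambda>n. \<bar>F (T * q ^ n)\<bar>) \<longlonglongrightarrow> \<bar>F 0\<bar>"
        unfolding F_def
        by (rule continuous_at_0_sequence[OF _ TT])
          (intro continuous_intros k bounded_linear.continuous_on[OF bounded_linear_green])
      moreover have "2 * m \<le> \<bar>F (T * q ^ n)\<bar>" for n
        using q_power_in[OF TT, of n] T q by (intro pos) auto
      ultimately show ?thesis using True by (auto intro: LIMSEQ_le_const)
    qed (use pos t in auto)
  qed
  obtain K\<^sub>0 where "\<forall>r\<in>k ` {0..T}. norm r \<le> K\<^sub>0"
    using compact_imp_bounded[OF compact_continuous_image[OF k(1) compact_Icc]]
    unfolding bounded_iff by blast
  then have K\<^sub>0: "norm (k t) \<le> K\<^sub>0" if "t \<in> {0..T}" for t using that by auto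
  \<comment> \<open>the summand \<open>1\<close> leaves room for perturbed data\<close>
  define K where "K = K\<^sub>0 + 1"
  have K: "0 \<le> K"
  proof -
    have "norm (k 0) \<le> K\<^sub>0" using K\<^sub>0[of 0] T by simp
    then show ?thesis using norm_ge_zero[of "k 0"] unfolding K_def by linarith
  qed
  define a where "a = K * norm ones / m"
  have a: "0 \<le> a" using K m by (simp add: a_def)
  \<comment> \<open>ensures \<open>2 a T0 \<le> 1\<close>, the smallness condition for existence and stability\<close>
  define T0 where "T0 = min T (1 / (2 * a + 1))"
  have T0: "0 < T0" "T0 \<le> T" using T a by (simp_all add: T0_def)
  have small: "2 * (K * norm ones / m * T0) \<le> 1"
  proof -
    have "a * T0 \<le> a * (1 / (2 * a + 1))"
      using a by (intro mult_left_mono) (simp_all add: T0_def)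
    also have "2 * (a * (1 / (2 * a + 1))) \<le> 1" using a by simp
    finally show ?thesis by (simp add: a_def)
  qed
  have solvable: "\<exists>u \<upsilon>. solution_pair q T0 \<phi>' f' \<psi>' u \<upsilon>"
    if "\<And>n. \<phi>' (q ^ n) = val (green p') n"
      "continuous_on {0..T} k'" "\<And>t n. t \<in> {0..T} \<Longrightarrow> f' t (q ^ n) = val (green (k' t)) n"
      "\<psi>' \<in> Cq q 1 T" "compatible_data q \<phi>' \<psi>'"
      "\<And>t. t \<in> {0..T} \<Longrightarrow> norm (k' t) \<le> K" "\<And>t. t \<in> {0..T} \<Longrightarrow> m \<le> \<bar>inner ones (green (k' t))\<bar>"
    for \<phi>' f' \<psi>' p' k'
  proof -
    have "continuous_on {0..T0} k'" "continuous_on {0..T0} (Dq q \<psi>')"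
      using that(2) Cq_1D(2)[OF that(4)] T0 by (auto elim: continuous_on_subset)
    then have "\<exists>w \<upsilon>. continuous_on {0..T0} \<upsilon> \<and> solves T0 p' k' (Dq q \<psi>') w \<upsilon>"
      using T0 that m small by (intro existence[where K = K and m = m]) auto
    then show ?thesis using solves_solution_pair[OF T0 that(1-5)] by blast
  qed
  have kK: "norm (k t) \<le> K" "m \<le> \<bar>inner ones (green (k t))\<bar>" if "t \<in> {0..T}" for t
    using K\<^sub>0[OF that] F_pos[OF that] m by (simp_all add: K_def F_def)
  have dependence: "\<exists>\<delta>>0. \<forall>\<phi>' f' \<psi>'.
       (\<phi>', f', \<psi>') \<in> data_space q T \<and> compatible_data q \<phi>' \<psi>' \<and>
       W2L_norm q (\<lambda>x. \<phi>' x - \<phi> x) < \<delta> \<and>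
       CqX_norm q 0 T (W2L_norm q) (\<lambda>t x. f' t x - f t x) < \<delta> \<and>
       Cq_norm q 1 T (\<lambda>t. \<psi>' t - \<psi> t) < \<delta> \<longrightarrow>
       (\<exists>u' \<upsilon>'. solution_pair q T0 \<phi>' f' \<psi>' u' \<upsilon>') \<and>
       (\<forall>u' \<upsilon>'. solution_pair q T0 \<phi>' f' \<psi>' u' \<upsilon>' \<longrightarrow>
          Cq_norm q 0 T0 (\<lambda>t. \<upsilon>' t - \<upsilon> t) < \<epsilon> \<and>
          CqX_norm q 0 T0 (W2L_norm q) (\<lambda>t x. u' t x - u t x) < \<epsilon> \<and>
          CqX_norm q 0 T0 (L2q_norm q) (Dqt q (\<lambda>t x. u' t x - u t x)) < \<epsilon>)"
    if sp: "solution_pair q T0 \<phi> f \<psi> u \<upsilon>" and \<epsilon>: "0 < \<epsilon>" for u \<upsilon> \<epsilon>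
  proof -
    obtain w where w: "solves T0 p k (Dq q \<psi>) w \<upsilon>" "continuous_on {0..T0} \<upsilon>"
      "\<And>t n. t \<in> {0..T0} \<Longrightarrow> u t (q ^ n) = val (green (w t)) n"
      using solution_pair_solves[OF T0 p k \<psi> sp] by blast
    obtain C where C: "0 < C" and est: "\<And>p' k' \<eta>' w' \<upsilon>' \<delta> t. \<lbrakk>solves T0 p' k' \<eta>' w' \<upsilon>';
      \<And>t. t \<in> {0..T0} \<Longrightarrow> norm (k' t) \<le> K; \<And>t. t \<in> {0..T0} \<Longrightarrow> m \<le> \<bar>inner ones (green (k' t))\<bar>;
      norm (p' - p) \<le> \<delta>; \<And>t. t \<in> {0..T0} \<Longrightarrow> norm (k' t - k t) \<le> \<delta>;
      \<And>t. t \<in> {0..T0} \<Longrightarrow> \<bar>\<eta>' t - Dq q \<psi> t\<bar> \<le> \<delta>; t \<in> {0..T0}\<rbrakk> \<Longrightarrow>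
      \<bar>\<upsilon>' t - \<upsilon> t\<bar> \<le> C * \<delta> \<and> norm (w' t - w t) \<le> C * \<delta> \<and>
      norm ((\<upsilon>' t *\<^sub>R green (k' t) - w' t) - (\<upsilon> t *\<^sub>R green (k t) - w t)) \<le> C * \<delta>"
      using continuous_dependence[OF w(1,2) less_imp_le[OF T0(1)] K m small] by blast
    \<comment> \<open>the first two bounds keep perturbed data within \<open>K\<close> and \<open>m\<close>, the third one makes \<open>C \<delta> < \<epsilon>\<close>\<close>
    define \<delta> where "\<delta> = min 1 (min (m / (2 * norm ones + 1)) (\<epsilon> / (2 * C)))"
    have \<delta>: "0 < \<delta>" using m \<epsilon> C by (simp add: \<delta>_def add_nonneg_pos)
    have \<delta>1: "\<delta> \<le> 1" and \<delta>C: "C * \<delta> < \<epsilon>" and \<delta>m: "2 * norm ones * \<delta> \<le> m"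
    proof -
      show "\<delta> \<le> 1" by (simp add: \<delta>_def)
      have "\<delta> \<le> \<epsilon> / (2 * C)" by (simp add: \<delta>_def)
      then have "C * \<delta> \<le> \<epsilon> / 2" using C by (simp add: field_simps)
      then show "C * \<delta> < \<epsilon>" using \<epsilon> by simp
      have "\<delta> \<le> m / (2 * norm ones + 1)" by (simp add: \<delta>_def)
      then have "\<delta> * (2 * norm ones + 1) \<le> m"
        by (subst (asm) pos_le_divide_eq) (simp_all add: add_nonneg_pos)
      then show "2 * norm ones * \<delta> \<le> m" using \<delta> by (simp add: algebra_simps)
    qed
    show ?thesis
    proof (rule exI[of _ \<delta>], intro conjI allI impI)
      show "0 < \<delta>" by (rule \<delta>)
      fix \<phi>' f' \<psi>'
      assume *: "(\<phi>', f', \<psi>') \<in> data_space q T \<and> compatible_data q \<phi>' \<psi>' \<and>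
       W2L_norm q (\<lambda>x. \<phi>' x - \<phi> x) < \<delta> \<and>
       CqX_norm q 0 T (W2L_norm q) (\<lambda>t x. f' t x - f t x) < \<delta> \<and>
       Cq_norm q 1 T (\<lambda>t. \<psi>' t - \<psi> t) < \<delta>"
      then have data: "\<phi>' \<in> W2L q" "f' \<in> CqX q 0 T (W2L q) (W2L_norm q)" "\<psi>' \<in> Cq q 1 T"
        "compatible_data q \<phi>' \<psi>'" by (auto simp: data_space_def)
      obtain p' where p': "\<And>n. \<phi>' (q ^ n) = val (green p') n"
        using data(1) unfolding W2L_iff by blast
      obtain k' where k': "continuous_on {0..T} k'" "\<And>t n. t \<in> {0..T} \<Longrightarrow> f' t (q ^ n) = val (green (k' t)) n"
        using data(2) unfolding CqX_W2L_iff by blast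
      have near: "norm (p' - p) \<le> \<delta>" "\<And>t. t \<in> {0..T} \<Longrightarrow> norm (k' t - k t) \<le> \<delta>"
        "\<And>t. t \<in> {0..T} \<Longrightarrow> \<bar>Dq q \<psi>' t - Dq q \<psi> t\<bar> \<le> \<delta>"
        using * W2L_norm_diff[OF p' p] le_CqX_norm_W2L[OF k' k] le_Cq_norm_1[OF T \<psi> data(3)] by force+
      have k'K: "norm (k' t) \<le> K" "m \<le> \<bar>inner ones (green (k' t))\<bar>" if t: "t \<in> {0..T}" for t
      proof -
        show "norm (k' t) \<le> K"
          using norm_triangle_sub[of "k' t" "k t"] near(2)[OF t] \<delta>1 K\<^sub>0[OF t] by (simp add: K_def)
        have "\<bar>inner ones (green (k' t - k t))\<bar> \<le> 2 * norm ones * norm (k' t - k t)"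
          by (rule inner_green_le)
        also have "\<dots> \<le> 2 * norm ones * \<delta>" using near(2)[OF t] by (intro mult_left_mono) auto
        also have "\<dots> \<le> m" by (rule \<delta>m)
        finally have "\<bar>inner ones (green (k' t)) - F t\<bar> \<le> m"
          by (simp add: F_def G_diff inner_diff_right)
        then show "m \<le> \<bar>inner ones (green (k' t))\<bar>" using F_pos[OF t] by linarith
      qed
      show "\<exists>u' \<upsilon>'. solution_pair q T0 \<phi>' f' \<psi>' u' \<upsilon>'"
        using solvable[OF p' k' data(3,4) k'K] by blast
      fix u' \<upsilon>' assume sp': "solution_pair q T0 \<phi>' f' \<psi>' u' \<upsilon>'"
      obtain w' where w': "solves T0 p' k' (Dq q \<psi>') w' \<upsilon>'" "continuous_on {0..T0} \<upsilon>'"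
        "\<And>t n. t \<in> {0..T0} \<Longrightarrow> u' t (q ^ n) = val (green (w' t)) n"
        using solution_pair_solves[OF T0 p' k' data(3) sp'] by blast
      have sub: "t \<in> {0..T}" if "t \<in> {0..T0}" for t using that T0 by simp
      have est': "\<bar>\<upsilon>' t - \<upsilon> t\<bar> \<le> C * \<delta>" "norm (w' t - w t) \<le> C * \<delta>"
        "norm ((\<upsilon>' t *\<^sub>R green (k' t) - w' t) - (\<upsilon> t *\<^sub>R green (k t) - w t)) \<le> C * \<delta>"
        if "t \<in> {0..T0}" for t
        using est[OF w'(1) k'K near that] sub by blast+
      have kc: "continuous_on {0..T0} k" "continuous_on {0..T0} k'"
        using k(1) k'(1) T0 by (auto elim: continuous_on_subset)
      have wc: "continuous_on {0..T0} w" "continuous_on {0..T0} w'"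
        using w(1) w'(1) by (simp_all add: solves_def)
      have "Cq_norm q 0 T0 (\<lambda>t. \<upsilon>' t - \<upsilon> t) \<le> C * \<delta>"
        using T0 est'(1) by (intro Cq_norm_0_le) auto
      then show "Cq_norm q 0 T0 (\<lambda>t. \<upsilon>' t - \<upsilon> t) < \<epsilon>" using \<delta>C by simp
      have "CqX_norm q 0 T0 (W2L_norm q) (\<lambda>t x. u' t x - u t x) \<le> C * \<delta>"
        using T0 est'(2) W2L_norm_diff[OF w'(3) w(3)] by (intro CqX_norm_le) auto
      then show "CqX_norm q 0 T0 (W2L_norm q) (\<lambda>t x. u' t x - u t x) < \<epsilon>" using \<delta>C by simp
      have D: "Dqt q (\<lambda>t x. u' t x - u t x) t (q ^ n)
          = val ((\<upsilon>' t *\<^sub>R green (k' t) - w' t) - (\<upsilon> t *\<^sub>R green (k t) - w t)) n"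
        if t: "t \<in> {0..T0}" for t n
        unfolding Dqt_def
      proof (rule Dq_eqI[OF T0(1) _ _ t])
        show "continuous_on {0..T0} (\<lambda>t. val ((\<upsilon>' t *\<^sub>R green (k' t) - w' t) - (\<upsilon> t *\<^sub>R green (k t) - w t)) n)"
          by (intro bounded_linear.continuous_on[OF bounded_linear_val] continuous_intros w w' kc wc
              bounded_linear.continuous_on[OF bounded_linear_green])
        fix t assume t: "0 < t" "t \<le> T0"
        have "Dqt q u' t (q ^ n) = val (\<upsilon>' t *\<^sub>R green (k' t) - w' t) n"
          by (rule Dqt_solution[OF T0(1) w'(1,2) kc(2)]) (use w'(3) t in auto)
        moreover have "Dqt q u t (q ^ n) = val (\<upsilon> t *\<^sub>R green (k t) - w t) n"
          by (rule Dqt_solution[OF T0(1) w(1,2) kc(1)]) (use w(3) t in auto)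
        ultimately show "(u' t (q ^ n) - u t (q ^ n) - (u' (q * t) (q ^ n) - u (q * t) (q ^ n))) / ((1 - q) * t)
            = val ((\<upsilon>' t *\<^sub>R green (k' t) - w' t) - (\<upsilon> t *\<^sub>R green (k t) - w t)) n"
          using t by (simp add: Dqt_def Dq_nonzero val_diff[of "_ - _"] diff_divide_distrib)
      qed
      have "CqX_norm q 0 T0 (L2q_norm q) (Dqt q (\<lambda>t x. u' t x - u t x)) \<le> C * \<delta>"
        using T0 est'(3) L2q_norm_grid[OF D] by (intro CqX_norm_le) auto
      then show "CqX_norm q 0 T0 (L2q_norm q) (Dqt q (\<lambda>t x. u' t x - u t x)) < \<epsilon>" using \<delta>C by simp
    qed
  qed
  have unique: "\<upsilon>' t = \<upsilon> t \<and> L2q_norm q (\<lambda>x. u' t x - u t x) = 0"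
    if sp: "solution_pair q T0 \<phi> f \<psi> u \<upsilon>" and sp': "solution_pair q T0 \<phi> f \<psi> u' \<upsilon>'"
      and t: "t \<in> {0..T0}" for u \<upsilon> u' \<upsilon>' t
  proof -
    obtain w where w: "solves T0 p k (Dq q \<psi>) w \<upsilon>" "continuous_on {0..T0} \<upsilon>"
      "\<And>t n. t \<in> {0..T0} \<Longrightarrow> u t (q ^ n) = val (green (w t)) n"
      using solution_pair_solves[OF T0 p k \<psi> sp] by blast
    obtain w' where w': "solves T0 p k (Dq q \<psi>) w' \<upsilon>'" "continuous_on {0..T0} \<upsilon>'"
      "\<And>t n. t \<in> {0..T0} \<Longrightarrow> u' t (q ^ n) = val (green (w' t)) n"
      using solution_pair_solves[OF T0 p k \<psi> sp'] by blast
    have kK': "norm (k t) \<le> K" "m \<le> \<bar>inner ones (green (k t))\<bar>" if "t \<in> {0..T0}" for t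
      using kK[of t] that T0 by simp_all
    have eq: "\<upsilon>' t = \<upsilon> t" "w' t = w t"
      using solves_unique[OF w(1) w'(1) w(2) kK'(1) m kK'(2) small t] by auto
    have "L2q_norm q (\<lambda>x. u' t x - u t x) = norm (green (w' t) - green (w t))"
      using t by (intro L2q_norm_grid) (simp add: w w' val_diff)
    then show ?thesis using eq by simp
  qed
  have "\<exists>u \<upsilon>. solution_pair q T0 \<phi> f \<psi> u \<upsilon>"
    by (rule solvable[OF p k \<psi> compat kK])
  then show ?thesis
    unfolding locally_well_posed_def using T0 unique dependence by (intro exI[of _ T0]) blast
qed

end

theorem theorem3p1:
  fixes q T M\<^sub>1 :: real
    and \<phi> :: "real \<Rightarrow> real" and f :: "real \<Rightarrow> real \<Rightarrow> real" and \<psi> :: "real \<Rightarrow> real"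
  assumes "0 < q" and "q < 1" and "0 < T"
    and "\<phi> \<in> W2L q"
    and "f \<in> CqX q 0 T (W2L q) (W2L_norm q)"
    and "\<psi> \<in> Cq q 1 T"
    and "compatible_data q \<phi> \<psi>"
    and "0 < M\<^sub>1"
    and "\<And>t. 0 < t \<Longrightarrow> t \<le> T \<Longrightarrow>
           jackson_integral q 0 1 (f t) \<noteq> 0 \<and> inverse \<bar>jackson_integral q 0 1 (f t)\<bar> \<le> M\<^sub>1"
  shows "locally_well_posed q T \<phi> f \<psi>"
proof -
  interpret geometric_grid q by unfold_locales (rule assms)+
  show ?thesis by (rule locally_well_posed_source[OF assms(3-9)])
qed

end
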